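(* Assume $\gamma\in(1,2)$ and $0<\alpha<1-\gamma^{-1}$. Then there exists $\beta_0\in(0,1]$ (depending on the inter-arrival law $K$ and on the distribution of $\omega_1$) such that for all $\beta\in(0,\beta_0)$ we have $h_c(\beta)=0$ and $$\lim_{h\to 0+}\frac{\log \mathrm{F}(\beta,h)}{\log h}=\frac1\alpha .$$
   Context: Renewal: $\tau=(\tau_n)_{n\ge0}$ is a renewal process under $\mathbf P$ (expectation $\mathbf E$), $\tau_0=0$, with i.i.d. positive integer increments of law $K(n):=\mathbf P[\tau_1=n]$, $\sum_{n\ge1}K(n)=1$ (recurrent), and $K(n)\sim C_K n^{-(1+\alpha)}$ as $n\to\infty$ for some constant $C_K>0$ and $\alpha\in(0,\infty)$. $\tau$ is also viewed as a random subset of the nonnegative integers. Environment: $(\omega_n)_{n\ge0}$ are i.i.d. real random variables under $\mathbb P$ (expectation $\mathbb E$) with $\mathbb P[\omega_1\ge-1]=1$, $\mathbb E[\omega_1]=0$ and $\mathbb P[\omega_1\ge x]\sim C_{\mathbb P}x^{-\gamma}$ as $x\to\infty$, for some constant $C_{\mathbb P}>0$ and $\gamma\in(1,2)$. Pinning model: for $\beta\in[0,1)$, $h\in\mathbb R$, $N\in\mathbb N$, $$Z^{\beta,\omega}_{N,h}:=\mathbf E\Big[\Big(\prod_{n\in\tau\cap[1,N]}e^h(\beta\omega_n+1)\Big)\mathbf 1_{\{N\in\tau\}}\Big].$$ Free energy: $\mathrm F(\beta,h):=\lim_{N\to\infty}\frac1N\log Z^{\beta,\omega}_{N,h}$ ($\mathbb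 P$-a.s. limit, which is known to exist, to be finite, nonnegative, non-random, and equal to $\lim_N\frac1N\mathbb E[\log Z^{\beta,\omega}_{N,h}]$); it is non-decreasing and convex in $h$. Critical point: $h_c(\beta):=\inf\{h\in\mathbb R:\mathrm F(\beta,h)>0\}$. *)

theory Defs
  imports "HOL-Probability.Probability" "HOL-Library.Landau_Symbols"
begin

definition inter_arrival_law :: "(nat \<Rightarrow> real) \<Rightarrow> real \<Rightarrow> real \<Rightarrow> bool" where
  "inter_arrival_law K \<alpha> C\<^sub>K \<longleftrightarrow>
     (\<forall>n. 0 \<le> K n) \<and> K 0 = 0 \<and> K sums 1 \<and>
     0 < C\<^sub>K \<and> K \<sim>[at_top] (\<lambda>n. C\<^sub>K * real n powr (- (1 + \<alpha>)))"

text \<open>The subtraction of natural numbers never truncates, because the paths are increasing.\<close>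

definition renewal_process ::
  "'a measure \<Rightarrow> (nat \<Rightarrow> real) \<Rightarrow> (nat \<Rightarrow> 'a \<Rightarrow> nat) \<Rightarrow> bool" where
  "renewal_process P K \<tau> \<longleftrightarrow>
     prob_space P \<and>
     (\<forall>x\<in>space P. \<tau> 0 x = 0 \<and> strict_mono (\<lambda>n. \<tau> n x)) \<and>
     prob_space.indep_vars P (\<lambda>_. count_space UNIV) (\<lambda>n x. \<tau> (Suc n) x - \<tau> n x) UNIV \<and>
     (\<forall>n k. measure P {x \<in> space P. \<tau> (Suc n) x - \<tau> n x = k} = K k)"

definition disorder_law :: "real measure \<Rightarrow> real \<Rightarrow> real \<Rightarrow> bool" where
  "disorder_law D \<gamma> C\<^sub>P \<longleftrightarrow>
     prob_space D \<and> sets D = sets borel \<and>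
     measure D {-1..} = 1 \<and>
     integrable D (\<lambda>x. x) \<and> (\<integral>x. x \<partial>D) = 0 \<and>
     0 < C\<^sub>P \<and> (\<lambda>x. measure D {x..}) \<sim>[at_top] (\<lambda>x. C\<^sub>P * x powr (- \<gamma>))"

definition iid_environment ::
  "'b measure \<Rightarrow> real measure \<Rightarrow> (nat \<Rightarrow> 'b \<Rightarrow> real) \<Rightarrow> bool" where
  "iid_environment M D \<omega> \<longleftrightarrow>
     prob_space M \<and>
     prob_space.indep_vars M (\<lambda>_. borel) \<omega> UNIV \<and>
     (\<forall>n. distr M borel (\<omega> n) = D)"

definition renewal_set :: "(nat \<Rightarrow> 'a \<Rightarrow> nat) \<Rightarrow> 'a \<Rightarrow> nat set" where
  "renewal_set \<tau> x = range (\<lambda>k. \<tau> k x)"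

text \<open>Here \<open>w\<close> is a single realization of the environment.\<close>

definition partition_function ::
  "'a measure \<Rightarrow> (nat \<Rightarrow> 'a \<Rightarrow> nat) \<Rightarrow> real \<Rightarrow> real \<Rightarrow> (nat \<Rightarrow> real) \<Rightarrow> nat \<Rightarrow> real" where
  "partition_function P \<tau> \<beta> h w N =
     (\<integral>x. (\<Prod>n \<in> renewal_set \<tau> x \<inter> {1..N}. exp h * (\<beta> * w n + 1))
          * indicator (renewal_set \<tau> x) N \<partial>P)"

text \<open>
  The free energy is the almost sure, non-random limit of \<open>(1/N) log Z\<close>.  The partition
  function may vanish for finitely many \<open>N\<close> (where \<open>K\<close> vanishes); the convention
  \<open>ln 0 = 0\<close> used there does not affect the limit.
\<close>

definition free_energy ::
  "'a measure \<Rightarrow> (nat \<Rightarrow> 'a \<Rightarrow> nat) \<Rightarrow> 'b measure \<Rightarrow> (nat \<Rightarrow> 'b \<Rightarrow> real) \<Rightarrow> real \<Rightarrow> real \<Rightarrow> real" where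
  "free_energy P \<tau> M \<omega> \<beta> h =
     (THE c. AE y in M.
        (\<lambda>N. 1 / real N * ln (partition_function P \<tau> \<beta> h (\<lambda>n. \<omega> n y) N)) \<longlonglongrightarrow> c)"

definition critical_point ::
  "'a measure \<Rightarrow> (nat \<Rightarrow> 'a \<Rightarrow> nat) \<Rightarrow> 'b measure \<Rightarrow> (nat \<Rightarrow> 'b \<Rightarrow> real) \<Rightarrow> real \<Rightarrow> real" where
  "critical_point P \<tau> M \<omega> \<beta> = Inf {h. free_energy P \<tau> M \<omega> \<beta> h > 0}"

end

theory Submission
  imports Defs "HOL-Real_Asymp.Real_Asymp"
begin

text \<open>
  The partition function obeys the renewal recursion
  \<open>Z N = exp h * (\<beta> * \<omega> N + 1) * (\<Sum>m<N. Z m * K (N - m))\<close>. Its logarithm is superadditive and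
  its variance is of order \<open>N\<close>, by resampling one disorder variable at a time; so \<open>ln (Z N) / N\<close>
  converges almost surely along the squares, and superadditivity fills the gaps. The limit is at
  most the exponent of the pure model, hence zero for \<open>h \<le> 0\<close> and at most of order
  \<open>h powr (1 / \<alpha>)\<close> for \<open>h > 0\<close>.

  For the lower bound take \<open>p < \<gamma>\<close> with \<open>p * (1 - \<alpha>) > 1\<close>. At \<open>h = 0\<close> the partition function
  with free endpoint is a martingale in \<open>N\<close>, bounded in \<open>L p\<close> for small \<open>\<beta>\<close> because the renewal
  mass function is \<open>p\<close>-summable. By a Paley-Zygmund argument, paths with about \<open>N powr s\<close> contacts
  (\<open>s < \<alpha>\<close>) carry a fixed mass with probability bounded below. Such paths gain \<open>h * N powr s\<close>, which
  beats the logarithmic cost of pinning the endpoint as soon as \<open>N\<close> exceeds a power of \<open>1 / h\<close>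
  slightly larger than \<open>1 / \<alpha>\<close>.
\<close>

section \<open>The renewal recursion\<close>

text \<open>Because that inequality is strict, the sharp order n powr (\<alpha> - 1) of the renewal
  mass can be replaced by n powr -\<theta> with \<theta> slightly below 1 - \<alpha>. This weaker
  bound is elementary: forbid jumps above n powr r and use that the truncated law is defective. In
  the same way moments of K of order s < \<alpha> stand in for stable limit theorems. The p-th
  moments close up because \<open>approach K w N\<close>, the mass that reaches N before the weight
  of N is collected, does not involve \<open>w N\<close>. It is the coefficient of the martingale
  increment at N, and it obeys a resolvent identity of the same martingale form, so its moments
  satisfy a convolution inequality.\<close>

primrec walk :: "(nat \<Rightarrow> real) \<Rightarrow> (nat \<Rightarrow> real) \<Rightarrow> nat \<Rightarrow> nat \<Rightarrow> real" where
  "walk K w 0 N = of_bool (N = 0)"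
| "walk K w (Suc k) N = w N * (\<Sum>m<N. walk K w k m * K (N - m))"

text \<open>\<open>walk\<close> records the number \<open>k\<close> of contacts, so that the field
  factors out as \<open>exp h ^ k\<close> and paths with few contacts can be split off. Jumps have
  length at least 1, so \<open>k \<le> N\<close> exhausts all paths.\<close>

definition pinned :: "(nat \<Rightarrow> real) \<Rightarrow> (nat \<Rightarrow> real) \<Rightarrow> nat \<Rightarrow> real" where
  "pinned K w N = (\<Sum>k\<le>N. walk K w k N)"

text \<open>The mass that reaches \<open>N\<close> before the weight of \<open>N\<close> is
  collected; only \<open>w i\<close> with \<open>0 < i < N\<close> enter.\<close>

definition approach :: "(nat \<Rightarrow> real) \<Rightarrow> (nat \<Rightarrow> real) \<Rightarrow> nat \<Rightarrow> real" where
  "approach K w N = (\<Sum>m<N. pinned K w m * K (N - m))"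

text \<open>For \<open>K sums 1\<close>, the probability of a jump longer than
  \<open>n\<close>.\<close>

definition tail :: "(nat \<Rightarrow> real) \<Rightarrow> nat \<Rightarrow> real" where
  "tail K n = 1 - (\<Sum>j\<le>n. K j)"

lemma walk_eq_0: "N < k \<Longrightarrow> walk K w k N = 0"
proof (induction k arbitrary: N)
  case (Suc k)
  then show ?case by (auto intro!: sum.neutral)
qed simp

lemma pinned_eq_sum: "N \<le> n \<Longrightarrow> pinned K w N = (\<Sum>k\<le>n. walk K w k N)"
  unfolding pinned_def by (intro sum.mono_neutral_left) (auto simp: walk_eq_0)

lemma pinned_0 [simp]: "pinned K w 0 = 1"
  by (simp add: pinned_def)

lemma pinned_rec:
  assumes "0 < N"
  shows "pinned K w N = w N * approach K w N"
proof -
  obtain n where n: "N = Suc n" using assms gr0_implies_Suc by blast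
  have "pinned K w N = (\<Sum>k\<le>n. walk K w (Suc k) N)"
    unfolding pinned_def n by (subst sum.atMost_Suc_shift) simp
  also have "\<dots> = w N * (\<Sum>k\<le>n. \<Sum>m<N. walk K w k m * K (N - m))"
    by (simp add: sum_distrib_left)
  also have "(\<Sum>k\<le>n. \<Sum>m<N. walk K w k m * K (N - m)) = (\<Sum>m<N. \<Sum>k\<le>n. walk K w k m * K (N - m))"
    by (rule sum.swap)
  also have "\<dots> = (\<Sum>m<N. pinned K w m * K (N - m))"
    by (intro sum.cong refl) (auto simp: n pinned_eq_sum[of _ n] sum_distrib_right)
  finally show ?thesis by (simp add: approach_def)
qed

lemma walk_cong: "(\<And>i. 0 < i \<Longrightarrow> i \<le> N \<Longrightarrow> w i = w' i) \<Longrightarrow> walk K w k N = walk K w' k N"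
proof (induction k arbitrary: N)
  case (Suc k)
  show ?case
  proof (cases "N = 0")
    case False
    have "walk K w k m = walk K w' k m" if "m < N" for m
      by (rule Suc.IH) (use Suc.prems that in auto)
    then show ?thesis using Suc.prems[of N] False by simp
  qed simp
qed simp

lemma pinned_cong: "(\<And>i. 0 < i \<Longrightarrow> i \<le> N \<Longrightarrow> w i = w' i) \<Longrightarrow> pinned K w N = pinned K w' N"
  unfolding pinned_def by (intro sum.cong refl walk_cong) auto

lemma approach_cong: "(\<And>i. 0 < i \<Longrightarrow> i < N \<Longrightarrow> w i = w' i) \<Longrightarrow> approach K w N = approach K w' N"
  unfolding approach_def by (intro sum.cong refl arg_cong2[of _ _ _ _ "(*)"] pinned_cong) auto

lemma walk_nonneg:
  assumes "\<And>n. 0 \<le> K n" "\<And>n. 0 \<le> w n"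
  shows "0 \<le> walk K w k N"
proof (induction k arbitrary: N)
  case (Suc k)
  then show ?case using assms by (auto intro!: mult_nonneg_nonneg sum_nonneg)
qed simp

lemma pinned_nonneg:
  assumes "\<And>n. 0 \<le> K n" "\<And>n. 0 \<le> w n"
  shows "0 \<le> pinned K w N"
  unfolding pinned_def using walk_nonneg[OF assms] by (intro sum_nonneg) auto

lemma approach_nonneg:
  assumes "\<And>n. 0 \<le> K n" "\<And>n. 0 \<le> w n"
  shows "0 \<le> approach K w N"
  unfolding approach_def using pinned_nonneg[OF assms] assms by (intro sum_nonneg) auto

lemma walk_scale: "walk K (\<lambda>n. c * w n) k N = c ^ k * walk K w k N"
proof (induction k arbitrary: N)
  case (Suc k)
  then show ?case by (simp add: sum_distrib_left algebra_simps)
qed simp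

text \<open>A path visits the site \<open>i\<close> at most once, so the factor \<open>r\<close> is
  collected at most once; \<open>1 \<le> r\<close> covers the paths that avoid
  \<open>i\<close>.\<close>

lemma pinned_le_scale:
  assumes K: "\<And>n. 0 \<le> K n" and w: "\<And>n. 0 \<le> w n" and r: "1 \<le> r"
    and w': "\<And>n. n \<noteq> i \<Longrightarrow> w' n = w n" "w' i = r * w i"
  shows "pinned K w' N \<le> r * pinned K w N"
proof (induction N rule: less_induct)
  case (less N)
  show ?case
  proof (cases "N = 0")
    case False
    show ?thesis
    proof (cases "N = i")
      case True
      then have "approach K w' N = approach K w N" by (intro approach_cong w') auto
      then show ?thesis using pinned_rec[of N K w'] pinned_rec[of N K w] True False w' by simp
    next
      case neq: False
      have "approach K w' N \<le> (\<Sum>m<N. r * pinned K w m * K (N - m))"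
        unfolding approach_def using less K by (intro sum_mono mult_right_mono) auto
      also have "\<dots> = r * approach K w N" by (simp add: approach_def sum_distrib_left mult.assoc)
      finally have "w N * approach K w' N \<le> w N * (r * approach K w N)" using w by (intro mult_left_mono) auto
      then show ?thesis using pinned_rec[of N K w'] pinned_rec[of N K w] neq False w' by (simp add: mult_ac)
    qed
  qed (use r in simp)
qed

lemma walk_mono:
  assumes K: "\<And>n. 0 \<le> K n" and w: "\<And>n. 0 \<le> w n" and le: "\<And>n. w n \<le> w' n"
  shows "walk K w k N \<le> walk K w' k N"
proof (induction k arbitrary: N)
  case (Suc k)
  show ?case unfolding walk.simps
    by (intro mult_mono le sum_mono mult_right_mono Suc K sum_nonneg mult_nonneg_nonneg walk_nonneg w)
       (use w le order_trans in blast)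
qed simp

lemma pinned_mono:
  assumes K: "\<And>n. 0 \<le> K n" and w: "\<And>n. 0 \<le> w n" and le: "\<And>n. w n \<le> w' n"
  shows "pinned K w N \<le> pinned K w' N"
  unfolding pinned_def by (intro sum_mono walk_mono assms)

text \<open>Only the paths through \<open>n\<close> are kept; beyond \<open>n\<close> they see the
  shifted environment.\<close>

lemma pinned_superadd:
  assumes K: "\<And>n. 0 \<le> K n" and w: "\<And>n. 0 \<le> w n"
  shows "pinned K w n * pinned K (\<lambda>i. w (n + i)) m \<le> pinned K w (n + m)"
proof (induction m rule: less_induct)
  case (less m)
  let ?w = "\<lambda>i. w (n + i)"
  show ?case
  proof (cases "m = 0")
    case False
    have "pinned K w n * approach K ?w m = (\<Sum>j<m. pinned K w n * pinned K ?w j * K (m - j))"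
      by (simp add: approach_def sum_distrib_left mult.assoc)
    also have "\<dots> \<le> (\<Sum>j<m. pinned K w (n + j) * K (m - j))"
      using less K by (intro sum_mono mult_right_mono) auto
    also have "\<dots> = (\<Sum>j\<in>(+) n ` {..<m}. pinned K w j * K (n + m - j))"
      by (subst sum.reindex) auto
    also have "\<dots> \<le> approach K w (n + m)"
      unfolding approach_def using K pinned_nonneg[of K w] w by (intro sum_mono2) auto
    finally have "w (n + m) * (pinned K w n * approach K ?w m) \<le> w (n + m) * approach K w (n + m)"
      using w by (intro mult_left_mono) auto
    then show ?thesis using pinned_rec[of m K ?w] pinned_rec[of "n + m" K w] False by (simp add: mult_ac)
  qed simp
qed

lemma pinned_ge_jump:
  assumes K: "\<And>n. 0 \<le> K n" and w: "\<And>n. 0 \<le> w n" and N: "0 < N"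
  shows "w N * K N \<le> pinned K w N"
proof -
  have "(\<Sum>m\<in>{0}. pinned K w m * K (N - m)) \<le> approach K w N"
    unfolding approach_def using N K pinned_nonneg[of K w] w by (intro sum_mono2) auto
  then have "w N * K N \<le> w N * approach K w N" using w by (intro mult_left_mono) auto
  then show ?thesis using pinned_rec[of N K w] N by simp
qed

lemma approach_const1: "0 < N \<Longrightarrow> approach K (\<lambda>_. 1) N = pinned K (\<lambda>_. 1) N"
  using pinned_rec[of N K "\<lambda>_. 1"] by simp

section \<open>Resolvent and martingale identities\<close>

lemma sum_triangle:
  fixes N :: nat
  shows "(\<Sum>l\<in>{1..<N}. \<Sum>m\<in>{1..<l}. f l m) = (\<Sum>m\<in>{1..<N}. \<Sum>l\<in>{m<..<N}. f l m)"
proof -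
  have "(\<Sum>l\<in>{1..<N}. \<Sum>m\<in>{1..<l}. f l m) = (\<Sum>l\<in>{1..<N}. \<Sum>m | m \<in> {1..<N} \<and> m < l. f l m)"
    by (intro sum.cong refl) auto
  also have "\<dots> = (\<Sum>m\<in>{1..<N}. \<Sum>l | l \<in> {1..<N} \<and> m < l. f l m)"
    by (rule sum.swap_restrict) auto
  also have "\<dots> = (\<Sum>m\<in>{1..<N}. \<Sum>l\<in>{m<..<N}. f l m)"
    by (intro sum.cong refl) auto
  finally show ?thesis .
qed

text \<open>A Duhamel formula: write each weight as \<open>1 + (w m - 1)\<close> and split at the
  last site \<open>m\<close> where the second part is taken; from there on the path is a pure
  renewal. Since \<open>approach K w m\<close> does not involve \<open>w m\<close>, centred
  independent disorder makes the sum a martingale.\<close>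

lemma approach_resolvent:
  fixes K w :: "nat \<Rightarrow> real"
  assumes "0 < N"
  defines "u \<equiv> pinned K (\<lambda>_. 1)"
  shows "approach K w N = u N + (\<Sum>m\<in>{1..<N}. (w m - 1) * approach K w m * u (N - m))"
  using assms(1)
proof (induction N rule: less_induct)
  case (less N)
  let ?a = "approach K w"
  have split: "(\<Sum>m<N. f m) = f 0 + (\<Sum>m\<in>{1..<N}. f m)" for f :: "nat \<Rightarrow> real"
  proof -
    have "{..<N} = insert 0 {1..<N}" using less.prems by auto
    then show ?thesis by simp
  qed
  have u: "u n = (\<Sum>m<n. u m * K (n - m))" if "0 < n" for n
    using approach_const1[OF that, of K] unfolding u_def approach_def by simp
  have "?a N = K N + (\<Sum>l\<in>{1..<N}. w l * ?a l * K (N - l))"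
    unfolding approach_def[of K w N] split by (simp add: pinned_rec)
  also have "(\<Sum>l\<in>{1..<N}. w l * ?a l * K (N - l)) =
      (\<Sum>l\<in>{1..<N}. (w l - 1) * ?a l * K (N - l)) + (\<Sum>l\<in>{1..<N}. ?a l * K (N - l))"
    by (simp add: sum.distrib[symmetric] algebra_simps)
  also have "(\<Sum>l\<in>{1..<N}. ?a l * K (N - l)) =
     (\<Sum>l\<in>{1..<N}. u l * K (N - l)) + (\<Sum>l\<in>{1..<N}. \<Sum>m\<in>{1..<l}. (w m - 1) * ?a m * u (l - m) * K (N - l))"
    unfolding sum.distrib[symmetric]
  proof (intro sum.cong refl)
    fix l assume "l \<in> {1..<N}"
    then have "?a l = u l + (\<Sum>m\<in>{1..<l}. (w m - 1) * ?a m * u (l - m))" by (intro less.IH) auto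
    then show "?a l * K (N - l) = u l * K (N - l) + (\<Sum>m\<in>{1..<l}. (w m - 1) * ?a m * u (l - m) * K (N - l))"
      by (simp add: distrib_right sum_distrib_right)
  qed
  also have "(\<Sum>l\<in>{1..<N}. \<Sum>m\<in>{1..<l}. (w m - 1) * ?a m * u (l - m) * K (N - l)) =
     (\<Sum>m\<in>{1..<N}. \<Sum>l\<in>{m<..<N}. (w m - 1) * ?a m * u (l - m) * K (N - l))"
    by (rule sum_triangle)
  \<comment> \<open>Over the sites strictly between \<open>m\<close> and \<open>N\<close>, the
    convolution of \<open>u\<close> with \<open>K\<close> misses the single jump from
    \<open>m\<close> to \<open>N\<close>, hence \<open>- K (N - m)\<close>; the first sum above
    supplies it.\<close>
  also have "\<dots> = (\<Sum>m\<in>{1..<N}. (w m - 1) * ?a m * (u (N - m) - K (N - m)))"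
  proof (intro sum.cong refl)
    fix m assume m: "m \<in> {1..<N}"
    have "u (N - m) = u 0 * K (N - m) + (\<Sum>j\<in>{1..<N-m}. u j * K (N - m - j))"
      using m by (subst u) (auto simp: lessThan_atLeast0 sum.atLeast_Suc_lessThan)
    also have "(\<Sum>j\<in>{1..<N-m}. u j * K (N - m - j)) = (\<Sum>l\<in>{m<..<N}. u (l - m) * K (N - l))"
      by (rule sum.reindex_bij_witness[of _ "\<lambda>l. l - m" "\<lambda>j. j + m"]) (auto simp: add.commute)
    finally show "(\<Sum>l\<in>{m<..<N}. (w m - 1) * ?a m * u (l - m) * K (N - l)) = (w m - 1) * ?a m * (u (N - m) - K (N - m))"
      by (simp add: u_def sum_distrib_left mult.assoc)
  qed
  also have "K N + ((\<Sum>l\<in>{1..<N}. (w l - 1) * ?a l * K (N - l)) + ((\<Sum>l\<in>{1..<N}. u l * K (N - l)) +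
      (\<Sum>m\<in>{1..<N}. (w m - 1) * ?a m * (u (N - m) - K (N - m))))) =
      (K N + (\<Sum>l\<in>{1..<N}. u l * K (N - l))) + (\<Sum>m\<in>{1..<N}. (w m - 1) * ?a m * u (N - m))"
    by (simp add: algebra_simps sum.distrib sum_subtractf)
  also have "K N + (\<Sum>l\<in>{1..<N}. u l * K (N - l)) = u N"
    using u[OF less.prems] unfolding split by (simp add: u_def)
  finally show ?case .
qed

lemma tail_Suc: "tail K (Suc n) = tail K n - K (Suc n)"
  by (simp add: tail_def)

text \<open>Moving the horizon to \<open>N + 1\<close> adds \<open>pinned - approach\<close> at
  \<open>N + 1\<close>, which is \<open>w (N + 1) - 1\<close> times a quantity of the past. With
  weights 1 the total stays equal to 1.\<close>

lemma free_eq: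
  assumes "K 0 = 0"
  shows "(\<Sum>m\<le>N. pinned K w m * tail K (N - m)) = 1 + (\<Sum>m\<in>{1..N}. (w m - 1) * approach K w m)"
proof (induction N)
  case 0
  then show ?case using assms by (simp add: tail_def)
next
  case (Suc N)
  have "(\<Sum>m\<le>Suc N. pinned K w m * tail K (Suc N - m)) =
      pinned K w (Suc N) + (\<Sum>m\<le>N. pinned K w m * (tail K (N - m) - K (Suc N - m)))"
    using assms tail_Suc[of K] by (auto simp: tail_def[of K 0] Suc_diff_le)
  also have "\<dots> = pinned K w (Suc N) - approach K w (Suc N) + (\<Sum>m\<le>N. pinned K w m * tail K (N - m))"
    by (simp add: approach_def algebra_simps sum_subtractf lessThan_Suc_atMost)
  also have "pinned K w (Suc N) - approach K w (Suc N) = (w (Suc N) - 1) * approach K w (Suc N)"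
    by (simp add: pinned_rec algebra_simps)
  finally show ?case using Suc by simp
qed

text \<open>\<open>exp (F * N)\<close> is a supersolution of the recursion. \<open>F\<close> may be
  negative, which gives exponential decay for a defective law.\<close>

lemma pinned_exp_bound:
  assumes K: "\<And>n. 0 \<le> K n" and c: "0 \<le> c"
    and le: "\<And>N. c * (\<Sum>n\<in>{1..N}. K n * exp (- F * real n)) \<le> 1"
  shows "pinned K (\<lambda>_. c) N \<le> exp (F * real N)"
proof (induction N rule: less_induct)
  case (less N)
  show ?case
  proof (cases "N = 0")
    case False
    have "approach K (\<lambda>_. c) N \<le> (\<Sum>m<N. exp (F * real m) * K (N - m))"
      unfolding approach_def using less K by (intro sum_mono mult_right_mono) auto
    also have "\<dots> = (\<Sum>m<N. exp (F * real N) * (K (N - m) * exp (- F * real (N - m))))"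
      by (intro sum.cong refl) (auto simp: exp_add[symmetric] of_nat_diff algebra_simps)
    also have "\<dots> = exp (F * real N) * (\<Sum>n\<in>{1..N}. K n * exp (- F * real n))"
      unfolding sum_distrib_left
      by (rule sum.reindex_bij_witness[of _ "\<lambda>n. N - n" "\<lambda>n. N - n"]) auto
    finally have "c * approach K (\<lambda>_. c) N \<le> exp (F * real N) * (c * (\<Sum>n\<in>{1..N}. K n * exp (- F * real n)))"
      using c by (simp add: mult_left_mono mult.left_commute)
    also have "\<dots> \<le> exp (F * real N) * 1" by (intro mult_left_mono le) auto
    finally show ?thesis using False by (simp add: pinned_rec)
  qed simp
qed

section \<open>The pure renewal process\<close>

lemma tail_nonneg:
  assumes "\<And>n. 0 \<le> K n" "K sums 1"
  shows "0 \<le> tail K n"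
  using sum_le_suminf[of K "{..n}"] assms by (auto simp: tail_def sums_iff)

lemma tail_antimono:
  assumes "\<And>n. 0 \<le> K n" "m \<le> n"
  shows "tail K n \<le> tail K m"
  unfolding tail_def using assms by (auto intro!: sum_mono2)

text \<open>\<open>tail\<close> decreases, so \<open>free_eq\<close> with weights 1 bounds the
  expected number of renewals up to \<open>N\<close>; a tail of order
  \<open>N powr -\<alpha>\<close> then allows at most order \<open>N powr \<alpha>\<close> of
  them.\<close>

lemma sum_renewal_tail_le:
  assumes K: "\<And>n. 0 \<le> K n" "K 0 = 0"
  shows "(\<Sum>m\<le>N. pinned K (\<lambda>_. 1) m) * tail K N \<le> 1"
proof -
  have "(\<Sum>m\<le>N. pinned K (\<lambda>_. 1) m) * tail K N \<le> (\<Sum>m\<le>N. pinned K (\<lambda>_. 1) m * tail K (N - m))"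
    unfolding sum_distrib_right using K(1) by (intro sum_mono mult_left_mono tail_antimono pinned_nonneg) auto
  also have "\<dots> = 1" using free_eq[where K=K, OF K(2), of "\<lambda>_. 1"] by simp
  finally show ?thesis .
qed

lemma sum_renewal_rec:
  defines "W \<equiv> \<lambda>K n. \<Sum>m\<le>n. pinned K (\<lambda>_. 1) m"
  shows "W K n = 1 + (\<Sum>m<n. W K m * K (n - m))"
proof (induction n)
  case (Suc n)
  have "(\<Sum>m<Suc n. W K m * K (Suc n - m)) = K (Suc n) + (\<Sum>m<n. W K (Suc m) * K (n - m))"
    by (subst sum.lessThan_Suc_shift) (simp add: W_def)
  also have "(\<Sum>m<n. W K (Suc m) * K (n - m)) =
      (\<Sum>m<n. W K m * K (n - m)) + (\<Sum>m<n. pinned K (\<lambda>_. 1) (Suc m) * K (n - m))"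
    by (simp add: W_def distrib_right sum.distrib)
  also have "K (Suc n) + ((\<Sum>m<n. W K m * K (n - m)) + (\<Sum>m<n. pinned K (\<lambda>_. 1) (Suc m) * K (n - m))) =
     (\<Sum>m<n. W K m * K (n - m)) + approach K (\<lambda>_. 1) (Suc n)"
    unfolding approach_def
    using sum.lessThan_Suc_shift[of "\<lambda>m. pinned K (\<lambda>_. 1) m * K (Suc n - m)" n] by simp
  finally show ?case using Suc approach_const1[of "Suc n" K] by (simp add: W_def)
qed (simp add: W_def)

text \<open>Splits a renewal path at its last jump longer than \<open>l\<close>.\<close>

lemma renewal_le_truncated:
  assumes K: "\<And>n. 0 \<le> K n" and big: "\<And>j. l < j \<Longrightarrow> K j \<le> \<kappa>"
  defines "W \<equiv> \<lambda>n. \<Sum>m\<le>n. pinned K (\<lambda>_. 1) m"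
  assumes "n \<le> N"
  shows "pinned K (\<lambda>_. 1) n \<le> pinned (\<lambda>j. if j \<le> l then K j else 0) (\<lambda>_. 1) n + \<kappa> * W N * W n"
  using \<open>n \<le> N\<close>
proof (induction n rule: less_induct)
  case (less n)
  let ?K = "\<lambda>j. if j \<le> l then K j else 0"
  have \<kappa>: "0 \<le> \<kappa>" using K[of "Suc l"] big[of "Suc l"] by simp
  have u0: "0 \<le> pinned K (\<lambda>_. 1) m" for m using K by (intro pinned_nonneg) auto
  have W0: "0 \<le> W m" for m unfolding W_def by (intro sum_nonneg u0)
  show ?case
  proof (cases "n = 0")
    case True
    then show ?thesis using \<kappa> W0[of N] W0[of 0] by simp
  next
    case False
    have "approach K (\<lambda>_. 1) n \<le> (\<Sum>m<n. (pinned ?K (\<lambda>_. 1) m + \<kappa> * W N * W m) * ?K (n - m) + \<kappa> * pinned K (\<lambda>_. 1) m)"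
      unfolding approach_def
    proof (intro sum_mono)
      fix m assume m: "m \<in> {..<n}"
      show "pinned K (\<lambda>_. 1) m * K (n - m) \<le> (pinned ?K (\<lambda>_. 1) m + \<kappa> * W N * W m) * ?K (n - m) + \<kappa> * pinned K (\<lambda>_. 1) m"
      proof (cases "n - m \<le> l")
        case True
        have "pinned K (\<lambda>_. 1) m * K (n - m) \<le> (pinned ?K (\<lambda>_. 1) m + \<kappa> * W N * W m) * K (n - m)"
          using m less.prems K by (intro mult_right_mono less.IH) auto
        moreover have "0 \<le> \<kappa> * pinned K (\<lambda>_. 1) m" using \<kappa> u0 by simp
        ultimately show ?thesis using True by simp
      next
        case False
        then have "K (n - m) * pinned K (\<lambda>_. 1) m \<le> \<kappa> * pinned K (\<lambda>_. 1) m"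
          using u0 by (intro mult_right_mono big) auto
        then show ?thesis using False by (simp add: mult.commute)
      qed
    qed
    also have "\<dots> = approach ?K (\<lambda>_. 1) n + \<kappa> * W N * (\<Sum>m<n. W m * ?K (n - m)) + \<kappa> * (\<Sum>m<n. pinned K (\<lambda>_. 1) m)"
      by (simp add: approach_def sum.distrib sum_distrib_left distrib_right mult.assoc)
    also have "(\<Sum>m<n. W m * ?K (n - m)) \<le> (\<Sum>m<n. W m * K (n - m))"
      using W0 K by (intro sum_mono mult_left_mono) auto
    \<comment> \<open>The \<open>- 1\<close> makes room for the term \<open>\<kappa> * W N\<close>
      that comes from a final jump longer than \<open>l\<close>.\<close>
    also have "(\<Sum>m<n. W m * K (n - m)) = W n - 1"
      using sum_renewal_rec[of K n] by (simp add: W_def)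
    also have "(\<Sum>m<n. pinned K (\<lambda>_. 1) m) \<le> W N"
      unfolding W_def using u0 less.prems by (intro sum_mono2) auto
    finally have "approach K (\<lambda>_. 1) n \<le> approach ?K (\<lambda>_. 1) n + \<kappa> * W N * (W n - 1) + \<kappa> * W N"
      using \<kappa> W0 by (simp add: mult_left_mono add_mono)
    then show ?thesis using False approach_const1[of n] by (simp add: algebra_simps)
  qed
qed

section \<open>The number of contacts up to N\<close>

lemma sum_walk_Suc:
  assumes "K 0 = 0"
  shows "(\<Sum>m\<le>N. walk K (\<lambda>_. 1) (Suc L) m * \<phi> m) =
    (\<Sum>a\<le>N. walk K (\<lambda>_. 1) L a * (\<Sum>n\<le>N - a. K n * \<phi> (a + n)))"
proof -
  let ?f = "\<lambda>a m. walk K (\<lambda>_. 1) L a * K (m - a) * \<phi> m"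
  have "(\<Sum>m\<le>N. walk K (\<lambda>_. 1) (Suc L) m * \<phi> m) = (\<Sum>m\<le>N. \<Sum>a | a \<in> {..N} \<and> a < m. ?f a m)"
    by (intro sum.cong refl) (auto simp: sum_distrib_right intro!: sum.cong)
  also have "\<dots> = (\<Sum>a\<le>N. \<Sum>m | m \<in> {..N} \<and> a < m. ?f a m)"
    by (rule sum.swap_restrict) auto
  also have "\<dots> = (\<Sum>a\<le>N. walk K (\<lambda>_. 1) L a * (\<Sum>n\<le>N - a. K n * \<phi> (a + n)))"
  proof (intro sum.cong refl)
    fix a assume a: "a \<in> {..N}"
    have "(\<Sum>m | m \<in> {..N} \<and> a < m. ?f a m) = (\<Sum>n\<in>{1..N - a}. walk K (\<lambda>_. 1) L a * K n * \<phi> (a + n))"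
      by (rule sum.reindex_bij_witness[of _ "\<lambda>n. a + n" "\<lambda>m. m - a"]) auto
    also have "\<dots> = (\<Sum>n\<le>N - a. walk K (\<lambda>_. 1) L a * K n * \<phi> (a + n))"
      using assms by (intro sum.mono_neutral_left) (auto simp: not_le less_Suc_eq_le)
    finally show "(\<Sum>m | m \<in> {..N} \<and> a < m. ?f a m) = walk K (\<lambda>_. 1) L a * (\<Sum>n\<le>N - a. K n * \<phi> (a + n))"
      by (simp add: sum_distrib_left mult.assoc)
  qed
  finally show ?thesis .
qed

text \<open>For a probability law the inner sum is the probability of exactly \<open>k\<close>
  contacts after 0 and up to \<open>N\<close>; the sum telescopes to the probability that contact
  number \<open>L\<close> lies beyond \<open>N\<close>.\<close>

lemma sum_walk_tail:
  assumes "K 0 = 0"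
  shows "(\<Sum>k<L. \<Sum>m\<le>N. walk K (\<lambda>_. 1) k m * tail K (N - m)) = 1 - (\<Sum>m\<le>N. walk K (\<lambda>_. 1) L m)"
proof (induction L)
  case 0
  have "{..N} = insert 0 {1..N}" by auto
  then show ?case by simp
next
  case (Suc L)
  have "(\<Sum>m\<le>N. walk K (\<lambda>_. 1) (Suc L) m) = (\<Sum>a\<le>N. walk K (\<lambda>_. 1) L a * (1 - tail K (N - a)))"
    using sum_walk_Suc[where K=K and N=N and L=L and \<phi>="\<lambda>_. 1", OF assms] by (simp add: tail_def del: walk.simps)
  then show ?case using Suc by (simp add: algebra_simps sum_subtractf del: walk.simps)
qed

lemma powr_add_le:
  fixes x y s :: real
  assumes "0 \<le> x" "0 \<le> y" "0 < s" "s \<le> 1"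
  shows "(x + y) powr s \<le> x powr s + y powr s"
proof (cases "x + y = 0")
  case False
  then have pos: "0 < x + y" using assms by simp
  have le: "z / (x + y) \<le> (z / (x + y)) powr s" if "0 \<le> z" "z \<le> x + y" for z
  proof (cases "z = 0")
    case False
    then have "0 < z / (x + y)" "z / (x + y) \<le> 1" using that pos by auto
    then show ?thesis using powr_mono'[of s 1 "z / (x + y)"] assms that by simp
  qed simp
  have "1 = x / (x + y) + y / (x + y)" using pos by (simp add: add_divide_distrib[symmetric])
  also have "\<dots> \<le> (x / (x + y)) powr s + (y / (x + y)) powr s"
    using assms by (intro add_mono le) auto
  also have "\<dots> = (x powr s + y powr s) / (x + y) powr s"
    using assms by (simp add: powr_divide add_divide_distrib)
  finally show ?thesis using pos by (simp add: field_simps)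
qed (use assms in auto)

text \<open>Markov's inequality for the power \<open>s\<close> of the position of contact number
  \<open>L\<close>: as \<open>x powr s\<close> is subadditive, its mean is at most
  \<open>L * M\<close>. The test function \<open>1 - (m / N) powr s\<close> is used because only
  positions up to \<open>N\<close> are summed.\<close>

lemma walk_tail_le:
  assumes K: "\<And>n. 0 \<le> K n" "K 0 = 0" "K sums 1" and s: "0 < s" "s \<le> 1"
    and M: "(\<lambda>n. K n * real n powr s) sums M" and N: "0 < N"
  shows "(\<Sum>k<L. \<Sum>m\<le>N. walk K (\<lambda>_. 1) k m * tail K (N - m)) \<le> real L * M * real N powr - s"
proof -
  define \<psi> where "\<psi> = (\<lambda>n. (real n / real N) powr s)"
  define \<phi> where "\<phi> = (\<lambda>m. 1 - \<psi> m)"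
  define \<eta> where "\<eta> = M * real N powr - s"
  have \<eta>: "(\<lambda>n. K n * \<psi> n) sums \<eta>"
  proof -
    have "(\<lambda>n. K n * real n powr s * real N powr - s) sums \<eta>" unfolding \<eta>_def by (intro sums_mult2 M)
    then show ?thesis unfolding \<psi>_def using N by (simp add: powr_divide powr_minus_divide)
  qed
  have walk0: "0 \<le> walk K (\<lambda>_. 1) k m" for k m using K by (intro walk_nonneg) auto
  have walk1: "(\<Sum>m\<le>N. walk K (\<lambda>_. 1) L m) \<le> 1" for L
  proof -
    have "0 \<le> (\<Sum>k<L. \<Sum>m\<le>N. walk K (\<lambda>_. 1) k m * tail K (N - m))"
      by (intro sum_nonneg mult_nonneg_nonneg walk0 tail_nonneg K)
    then show ?thesis unfolding sum_walk_tail[where K=K, OF K(2)] by simp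
  qed
  \<comment> \<open>One more jump lowers the mean of \<open>\<phi>\<close> by at most
    \<open>\<eta>\<close>. Jumps that lead beyond \<open>N\<close> may be dropped, since there
    \<open>\<psi> n - \<phi> a \<ge> \<psi> (a + n) - 1 \<ge> 0\<close>.\<close>
  have step: "\<phi> a - \<eta> \<le> (\<Sum>n\<le>N - a. K n * \<phi> (a + n))" if "a \<le> N" for a
  proof -
    have sub: "\<psi> (a + n) \<le> \<psi> a + \<psi> n" for n
      unfolding \<psi>_def of_nat_add add_divide_distrib using s by (intro powr_add_le) auto
    have ss: "(\<lambda>n. K n * (\<psi> n - \<phi> a)) sums (\<eta> - 1 * \<phi> a)"
      unfolding right_diff_distrib by (intro sums_diff \<eta> sums_mult2 K)
    have "(\<Sum>n\<le>N - a. K n * (\<psi> n - \<phi> a)) \<le> (\<Sum>n. K n * (\<psi> n - \<phi> a))"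
    proof (intro sum_le_suminf)
      fix n assume "n \<in> - {..N - a}"
      then have "1 \<le> \<psi> (a + n)" unfolding \<psi>_def using N s by (intro ge_one_powr_ge_zero) (auto simp: field_simps)
      then show "0 \<le> K n * (\<psi> n - \<phi> a)" using sub[of n] K by (auto simp: \<phi>_def)
    qed (use ss in \<open>auto simp: sums_iff\<close>)
    then have "\<phi> a - \<eta> \<le> (\<Sum>n\<le>N - a. K n * (\<phi> a - \<psi> n))"
      using ss by (simp add: sums_iff right_diff_distrib sum_subtractf)
    also have "\<dots> \<le> (\<Sum>n\<le>N - a. K n * \<phi> (a + n))"
      using sub K by (intro sum_mono mult_left_mono) (auto simp: \<phi>_def algebra_simps)
    finally show ?thesis .
  qed
  have *: "1 - real L * \<eta> \<le> (\<Sum>m\<le>N. walk K (\<lambda>_. 1) L m * \<phi> m)" for L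
  proof (induction L)
    case 0
    have "{..N} = insert 0 {1..N}" by auto
    then show ?case by (simp add: \<phi>_def \<psi>_def)
  next
    case (Suc L)
    have "0 \<le> \<eta>" using sums_le[OF _ sums_zero \<eta>] K by (auto simp: \<psi>_def)
    then have "\<eta> * (\<Sum>a\<le>N. walk K (\<lambda>_. 1) L a) \<le> \<eta> * 1" by (intro mult_left_mono walk1)
    then have "1 - real (Suc L) * \<eta> \<le> (\<Sum>m\<le>N. walk K (\<lambda>_. 1) L m * \<phi> m) - \<eta> * (\<Sum>a\<le>N. walk K (\<lambda>_. 1) L a)"
      using Suc by (simp add: algebra_simps)
    also have "\<dots> = (\<Sum>a\<le>N. walk K (\<lambda>_. 1) L a * (\<phi> a - \<eta>))"
      by (simp add: algebra_simps sum_subtractf sum_distrib_left)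
    also have "\<dots> \<le> (\<Sum>a\<le>N. walk K (\<lambda>_. 1) L a * (\<Sum>n\<le>N - a. K n * \<phi> (a + n)))"
      by (intro sum_mono mult_left_mono step walk0) auto
    finally show ?case using sum_walk_Suc[where K=K and N=N and L=L and \<phi>=\<phi>, OF K(2)] by simp
  qed
  have "(\<Sum>m\<le>N. walk K (\<lambda>_. 1) L m * \<phi> m) \<le> (\<Sum>m\<le>N. walk K (\<lambda>_. 1) L m)"
    by (intro sum_mono mult_left_le walk0) (simp add: \<phi>_def \<psi>_def)
  then show ?thesis using *[of L] sum_walk_tail[where K=K and L=L and N=N, OF K(2)] by (simp add: \<eta>_def mult.assoc)
qed

section \<open>Polynomial inter-arrival laws\<close>

text \<open>\<open>K\<close> may vanish for small \<open>n\<close>, so the lower bound holds only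
  from \<open>n0\<close> on; the upper bound extends to all \<open>n \<ge> 1\<close> because
  \<open>K n \<le> 1\<close> and \<open>C\<close> is at least
  \<open>n0 powr (1 + \<alpha>)\<close>.\<close>

lemma inter_arrival_law_bounds:
  assumes "inter_arrival_law K \<alpha> C\<^sub>K" "0 < \<alpha>"
  obtains c C n0 where "0 < c" "0 < C" "1 \<le> n0"
    "\<And>n. 1 \<le> n \<Longrightarrow> K n \<le> C * real n powr - (1 + \<alpha>)"
    "\<And>n. n0 \<le> n \<Longrightarrow> c * real n powr - (1 + \<alpha>) \<le> K n"
proof -
  have K: "\<And>n. 0 \<le> K n" "K sums 1" and CK: "0 < C\<^sub>K"
    and lim: "K \<sim>[at_top] (\<lambda>n. C\<^sub>K * real n powr - (1 + \<alpha>))"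
    using assms(1) unfolding inter_arrival_law_def by auto
  let ?g = "\<lambda>n. C\<^sub>K * real n powr - (1 + \<alpha>)"
  \<comment> \<open>\<open>asymp_equiv\<close> takes the ratio 0/0 to be 1, hence the conditional;
    positivity of \<open>?g\<close> removes it.\<close>
  have "\<forall>\<^sub>F n in sequentially. dist (if K n = 0 \<and> ?g n = 0 then 1 else K n / ?g n) 1 < 1 / 2"
    using lim unfolding asymp_equiv_def by (rule tendstoD) simp
  then obtain n1 where n1: "\<And>n. n1 \<le> n \<Longrightarrow> dist (if K n = 0 \<and> ?g n = 0 then 1 else K n / ?g n) 1 < 1 / 2"
    unfolding eventually_sequentially by blast
  define n0 where "n0 = max 1 n1"
  have b: "C\<^sub>K / 2 * real n powr - (1 + \<alpha>) \<le> K n \<and> K n \<le> 2 * C\<^sub>K * real n powr - (1 + \<alpha>)" if "n0 \<le> n" for n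
  proof -
    have pos: "0 < ?g n" using that CK by (simp add: n0_def)
    then have "\<not> (K n = 0 \<and> ?g n = 0)" by linarith
    then have "\<bar>K n / ?g n - 1\<bar> < 1 / 2" using n1[of n] that unfolding dist_real_def n0_def by (simp only: if_False)
    then have "1 / 2 \<le> K n / ?g n" "K n / ?g n \<le> 2" by linarith+
    then have "1 / 2 * ?g n \<le> K n" "K n \<le> 2 * ?g n" using pos by (simp_all add: field_simps)
    then show ?thesis by simp
  qed
  have K1: "K n \<le> 1" for n using sum_le_suminf[of K "{n}"] K by (auto simp: sums_iff)
  define C where "C = max (2 * C\<^sub>K) (real n0 powr (1 + \<alpha>))"
  show ?thesis
  proof (rule that[of "C\<^sub>K / 2" C n0])
    fix n :: nat assume n: "1 \<le> n"
    show "K n \<le> C * real n powr - (1 + \<alpha>)"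
    proof (cases "n0 \<le> n")
      case True
      have "2 * C\<^sub>K * real n powr - (1 + \<alpha>) \<le> C * real n powr - (1 + \<alpha>)"
        by (intro mult_right_mono) (auto simp: C_def)
      then show ?thesis using b[OF True] by linarith
    next
      case False
      have "1 = real n powr (1 + \<alpha>) * real n powr - (1 + \<alpha>)" using n by (simp add: powr_add[symmetric] powr_minus)
      also have "\<dots> \<le> real n0 powr (1 + \<alpha>) * real n powr - (1 + \<alpha>)"
        using False assms by (intro mult_right_mono powr_mono2) auto
      also have "\<dots> \<le> C * real n powr - (1 + \<alpha>)" by (intro mult_right_mono) (auto simp: C_def)
      finally show ?thesis using K1[of n] by linarith
    qed
  qed (use CK b in \<open>auto simp: C_def n0_def\<close>)
qed

text \<open>The \<open>n\<close> jump lengths from \<open>n + 1\<close> to \<open>2 * n\<close>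
  already carry enough mass once \<open>n \<ge> n0\<close>; below \<open>n0\<close>, monotonicity of
  \<open>tail\<close> suffices.\<close>

lemma tail_lower:
  assumes law: "inter_arrival_law K \<alpha> C\<^sub>K" "0 < \<alpha>"
  obtains c where "0 < c" "\<And>n. 1 \<le> n \<Longrightarrow> c * real n powr - \<alpha> \<le> tail K n"
proof -
  obtain c C n0 where c: "0 < c" "1 \<le> n0" "\<And>n. n0 \<le> n \<Longrightarrow> c * real n powr - (1 + \<alpha>) \<le> K n"
    using inter_arrival_law_bounds[OF law] by metis
  have K: "\<And>n. 0 \<le> K n" "K sums 1" using law(1) unfolding inter_arrival_law_def by auto
  define d where "d = c * 2 powr - (1 + \<alpha>)"
  have d: "0 < d" using c by (simp add: d_def)
  have large: "d * real n powr - \<alpha> \<le> tail K n" if n: "n0 \<le> n" for n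
  proof -
    have "real n * (c * real (2 * n) powr - (1 + \<alpha>)) = (\<Sum>j\<in>{n<..2 * n}. c * real (2 * n) powr - (1 + \<alpha>))"
      by simp
    also have "\<dots> \<le> sum K {n<..2 * n}"
    proof (intro sum_mono)
      fix j assume j: "j \<in> {n<..2 * n}"
      have "c * real (2 * n) powr - (1 + \<alpha>) \<le> c * real j powr - (1 + \<alpha>)"
        using j c n assms by (intro mult_left_mono powr_mono2') auto
      also have "\<dots> \<le> K j" using j n by (intro c) auto
      finally show "c * real (2 * n) powr - (1 + \<alpha>) \<le> K j" .
    qed
    also have "\<dots> = sum K {..2 * n} - sum K {..n}"
    proof -
      have "{..2 * n} = {..n} \<union> {n<..2 * n}" by auto
      moreover have "sum K ({..n} \<union> {n<..2 * n}) = sum K {..n} + sum K {n<..2 * n}"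
        by (rule sum.union_disjoint) auto
      ultimately show ?thesis by simp
    qed
    also have "\<dots> \<le> tail K n"
      using sum_le_suminf[of K "{..2 * n}"] K by (auto simp: tail_def sums_iff)
    finally have "real n * (c * real (2 * n) powr - (1 + \<alpha>)) \<le> tail K n" .
    moreover have "real n * (c * real (2 * n) powr - (1 + \<alpha>)) = d * real n powr - \<alpha>"
    proof -
      have "real n * real n powr - (1 + \<alpha>) = real n powr - \<alpha>"
        using n c(2) powr_mult_base[of "real n" "- (1 + \<alpha>)"] by simp
      moreover have "real (2 * n) powr - (1 + \<alpha>) = 2 powr - (1 + \<alpha>) * real n powr - (1 + \<alpha>)"
        by (simp add: powr_mult)
      ultimately show ?thesis by (simp add: d_def)
    qed
    ultimately show ?thesis by simp
  qed
  show ?thesis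
  proof (rule that[of "d * real n0 powr - \<alpha>"])
    show "0 < d * real n0 powr - \<alpha>" using d c by simp
    fix n :: nat assume n: "1 \<le> n"
    have le1: "real m powr - \<alpha> \<le> 1" if "1 \<le> m" for m
      using powr_mono2'[of "- \<alpha>" 1 "real m"] that assms by simp
    show "d * real n0 powr - \<alpha> * real n powr - \<alpha> \<le> tail K n"
    proof (cases "n0 \<le> n")
      case True
      have "d * real n0 powr - \<alpha> * real n powr - \<alpha> \<le> d * 1 * real n powr - \<alpha>"
        using d le1[OF c(2)] by (intro mult_right_mono mult_left_mono) auto
      then show ?thesis using large[OF True] by simp
    next
      case False
      have "d * real n0 powr - \<alpha> * real n powr - \<alpha> \<le> d * real n0 powr - \<alpha> * 1"
        using d le1[OF n] by (intro mult_left_mono) auto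
      also have "\<dots> \<le> tail K n0" using large[of n0] by simp
      also have "\<dots> \<le> tail K n" using False K by (intro tail_antimono) auto
      finally show ?thesis .
    qed
  qed
qed

lemma summable_moment:
  assumes law: "inter_arrival_law K \<alpha> C\<^sub>K" "0 < \<alpha>" and s: "s < \<alpha>"
  shows "summable (\<lambda>n. K n * real n powr s)"
proof -
  obtain c C n0 where C: "0 < C" "\<And>n. 1 \<le> n \<Longrightarrow> K n \<le> C * real n powr - (1 + \<alpha>)"
    using inter_arrival_law_bounds[OF law] by metis
  have K: "\<And>n. 0 \<le> K n" using law(1) unfolding inter_arrival_law_def by auto
  have "summable (\<lambda>n. C * real n powr (s - (1 + \<alpha>)))"
    using s by (intro summable_mult) (simp add: summable_real_powr_iff)
  moreover have "norm (K n * real n powr s) \<le> C * real n powr (s - (1 + \<alpha>))" if "1 \<le> n" for n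
  proof -
    have "K n * real n powr s \<le> C * real n powr - (1 + \<alpha>) * real n powr s"
      by (intro mult_right_mono C that) auto
    then show ?thesis using K by (simp add: powr_add[symmetric] algebra_simps)
  qed
  ultimately show ?thesis by (rule summable_comparison_test')
qed

lemma moment_ge_1:
  assumes K: "\<And>n. 0 \<le> K n" "K 0 = 0" "K sums 1" and s: "0 \<le> s"
    and M: "(\<lambda>n. K n * real n powr s) sums M"
  shows "1 \<le> M"
proof (rule sums_le[OF _ K(3) M])
  fix n
  show "K n \<le> K n * real n powr s"
  proof (cases "n = 0")
    case False
    then have "1 \<le> real n powr s" using s by (intro ge_one_powr_ge_zero) auto
    then show ?thesis using K(1)[of n] by (simp add: mult_le_cancel_left1)
  qed (use K in simp)
qed

text \<open>Forbidding jumps above \<open>l\<close> removes a mass of at least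
  \<open>c * l powr -\<alpha>\<close>, which leaves room for an exponential tilt in
  \<open>pinned_exp_bound\<close>.\<close>

lemma truncated_renewal_le_exp:
  assumes K: "\<And>n. 0 \<le> K n" "K 0 = 0" "K sums 1"
    and s: "0 < s" "s < \<alpha>" "s \<le> 1" and M: "(\<lambda>n. K n * real n powr s) sums M"
    and c: "0 < c" "\<And>n. 1 \<le> n \<Longrightarrow> c * real n powr - \<alpha> \<le> tail K n" and l: "1 \<le> l"
  shows "pinned (\<lambda>j. if j \<le> l then K j else 0) (\<lambda>_. 1) n
    \<le> exp (- (c / (2 * M) * real l powr (s - 1 - \<alpha>)) * real n)"
proof -
  \<comment> \<open>Solves \<open>2 * t * l powr (1 - s) * M = c * l powr -\<alpha>\<close>: the
    cost of the tilt equals the guaranteed missing mass.\<close>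
  define t where "t = c / (2 * M) * real l powr (s - 1 - \<alpha>)"
  have M1: "1 \<le> M" using s by (intro moment_ge_1[OF K _ M]) simp
  have "tail K 1 \<le> 1" using K by (simp add: tail_def)
  then have c1: "c \<le> 1" using c(2)[of 1] by simp
  have t0: "0 < t" using c M1 l by (simp add: t_def)
  \<comment> \<open>This puts every exponent \<open>t * n\<close> with \<open>n \<le> l\<close> into
    [0, 1], where \<open>exp x \<le> 1 + 2 * x\<close>.\<close>
  have tle: "t * real l \<le> 1"
  proof -
    have "t * real l = c / (2 * M) * real l powr (s - \<alpha>)"
      using l powr_mult_base[of "real l" "s - 1 - \<alpha>"] by (simp add: t_def mult.commute algebra_simps)
    also have "\<dots> \<le> 1 * 1"
    proof (intro mult_mono)
      show "c / (2 * M) \<le> 1" using c1 M1 by simp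
      show "real l powr (s - \<alpha>) \<le> 1" using powr_mono2'[of "s - \<alpha>" 1 "real l"] l s by simp
    qed (use c M1 in auto)
    finally show ?thesis by simp
  qed
  have jK: "real j * K j \<le> real l powr (1 - s) * (K j * real j powr s)" if "j \<le> l" for j
  proof (cases "j = 0")
    case False
    have "real j = real j powr (1 - s) * real j powr s" using False by (simp add: powr_add[symmetric])
    also have "\<dots> \<le> real l powr (1 - s) * real j powr s"
      using that s by (intro mult_right_mono powr_mono2) auto
    finally show ?thesis using K(1)[of j] mult_right_mono by (fastforce simp: mult_ac)
  qed simp
  let ?K = "\<lambda>j. if j \<le> l then K j else 0"
  show ?thesis unfolding t_def[symmetric]
  proof (rule pinned_exp_bound)
    fix N
    have "(\<Sum>n\<in>{1..N}. ?K n * exp (- (- t) * real n)) = (\<Sum>n\<in>{1..N} \<inter> {..l}. K n * exp (t * real n))"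
      by (subst sum.inter_restrict) (auto intro!: sum.cong)
    also have "\<dots> \<le> (\<Sum>n\<le>l. K n * exp (t * real n))"
      using K by (intro sum_mono2) auto
    also have "\<dots> \<le> (\<Sum>n\<le>l. K n + 2 * t * (real l powr (1 - s) * (K n * real n powr s)))"
    proof (intro sum_mono)
      fix n assume n: "n \<in> {..l}"
      have "t * real n \<le> t * real l" using n t0 by (intro mult_left_mono) auto
      then have x: "0 \<le> t * real n" "t * real n \<le> 1" using t0 tle by (simp, linarith)
      have "exp (t * real n) \<le> 1 + t * real n + (t * real n)\<^sup>2" by (rule exp_bound[OF x])
      also have "(t * real n)\<^sup>2 \<le> t * real n" unfolding power2_eq_square using x by (intro mult_left_le) auto
      finally have "K n * exp (t * real n) \<le> K n * (1 + 2 * (t * real n))" using K by (intro mult_left_mono) auto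
      also have "\<dots> = K n + 2 * t * (real n * K n)" by (simp add: algebra_simps)
      also have "\<dots> \<le> K n + 2 * t * (real l powr (1 - s) * (K n * real n powr s))"
        using jK[of n] n t0 by (intro add_left_mono mult_left_mono) auto
      finally show "K n * exp (t * real n) \<le> K n + 2 * t * (real l powr (1 - s) * (K n * real n powr s))" .
    qed
    also have "\<dots> = (1 - tail K l) + 2 * t * real l powr (1 - s) * (\<Sum>n\<le>l. K n * real n powr s)"
      by (simp add: sum.distrib tail_def sum_distrib_left mult_ac)
    also have "\<dots> \<le> (1 - tail K l) + 2 * t * real l powr (1 - s) * M"
      using sum_le_suminf[of "\<lambda>n. K n * real n powr s" "{..l}"] M K t0
      by (intro add_left_mono mult_left_mono) (auto simp: sums_iff)
    also have "2 * t * real l powr (1 - s) * M = c * real l powr - \<alpha>"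
    proof -
      have "real l powr (s - 1 - \<alpha>) * real l powr (1 - s) = real l powr - \<alpha>" by (simp add: powr_add[symmetric])
      then show ?thesis using M1 by (simp add: t_def field_simps)
    qed
    also have "1 - tail K l + c * real l powr - \<alpha> \<le> 1" using c(2)[OF l] by simp
    finally show "1 * (\<Sum>n\<in>{1..N}. ?K n * exp (- (- t) * real n)) \<le> 1" by simp
  qed (use K in auto)
qed

text \<open>Apply \<open>renewal_le_truncated\<close> with \<open>l\<close> about
  \<open>n powr r\<close>: the truncated part decays like a stretched exponential and the rest is of
  order \<open>n powr -\<theta>\<close> with \<open>p * \<theta> > 1\<close>.\<close>

lemma summable_renewal_powr:
  assumes law: "inter_arrival_law K \<alpha> C\<^sub>K" and \<alpha>: "0 < \<alpha>" "\<alpha> < 1" and p: "0 < p" "1 < p * (1 - \<alpha>)"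
  shows "summable (\<lambda>n. pinned K (\<lambda>_. 1) n powr p)"
proof -
  have K: "\<And>n. 0 \<le> K n" "K 0 = 0" "K sums 1" using law unfolding inter_arrival_law_def by auto
  obtain c0 C n0 where C: "0 < C" "\<And>n. 1 \<le> n \<Longrightarrow> K n \<le> C * real n powr - (1 + \<alpha>)"
    using inter_arrival_law_bounds[OF law \<alpha>(1)] by metis
  obtain c where c: "0 < c" "\<And>n. 1 \<le> n \<Longrightarrow> c * real n powr - \<alpha> \<le> tail K n"
    using tail_lower[OF law \<alpha>(1)] by metis
  define \<theta> where "\<theta> = (1 / p + (1 - \<alpha>)) / 2"
  have \<theta>: "1 < p * \<theta>" "\<theta> < 1 - \<alpha>" "0 < \<theta>"
  proof -
    have "1 / p < 1 - \<alpha>" using p by (simp add: field_simps)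
    then have \<theta>: "1 / p < \<theta>" "\<theta> < 1 - \<alpha>" by (auto simp: \<theta>_def)
    then show "1 < p * \<theta>" "\<theta> < 1 - \<alpha>" using p by (auto simp: field_simps)
    have "0 < 1 / p" using p by simp
    then show "0 < \<theta>" using \<theta>(1) by linarith
  qed
  \<comment> \<open>A jump above \<open>n powr r\<close> has probability of order at most
    \<open>n powr -(2 * \<alpha> + \<theta>)\<close>, and each of the two factors \<open>W\<close>
    costs \<open>n powr \<alpha>\<close>, which leaves \<open>n powr -\<theta>\<close>.
    \<open>r < 1\<close> amounts to \<open>\<theta> < 1 - \<alpha>\<close>.\<close>
  define r where "r = (2 * \<alpha> + \<theta>) / (1 + \<alpha>)"
  have r: "0 < r" "r < 1" "r * (1 + \<alpha>) = 2 * \<alpha> + \<theta>" using \<alpha> \<theta> by (auto simp: r_def)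
  \<comment> \<open>So close to \<alpha> that the decay exponent
    \<open>n * l powr (s - 1 - \<alpha>)\<close> is at least \<open>n powr q\<close> with
    \<open>q > 0\<close>.\<close>
  define s where "s = \<alpha> - min \<alpha> (1 / r - 1) / 2"
  have "0 < 1 / r - 1" using r by simp
  then have s: "0 < s" "s < \<alpha>" "\<alpha> - s < 1 / r - 1" using \<alpha> by (auto simp: s_def min_def)
  then have s1: "s \<le> 1" using \<alpha> by simp
  define q where "q = 1 - r * (1 + \<alpha> - s)"
  have q: "0 < q" using s(3) r by (simp add: q_def field_simps)
  obtain M where M: "(\<lambda>n. K n * real n powr s) sums M"
    using summable_moment[OF law \<alpha>(1) s(2)] by blast
  have M1: "1 \<le> M" using s by (intro moment_ge_1[OF K _ M]) simp
  define d where "d = c / (2 * M)"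
  have bound: "pinned K (\<lambda>_. 1) n \<le> exp (- d * real n powr q) + C / c\<^sup>2 * real n powr - \<theta>" if n: "1 \<le> n" for n
  proof -
    define l where "l = nat \<lfloor>real n powr r\<rfloor>"
    have n1: "1 \<le> real n powr r" using n r by (intro ge_one_powr_ge_zero) auto
    have l: "1 \<le> l" "real l \<le> real n powr r" "real n powr r \<le> real (Suc l)" using n1 by (auto simp: l_def le_nat_iff) linarith
    have big: "K j \<le> C * real n powr - (2 * \<alpha> + \<theta>)" if "l < j" for j
    proof -
      have "K j \<le> C * real j powr - (1 + \<alpha>)" using that by (intro C) auto
      also have "\<dots> \<le> C * (real n powr r) powr - (1 + \<alpha>)"
        using that l n n1 C \<alpha> by (intro mult_left_mono powr_mono2') auto
      also have "\<dots> = C * real n powr - (2 * \<alpha> + \<theta>)" by (simp add: powr_powr r(3) del: minus_add_distrib flip: minus_mult_right)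
      finally show ?thesis .
    qed
    define W where "W = (\<Sum>m\<le>n. pinned K (\<lambda>_. 1) m)"
    have W: "0 \<le> W" "W \<le> real n powr \<alpha> / c"
    proof -
      show W0: "0 \<le> W" unfolding W_def using K by (intro sum_nonneg pinned_nonneg) auto
      have "W * (c * real n powr - \<alpha>) \<le> W * tail K n" using c n W0 by (intro mult_left_mono) auto
      also have "\<dots> \<le> 1" unfolding W_def using K by (intro sum_renewal_tail_le)
      finally show "W \<le> real n powr \<alpha> / c" using c n by (simp add: powr_minus field_simps)
    qed
    have "pinned K (\<lambda>_. 1) n \<le> pinned (\<lambda>j. if j \<le> l then K j else 0) (\<lambda>_. 1) n + C * real n powr - (2 * \<alpha> + \<theta>) * W * W"
      unfolding W_def by (intro renewal_le_truncated[where K=K] K(1) big) auto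
    also have "pinned (\<lambda>j. if j \<le> l then K j else 0) (\<lambda>_. 1) n \<le> exp (- (d * real l powr (s - 1 - \<alpha>)) * real n)"
      unfolding d_def by (rule truncated_renewal_le_exp[OF K s(1,2) s1 M c l(1)])
    also have "\<dots> \<le> exp (- d * real n powr q)"
    proof -
      have "real n powr (r * (s - 1 - \<alpha>)) \<le> real l powr (s - 1 - \<alpha>)"
        unfolding powr_powr[symmetric] using l s by (intro powr_mono2') auto
      then have "real n powr (r * (s - 1 - \<alpha>)) * real n \<le> real l powr (s - 1 - \<alpha>) * real n" by (rule mult_right_mono) simp
      moreover have "real n powr (r * (s - 1 - \<alpha>)) * real n = real n powr q"
        using powr_mult_base[of "real n" "r * (s - 1 - \<alpha>)"] by (simp add: q_def algebra_simps)
      ultimately have "d * real n powr q \<le> d * (real l powr (s - 1 - \<alpha>) * real n)"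
        using c M1 by (intro mult_left_mono) (auto simp: d_def)
      then show ?thesis by (simp add: mult.assoc)
    qed
    also have "C * real n powr - (2 * \<alpha> + \<theta>) * W * W \<le> C * real n powr - (2 * \<alpha> + \<theta>) * (real n powr \<alpha> / c) * (real n powr \<alpha> / c)"
      using W C c by (intro mult_mono mult_left_mono) auto
    also have "\<dots> = C / c\<^sup>2 * (real n powr - (2 * \<alpha> + \<theta>) * real n powr \<alpha> * real n powr \<alpha>)"
      by (simp add: power2_eq_square)
    also have "real n powr - (2 * \<alpha> + \<theta>) * real n powr \<alpha> * real n powr \<alpha> = real n powr - \<theta>"
      unfolding powr_add[symmetric] by simp
    finally show ?thesis by simp
  qed
  have d: "0 < d" using c M1 by (simp add: d_def)
  have "(\<lambda>x::real. exp (- d * x powr q)) \<in> O(\<lambda>x. x powr - \<theta>)" using d q \<theta>(3) by real_asymp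
  then have "(\<lambda>n::nat. exp (- d * real n powr q)) \<in> O(\<lambda>n. real n powr - \<theta>)"
    by (rule landau_o.big.compose) (rule filterlim_real_sequentially)
  then obtain A where A: "\<forall>\<^sub>F n in sequentially. exp (- d * real n powr q) \<le> A * real n powr - \<theta>"
    by (elim landau_o.bigE) auto
  define B where "B = A + C / c\<^sup>2"
  have "\<forall>\<^sub>F n in sequentially. norm (pinned K (\<lambda>_. 1) n powr p) \<le> B powr p * real n powr - (p * \<theta>)"
    using A eventually_ge_at_top[of 1]
  proof eventually_elim
    case (elim n)
    have u0: "0 \<le> pinned K (\<lambda>_. 1) n" using K by (intro pinned_nonneg) auto
    have "pinned K (\<lambda>_. 1) n \<le> B * real n powr - \<theta>"
      using bound[OF elim(2)] elim(1) by (simp add: B_def algebra_simps)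
    then have "pinned K (\<lambda>_. 1) n powr p \<le> (B * real n powr - \<theta>) powr p" using u0 p by (intro powr_mono2) auto
    also have "\<dots> = B powr p * real n powr - (p * \<theta>)"
      by (simp add: powr_mult powr_powr mult.commute)
    finally show ?case by simp
  qed
  moreover have "summable (\<lambda>n. B powr p * real n powr - (p * \<theta>))"
    using \<theta> by (intro summable_mult) (simp add: summable_real_powr_iff)
  ultimately show ?thesis by (rule summable_comparison_test_ev)
qed

section \<open>Integration over the disorder\<close>

text \<open>A first-order expansion: the derivative of the power is Hoelder continuous of order
  \<open>p - 1 \<le> 1\<close>, so the remainder is of order \<open>|y| powr p\<close>. The linear
  term is kept because it averages out for centred \<open>y\<close>.\<close>

lemma abs_powr_add_le:
  fixes x y p :: real
  assumes p: "1 < p" "p \<le> 2"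
  shows "\<bar>x + y\<bar> powr p \<le> \<bar>x\<bar> powr p + p * (sgn x * \<bar>x\<bar> powr (p - 1)) * y + 2 * p * \<bar>y\<bar> powr p"
proof -
  have diff: "b powr (p - 1) - a powr (p - 1) \<le> (b - a) powr (p - 1)" if "0 \<le> a" "a \<le> b" for a b :: real
    using powr_add_le[of a "b - a" "p - 1"] that p by simp
  have deriv: "((\<lambda>t. t powr p) has_real_derivative p * t powr (p - 1)) (at t)" if "0 < t" for t :: real
    using has_real_derivative_powr[OF that, of p] by simp
  have pos: "\<bar>x + y\<bar> powr p \<le> \<bar>x\<bar> powr p + p * (sgn x * \<bar>x\<bar> powr (p - 1)) * y + 2 * p * \<bar>y\<bar> powr p"
    if x: "0 < x" for x y :: real
  proof -
    have ypow: "\<bar>y\<bar> * \<bar>y\<bar> powr (p - 1) = \<bar>y\<bar> powr p"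
      using powr_mult_base[of "\<bar>y\<bar>" "p - 1"] by simp
    have yp0: "0 \<le> p * \<bar>y\<bar> powr p" using p by simp
    consider "y = 0" | "0 < y" | "y < 0" "0 < x + y" | "x + y \<le> 0" by linarith
    then show ?thesis
    proof cases
      case 1
      then show ?thesis by simp
    next
      case 2
      obtain z where z: "x < z" "z < x + y" "(x + y) powr p - x powr p = (x + y - x) * (p * z powr (p - 1))"
        using MVT2[of x "x + y" "\<lambda>t. t powr p" "\<lambda>t. p * t powr (p - 1)"] 2 x deriv by force
      have "z powr (p - 1) \<le> x powr (p - 1) + (z - x) powr (p - 1)" using diff[of x z] z x by simp
      also have "(z - x) powr (p - 1) \<le> \<bar>y\<bar> powr (p - 1)" using z p 2 by (intro powr_mono2) auto
      finally have "(p * y) * z powr (p - 1) \<le> (p * y) * (x powr (p - 1) + \<bar>y\<bar> powr (p - 1))"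
        using p 2 by (intro mult_left_mono) auto
      also have "\<dots> = p * x powr (p - 1) * y + p * \<bar>y\<bar> powr p"
        using ypow 2 by (simp add: algebra_simps)
      finally show ?thesis using z x 2 yp0 by (simp add: mult_ac)
    next
      case 3
      obtain z where z: "x + y < z" "z < x" "x powr p - (x + y) powr p = (x - (x + y)) * (p * z powr (p - 1))"
        using MVT2[of "x + y" x "\<lambda>t. t powr p" "\<lambda>t. p * t powr (p - 1)"] 3 deriv by force
      have "x powr (p - 1) \<le> z powr (p - 1) + (x - z) powr (p - 1)" using diff[of z x] z 3 by simp
      also have "(x - z) powr (p - 1) \<le> \<bar>y\<bar> powr (p - 1)" using z p 3 by (intro powr_mono2) auto
      finally have "(p * \<bar>y\<bar>) * x powr (p - 1) \<le> (p * \<bar>y\<bar>) * (z powr (p - 1) + \<bar>y\<bar> powr (p - 1))"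
        using p by (intro mult_left_mono) auto
      also have "\<dots> = p * z powr (p - 1) * \<bar>y\<bar> + p * \<bar>y\<bar> powr p"
        using ypow by (simp add: algebra_simps)
      finally show ?thesis using z x 3 yp0 by (simp add: mult_ac)
    next
      \<comment> \<open>The sign changes, so both \<open>|x + y|\<close> and \<open>x\<close> are at
        most \<open>|y|\<close>; this case accounts for the factor 2.\<close>
      case 4
      have "x powr (p - 1) * \<bar>y\<bar> \<le> \<bar>y\<bar> powr (p - 1) * \<bar>y\<bar>"
        using 4 x p by (intro mult_right_mono powr_mono2) auto
      then have "p * (x powr (p - 1) * \<bar>y\<bar>) \<le> p * \<bar>y\<bar> powr p"
        using ypow p by (intro mult_left_mono) (auto simp: mult.commute)
      moreover have "\<bar>x + y\<bar> powr p \<le> \<bar>y\<bar> powr p" using 4 x p by (intro powr_mono2) auto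
      moreover have "\<bar>y\<bar> powr p \<le> p * \<bar>y\<bar> powr p" using p by (simp add: mult_le_cancel_right1)
      moreover have "\<bar>y\<bar> = - y" using 4 x by simp
      moreover have "sgn x = 1" "\<bar>x\<bar> = x" "0 \<le> x powr p" using x by auto
      ultimately have "\<bar>x + y\<bar> powr p \<le> x powr p - p * (x powr (p - 1) * \<bar>y\<bar>) + 2 * (p * \<bar>y\<bar> powr p)" by linarith
      also have "\<dots> = x powr p + p * (1 * x powr (p - 1)) * y + 2 * p * \<bar>y\<bar> powr p"
        unfolding \<open>\<bar>y\<bar> = - y\<close> by (simp add: algebra_simps)
      finally show ?thesis unfolding \<open>sgn x = 1\<close> \<open>\<bar>x\<bar> = x\<close> .
    qed
  qed
  show ?thesis
  proof (cases "x = 0")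
    case True
    have "\<bar>y\<bar> powr p \<le> 2 * p * \<bar>y\<bar> powr p" using p by (simp add: mult_le_cancel_right1)
    then show ?thesis using True by simp
  next
    case False
    have "\<bar>- x + - y\<bar> = \<bar>x + y\<bar>" by linarith
    then show ?thesis using False pos[of x y] pos[of "- x" "- y"] by (cases "0 < x") (auto simp: sgn_if)
  qed
qed

text \<open>Almost surely the identity under \<open>D\<close>, but it makes
  \<open>1 + \<beta> * clip x\<close> positive for every real \<open>x\<close>, so the logarithms
  need no exceptional sets.\<close>

definition clip :: "real \<Rightarrow> real" where "clip x = max (- 1) x"

lemma clip_measurable [measurable]: "clip \<in> borel_measurable borel"
  unfolding clip_def[abs_def] by measurable

lemma clip_ge: "- 1 \<le> clip x"
  by (simp add: clip_def)

lemma ennreal_term_le_suminf: "f k \<le> suminf f" for f :: "nat \<Rightarrow> ennreal"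
  using sum_le_suminf[of f "{k}"] by simp

section \<open>The product space of the disorder\<close>

locale disorder =
  fixes D :: "real measure"
  assumes prob_D: "prob_space D" and sets_D [measurable_cong]: "sets D = sets borel"
    and support: "measure D {-1..} = 1" and integrable_D: "integrable D (\<lambda>x. x)" and mean_D: "(\<integral>x. x \<partial>D) = 0"
begin

sublocale D: prob_space D by (rule prob_D)

text \<open>Estimates are made on this canonical space, where a coordinate can be overwritten by
  \<open>w(n := y)\<close>; \<open>distr_environment\<close> transfers them to any
  environment.\<close>

definition envs :: "(nat \<Rightarrow> real) measure" where "envs = PiM UNIV (\<lambda>_. D)"

sublocale envs: prob_space envs unfolding envs_def by (intro prob_space_PiM prob_D)

lemma space_envs [simp]: "space envs = UNIV"
  using sets_eq_imp_space_eq[OF sets_D] by (simp add: envs_def space_PiM)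

lemma space_D [simp]: "space D = UNIV"
  using sets_eq_imp_space_eq[OF sets_D] by simp

lemma prob_UNIV [simp]: "measure D UNIV = 1"
  using D.prob_space by simp

lemma emeasure_UNIV [simp]: "emeasure D UNIV = 1" "emeasure envs UNIV = 1"
  using D.emeasure_space_1 envs.emeasure_space_1 by simp_all

lemma coord_measurable [measurable]: "(\<lambda>w. w n) \<in> borel_measurable envs"
proof -
  have "(\<lambda>w. w n) \<in> measurable envs D" unfolding envs_def by measurable
  then show ?thesis by (simp cong: measurable_cong_sets add: sets_D)
qed

lemma update_measurable: "(\<lambda>(w, y). w(n := y)) \<in> measurable (envs \<Otimes>\<^sub>M D) envs"
  unfolding envs_def case_prod_beta by (rule measurable_fun_upd[of UNIV UNIV]) auto

lemma update_measurable_snd: "(\<lambda>y. w(n := y)) \<in> measurable D envs"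
  using measurable_compose[OF measurable_Pair1'[of w envs D] update_measurable[of n]] by simp

text \<open>The form in which independence is used: one coordinate may be replaced by a fresh copy,
  so the inner integral averages over that coordinate alone.\<close>

lemma nn_integral_resample:
  assumes [measurable]: "F \<in> borel_measurable envs"
  shows "(\<integral>\<^sup>+w. F w \<partial>envs) = (\<integral>\<^sup>+w. \<integral>\<^sup>+y. F (w(n := y)) \<partial>D \<partial>envs)"
proof -
  interpret pair_sigma_finite D envs ..
  have [measurable]: "(\<lambda>(y, w). w(n := y)) \<in> measurable (D \<Otimes>\<^sub>M envs) envs"
    unfolding envs_def case_prod_beta by (rule measurable_fun_upd[of UNIV UNIV]) auto
  have "envs = distr (D \<Otimes>\<^sub>M envs) envs (\<lambda>(y, w). w(n := y))"
    using distr_pair_PiM_eq_PiM[of UNIV "\<lambda>_. D" n] prob_D by (simp add: envs_def)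
  then have "(\<integral>\<^sup>+w. F w \<partial>envs) = (\<integral>\<^sup>+w. F w \<partial>distr (D \<Otimes>\<^sub>M envs) envs (\<lambda>(y, w). w(n := y)))"
    by (rule arg_cong)
  also have "\<dots> = (\<integral>\<^sup>+z. F (case z of (y, w) \<Rightarrow> w(n := y)) \<partial>(D \<Otimes>\<^sub>M envs))"
    by (rule nn_integral_distr) measurable
  also have "\<dots> = (\<integral>\<^sup>+w. \<integral>\<^sup>+y. F (w(n := y)) \<partial>D \<partial>envs)"
    by (subst nn_integral_snd[symmetric]) auto
  finally show ?thesis .
qed

lemma distr_shift: "distr envs envs (\<lambda>w i. w (k + i)) = envs"
  using distr_PiM_reindex[of UNIV "\<lambda>_. D" "\<lambda>i. k + i" UNIV] prob_D by (simp add: envs_def inj_on_def restrict_def)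

lemma shift_measurable: "(\<lambda>w i. w (k + i)) \<in> measurable envs envs"
  unfolding envs_def by (rule measurable_PiM_single') (auto simp: space_PiM)

lemma AE_clip: "AE x in D. clip x = x"
proof -
  have "AE x in D. x \<in> {-1..}" using support by (subst D.prob_eq_1[symmetric]) (auto simp: sets_D)
  then show ?thesis by eventually_elim (simp add: clip_def)
qed

lemma clip_measurable_D [measurable]: "clip \<in> borel_measurable D"
  using clip_measurable by (simp cong: measurable_cong_sets add: sets_D)

lemma integrable_clip: "integrable D clip"
  by (rule integrable_cong_AE_imp[OF integrable_D clip_measurable_D]) (use AE_clip in eventually_elim, simp)

lemma integral_clip: "(\<integral>x. clip x \<partial>D) = 0"
  unfolding mean_D[symmetric]
  by (rule integral_cong_AE[OF clip_measurable_D borel_measurable_integrable[OF integrable_D] AE_clip])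

text \<open>The Efron-Stein inequality: one coordinate is integrated out at a time.\<close>

lemma variance_bound:
  assumes "F \<in> borel_measurable envs"
    and "\<And>w w'. (\<And>i. i < N \<Longrightarrow> w i = w' i) \<Longrightarrow> F w = F w'"
    and "\<And>w n y. \<bar>F (w(n := y)) - F (w(n := 0))\<bar> \<le> g y"
    and g [measurable]: "g \<in> borel_measurable D" and g2: "integrable D (\<lambda>y. (g y)\<^sup>2)"
  shows "\<exists>c. (\<integral>\<^sup>+w. ennreal ((F w - c)\<^sup>2) \<partial>envs) \<le> ennreal (real N * (\<integral>y. (g y)\<^sup>2 \<partial>D))"
  using assms(1-3)
proof (induction N arbitrary: F)
  case 0
  \<comment> \<open>With no coordinate left \<open>F\<close> is constant, and this value serves as
    the centre \<open>c\<close>. The centre is existential because integrability over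
    \<open>envs\<close> will itself be derived from this bound.\<close>
  have "F w = F undefined" for w by (rule 0(2)) auto
  then have "(\<integral>\<^sup>+w. ennreal ((F w - F undefined)\<^sup>2) \<partial>envs) = (\<integral>\<^sup>+w. 0 \<partial>envs)"
    by (intro nn_integral_cong) simp
  then show ?case by auto
next
  case (Suc N F)
  note [measurable] = Suc.prems(1)
  define v where "v = (\<integral>y. (g y)\<^sup>2 \<partial>D)"
  have v0: "0 \<le> v" by (simp add: v_def)
  define G where "G = (\<lambda>w. \<integral>y. F (w(N := y)) \<partial>D)"
  have intg: "integrable D g" by (rule D.square_integrable_imp_integrable[OF g g2])
  have Fm: "(\<lambda>y. F (w(N := y))) \<in> borel_measurable D" for w
    by (rule measurable_compose[OF update_measurable_snd Suc.prems(1)])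
  have d_int: "integrable D (\<lambda>y. F (w(N := y)) - F (w(N := 0)))" for w
  proof (rule Bochner_Integration.integrable_bound[OF intg])
    have "norm (F (w(N := y)) - F (w(N := 0))) \<le> norm (g y)" for y
      using Suc.prems(3)[of w N y] unfolding real_norm_def by linarith
    then show "AE y in D. norm (F (w(N := y)) - F (w(N := 0))) \<le> norm (g y)" by (rule AE_I2)
  qed (intro borel_measurable_diff Fm borel_measurable_const)
  have F_int: "integrable D (\<lambda>y. F (w(N := y)))" for w
  proof -
    have "integrable D (\<lambda>y. (F (w(N := y)) - F (w(N := 0))) + F (w(N := 0)))"
      by (rule Bochner_Integration.integrable_add[OF d_int D.integrable_const])
    then show ?thesis by (simp only: diff_add_cancel)
  qed
  have "case_prod (\<lambda>w y. F (w(N := y))) = (\<lambda>z. F (case z of (w, y) \<Rightarrow> w(N := y)))" by (rule ext) (simp add: case_prod_beta)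
  then have "case_prod (\<lambda>w y. F (w(N := y))) \<in> borel_measurable (envs \<Otimes>\<^sub>M D)"
    using measurable_compose[OF update_measurable Suc.prems(1)] by (simp only:)
  then have G: "G \<in> borel_measurable envs" unfolding G_def by (rule D.borel_measurable_lebesgue_integral)
  have "\<exists>c. (\<integral>\<^sup>+w. ennreal ((G w - c)\<^sup>2) \<partial>envs) \<le> ennreal (real N * v)"
    unfolding v_def
  proof (rule Suc.IH)
    show "G \<in> borel_measurable envs" by (rule G)
    show "G w = G w'" if "\<And>i. i < N \<Longrightarrow> w i = w' i" for w w'
      unfolding G_def by (intro Bochner_Integration.integral_cong refl Suc.prems(2)) (use that in auto)
    show "\<bar>G (w(n := y)) - G (w(n := 0))\<bar> \<le> g y" for w n y
    proof (cases "n = N")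
      case True
      then have "G (w(n := y)) = G (w(n := 0))" by (simp add: G_def)
      then show ?thesis using Suc.prems(3)[of w n y] by simp
    next
      case False
      have "\<bar>G (w(n := y)) - G (w(n := 0))\<bar> = \<bar>\<integral>z. F (w(n := y, N := z)) - F (w(n := 0, N := z)) \<partial>D\<bar>"
        unfolding G_def by (subst Bochner_Integration.integral_diff[OF F_int F_int]) simp
      also have "\<dots> \<le> (\<integral>z. \<bar>F (w(n := y, N := z)) - F (w(n := 0, N := z))\<bar> \<partial>D)" by (rule integral_abs_bound)
      also have "\<dots> \<le> (\<integral>z. g y \<partial>D)"
      proof (intro integral_mono Bochner_Integration.integrable_abs Bochner_Integration.integrable_diff F_int)
        fix z
        show "\<bar>F (w(n := y, N := z)) - F (w(n := 0, N := z))\<bar> \<le> g y"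
          unfolding fun_upd_twist[OF False] by (rule Suc.prems(3))
      qed simp
      finally show ?thesis by simp
    qed
  qed
  then obtain c where c: "(\<integral>\<^sup>+w. ennreal ((G w - c)\<^sup>2) \<partial>envs) \<le> ennreal (real N * v)" by blast
  \<comment> \<open>With the other coordinates fixed, the second moment about \<open>c\<close> is
    the squared distance of the conditional mean \<open>G w\<close> from \<open>c\<close> plus a
    conditional variance. The latter is at most \<open>v\<close>, since increments from the
    reference point \<open>w(N := 0)\<close> are bounded by \<open>g\<close>.\<close>
  have inner: "(\<integral>\<^sup>+y. ennreal ((F (w(N := y)) - c)\<^sup>2) \<partial>D) \<le> ennreal ((G w - c)\<^sup>2) + ennreal v" for w
  proof -
    define a where "a = (\<lambda>y. F (w(N := y)) - F (w(N := 0)))"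
    define k where "k = F (w(N := 0)) - c"
    have a_le: "\<bar>a y\<bar> \<le> g y" for y unfolding a_def by (rule Suc.prems(3))
    have a2: "(a y)\<^sup>2 \<le> (g y)\<^sup>2" for y
      using a_le[of y] by (simp add: abs_le_square_iff[symmetric])
    have [measurable]: "a \<in> borel_measurable D" unfolding a_def by (intro borel_measurable_diff Fm borel_measurable_const)
    have a_int: "integrable D a" unfolding a_def by (rule d_int)
    have a2_int: "integrable D (\<lambda>y. (a y)\<^sup>2)"
      by (rule Bochner_Integration.integrable_bound[OF g2]) (use a2 in auto)
    have "(\<lambda>y. (F (w(N := y)) - c)\<^sup>2) = (\<lambda>y. (a y)\<^sup>2 + 2 * k * a y + k\<^sup>2)"
      by (auto simp: a_def k_def power2_eq_square algebra_simps)
    moreover have "integrable D (\<lambda>y. (a y)\<^sup>2 + 2 * k * a y + k\<^sup>2)" using a_int a2_int by simp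
    ultimately have "(\<integral>\<^sup>+y. ennreal ((F (w(N := y)) - c)\<^sup>2) \<partial>D) = ennreal (\<integral>y. (a y)\<^sup>2 + 2 * k * a y + k\<^sup>2 \<partial>D)"
      by (subst nn_integral_eq_integral) (auto simp del: ennreal_plus)
    also have "\<dots> \<le> ennreal (v + (G w - c)\<^sup>2)"
    proof (rule ennreal_leI)
      have "(\<integral>y. (a y)\<^sup>2 + 2 * k * a y + k\<^sup>2 \<partial>D) = (\<integral>y. (a y)\<^sup>2 \<partial>D) + 2 * k * (\<integral>y. a y \<partial>D) + k\<^sup>2"
        using a_int a2_int D.prob_space by simp
      also have "(\<integral>y. (a y)\<^sup>2 \<partial>D) \<le> v" unfolding v_def by (intro integral_mono a2_int g2 a2)
      also have "v + 2 * k * (\<integral>y. a y \<partial>D) + k\<^sup>2 \<le> v + ((\<integral>y. a y \<partial>D) + k)\<^sup>2"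
        by (simp add: power2_eq_square algebra_simps)
      also have "(\<integral>y. a y \<partial>D) + k = G w - c"
        unfolding a_def k_def G_def by (subst Bochner_Integration.integral_diff[OF F_int D.integrable_const]) simp
      finally show "(\<integral>y. (a y)\<^sup>2 + 2 * k * a y + k\<^sup>2 \<partial>D) \<le> v + (G w - c)\<^sup>2" by simp
    qed
    finally show ?thesis using v0 by (simp add: add.commute)
  qed
  have "(\<integral>\<^sup>+w. ennreal ((F w - c)\<^sup>2) \<partial>envs) = (\<integral>\<^sup>+w. \<integral>\<^sup>+y. ennreal ((F (w(N := y)) - c)\<^sup>2) \<partial>D \<partial>envs)"
    by (rule nn_integral_resample) simp
  also have "\<dots> \<le> (\<integral>\<^sup>+w. ennreal ((G w - c)\<^sup>2) + ennreal v \<partial>envs)" by (intro nn_integral_mono inner)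
  also have "\<dots> = (\<integral>\<^sup>+w. ennreal ((G w - c)\<^sup>2) \<partial>envs) + ennreal v"
  proof (subst nn_integral_add)
    note [measurable] = G
    show "(\<lambda>w. ennreal ((G w - c)\<^sup>2)) \<in> borel_measurable envs" by measurable
  qed (auto simp: envs.emeasure_space_1)
  also have "\<dots> \<le> ennreal (real N * v) + ennreal v" by (intro add_right_mono c)
  also have "\<dots> = ennreal (real (Suc N) * v)" using v0 by (simp add: ennreal_plus[symmetric] algebra_simps del: ennreal_plus)
  finally show ?case unfolding v_def by blast
qed

text \<open>The von Bahr-Esseen step: the linear term of the expansion integrates to zero.\<close>

lemma moment_step:
  fixes X Y :: "(nat \<Rightarrow> real) \<Rightarrow> real"
  assumes p: "1 < p" "p \<le> 2" and mom: "integrable D (\<lambda>y. \<bar>clip y\<bar> powr p)"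
    and [measurable]: "X \<in> borel_measurable envs" "Y \<in> borel_measurable envs"
    and X: "\<And>w y. X (w(n := y)) = X w" and Y: "\<And>w y. Y (w(n := y)) = Y w"
  shows "(\<integral>\<^sup>+w. ennreal (\<bar>X w + clip (w n) * Y w\<bar> powr p) \<partial>envs) \<le>
    (\<integral>\<^sup>+w. ennreal (\<bar>X w\<bar> powr p) \<partial>envs) +
    ennreal (2 * p * (\<integral>y. \<bar>clip y\<bar> powr p \<partial>D)) * (\<integral>\<^sup>+w. ennreal (\<bar>Y w\<bar> powr p) \<partial>envs)"
proof -
  define m where "m = (\<integral>y. \<bar>clip y\<bar> powr p \<partial>D)"
  have m0: "0 \<le> m" by (simp add: m_def)
  have inner: "(\<integral>\<^sup>+y. ennreal (\<bar>X w + clip y * Y w\<bar> powr p) \<partial>D) \<le>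
      ennreal (\<bar>X w\<bar> powr p) + ennreal (2 * p * m) * ennreal (\<bar>Y w\<bar> powr p)" for w
  proof -
    let ?b = "\<lambda>y. \<bar>X w\<bar> powr p + p * (sgn (X w) * \<bar>X w\<bar> powr (p - 1)) * (clip y * Y w) + 2 * p * \<bar>clip y * Y w\<bar> powr p"
    have le: "\<bar>X w + clip y * Y w\<bar> powr p \<le> ?b y" for y by (rule abs_powr_add_le[OF p])
    have eq: "?b = (\<lambda>y. \<bar>X w\<bar> powr p + (p * (sgn (X w) * \<bar>X w\<bar> powr (p - 1)) * Y w) * clip y + (2 * p * \<bar>Y w\<bar> powr p) * \<bar>clip y\<bar> powr p)"
      by (auto simp: abs_mult powr_mult mult_ac)
    have int: "integrable D ?b" unfolding eq using mom integrable_clip by simp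
    have "(\<integral>\<^sup>+y. ennreal (\<bar>X w + clip y * Y w\<bar> powr p) \<partial>D) \<le> (\<integral>\<^sup>+y. ennreal (?b y) \<partial>D)"
      by (intro nn_integral_mono ennreal_leI le)
    also have "\<dots> = ennreal (\<integral>y. ?b y \<partial>D)"
      using int le by (intro nn_integral_eq_integral) (auto intro!: AE_I2 order_trans[OF powr_ge_zero])
    also have "(\<integral>y. ?b y \<partial>D) = \<bar>X w\<bar> powr p + 2 * p * m * \<bar>Y w\<bar> powr p"
    proof -
      have *: "(\<integral>y. a + b * clip y + c * \<bar>clip y\<bar> powr p \<partial>D) = a + c * m" for a b c
        using mom integrable_clip by (simp add: integral_clip m_def)
      show ?thesis unfolding eq * by (simp only: mult_ac)
    qed
    finally show ?thesis using m0 p by (simp add: ennreal_plus[symmetric] ennreal_mult'[symmetric] del: ennreal_plus)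
  qed
  have "(\<integral>\<^sup>+w. ennreal (\<bar>X w + clip (w n) * Y w\<bar> powr p) \<partial>envs) =
      (\<integral>\<^sup>+w. \<integral>\<^sup>+y. ennreal (\<bar>X w + clip y * Y w\<bar> powr p) \<partial>D \<partial>envs)"
  proof -
    have "(\<integral>\<^sup>+w. ennreal (\<bar>X w + clip (w n) * Y w\<bar> powr p) \<partial>envs) =
      (\<integral>\<^sup>+w. \<integral>\<^sup>+y. ennreal (\<bar>X (w(n := y)) + clip ((w(n := y)) n) * Y (w(n := y))\<bar> powr p) \<partial>D \<partial>envs)"
      by (rule nn_integral_resample) measurable
    then show ?thesis by (simp only: X Y fun_upd_same)
  qed
  also have "\<dots> \<le> (\<integral>\<^sup>+w. ennreal (\<bar>X w\<bar> powr p) + ennreal (2 * p * m) * ennreal (\<bar>Y w\<bar> powr p) \<partial>envs)"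
    by (intro nn_integral_mono inner)
  also have "\<dots> = (\<integral>\<^sup>+w. ennreal (\<bar>X w\<bar> powr p) \<partial>envs) + ennreal (2 * p * m) * (\<integral>\<^sup>+w. ennreal (\<bar>Y w\<bar> powr p) \<partial>envs)"
    by (subst nn_integral_add) (auto simp: nn_integral_cmult)
  finally show ?thesis by (simp add: m_def)
qed

text \<open>Dyadic layers: if \<open>2 ^ k \<le> y \<le> 2 ^ Suc k\<close>, then
  \<open>y powr p\<close> is at most \<open>2 powr (p * Suc k)\<close>, and the layer has
  probability of order at most \<open>2 powr -(\<gamma> * k)\<close>. The resulting series is
  dominated by a geometric one of ratio \<open>2 powr (p - \<gamma>)\<close>.\<close>

lemma integrable_clip_powr:
  assumes tail: "(\<lambda>x. measure D {x..}) \<sim>[at_top] (\<lambda>x. C * x powr - \<gamma>)" and C: "0 < C" and p: "0 < p" "p < \<gamma>"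
  shows "integrable D (\<lambda>y. \<bar>clip y\<bar> powr p)"
proof -
  let ?g = "\<lambda>x::real. C * x powr - \<gamma>"
  define a where "a = (\<lambda>k::nat. (2::real) powr (p * real (Suc k)) * measure D {2 ^ k..})"
  have "\<forall>\<^sub>F x in at_top. dist (if measure D {x..} = 0 \<and> ?g x = 0 then 1 else measure D {x..} / ?g x) 1 < 1"
    using tail unfolding asymp_equiv_def by (rule tendstoD) simp
  then have "\<forall>\<^sub>F x in at_top. measure D {x..} \<le> 2 * ?g x"
    using eventually_gt_at_top[of 0]
  proof eventually_elim
    case (elim x)
    have pos: "0 < ?g x" using elim C by simp
    then have "\<not> (measure D {x..} = 0 \<and> ?g x = 0)" by linarith
    then have "\<bar>measure D {x..} / ?g x - 1\<bar> < 1" using elim(1) unfolding dist_real_def by (simp only: if_False)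
    then have "measure D {x..} / ?g x \<le> 2" by linarith
    then show ?case using pos by (simp add: field_simps)
  qed
  then have "\<forall>\<^sub>F k in sequentially. measure D {2 ^ k..} \<le> 2 * ?g (2 ^ k)"
    by (rule eventually_compose_filterlim) real_asymp
  then have "\<forall>\<^sub>F k in sequentially. norm (a k) \<le> 2 * C * 2 powr p * (2 powr (p - \<gamma>)) ^ k"
  proof eventually_elim
    case (elim k)
    have "a k \<le> 2 powr (p * real (Suc k)) * (2 * (C * (2 ^ k) powr - \<gamma>))"
      unfolding a_def by (intro mult_left_mono elim) auto
    also have "\<dots> = 2 * C * (2 powr (p * real (Suc k)) * (2 powr real k) powr - \<gamma>)" by (simp add: powr_realpow)
    also have "2 powr (p * real (Suc k)) * (2 powr real k) powr - \<gamma> = 2 powr p * (2 powr (p - \<gamma>)) powr real k"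
      by (simp add: powr_powr powr_add[symmetric] algebra_simps)
    also have "(2 powr (p - \<gamma>)) powr real k = (2 powr (p - \<gamma>)) ^ k" by (simp add: powr_realpow)
    finally show ?case by (simp add: a_def mult.assoc)
  qed
  moreover have "(2::real) powr (p - \<gamma>) < 1" using p powr_less_mono[of "p - \<gamma>" 0 "2::real"] by simp
  then have "summable (\<lambda>k. 2 * C * 2 powr p * (2 powr (p - \<gamma>)) ^ k)"
    by (intro summable_mult summable_geometric) auto
  ultimately have sum_a: "summable a" by (rule summable_comparison_test_ev)
  have "(\<integral>\<^sup>+y. ennreal (\<bar>clip y\<bar> powr p) \<partial>D) \<le>
      (\<integral>\<^sup>+y. 1 + (\<Sum>k. ennreal (2 powr (p * real (Suc k))) * indicator {2 ^ k..} y) \<partial>D)"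
  proof (intro nn_integral_mono)
    fix y
    show "ennreal (\<bar>clip y\<bar> powr p) \<le> 1 + (\<Sum>k. ennreal (2 powr (p * real (Suc k))) * indicator {2 ^ k..} y)"
    proof (cases "y \<le> 1")
      case True
      then have "\<bar>clip y\<bar> powr p \<le> 1 powr p" using p by (intro powr_mono2) (auto simp: clip_def)
      then have "ennreal (\<bar>clip y\<bar> powr p) \<le> 1" by simp
      then show ?thesis by (rule order_trans) simp
    next
      case False
      define k where "k = nat \<lfloor>log 2 y\<rfloor>"
      have "0 \<le> log 2 y" using False by simp
      then have k: "real k \<le> log 2 y" "log 2 y \<le> real (Suc k)" unfolding k_def by (auto; linarith)+
      have k1: "2 ^ k \<le> y" using k(1) False by (simp add: le_log_iff powr_realpow)
      have "\<bar>clip y\<bar> powr p \<le> (2 powr real (Suc k)) powr p"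
        using k(2) False p by (intro powr_mono2) (auto simp: clip_def log_le_iff)
      then have "ennreal (\<bar>clip y\<bar> powr p) \<le> ennreal (2 powr (p * real (Suc k))) * indicator {2 ^ k..} y"
        using k1 by (simp add: powr_powr mult.commute)
      also have "\<dots> \<le> (\<Sum>k. ennreal (2 powr (p * real (Suc k))) * indicator {2 ^ k..} y)"
        by (rule ennreal_term_le_suminf)
      finally show ?thesis by (rule order_trans) simp
    qed
  qed
  also have "\<dots> = 1 + (\<Sum>k. ennreal (a k))"
  proof -
    have [measurable]: "{2 ^ k..} \<in> sets D" for k by (simp add: sets_D)
    show ?thesis
      by (subst nn_integral_add) (auto simp: nn_integral_suminf nn_integral_cmult D.emeasure_space_1 a_def D.emeasure_eq_measure ennreal_mult)
  qed
  also have "\<dots> < \<infinity>"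
  proof -
    have "(\<Sum>k. ennreal (a k)) = ennreal (suminf a)" by (rule suminf_ennreal2[OF _ sum_a]) (simp add: a_def)
    then show ?thesis by simp
  qed
  finally show ?thesis by (intro integrableI_nonneg) auto
qed

end

section \<open>Moments of the partition function\<close>

lemma min_weight_ge:
  fixes x :: real
  assumes "0 < \<beta>" "\<beta> < 1"
  shows "1 - \<beta> \<le> 1 + \<beta> * clip x" "0 < 1 + \<beta> * clip x"
proof -
  have "\<beta> * - 1 \<le> \<beta> * clip x" using assms clip_ge by (intro mult_left_mono) auto
  then show "1 - \<beta> \<le> 1 + \<beta> * clip x" "0 < 1 + \<beta> * clip x" using assms by auto
qed

locale pinning = disorder +
  fixes K :: "nat \<Rightarrow> real" and \<beta> :: real
  assumes K_nonneg: "\<And>n. 0 \<le> K n" and K_0: "K 0 = 0" and K_sums: "K sums 1"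
    and \<beta>: "0 < \<beta>" "\<beta> < 1"
begin

definition weight :: "(nat \<Rightarrow> real) \<Rightarrow> nat \<Rightarrow> real" where "weight w n = 1 + \<beta> * clip (w n)"

abbreviation renewal :: "nat \<Rightarrow> real" where "renewal \<equiv> pinned K (\<lambda>_. 1)"

lemma weight_ge: "1 - \<beta> \<le> weight w n" and weight_pos: "0 < weight w n"
  using min_weight_ge[OF \<beta>] by (auto simp: weight_def)

lemma weight_nonneg: "0 \<le> weight w n"
  using weight_pos[of w n] by simp

lemma weight_measurable [measurable]: "(\<lambda>w. weight w n) \<in> borel_measurable envs"
  unfolding weight_def by measurable

lemma walk_measurable [measurable]: "(\<lambda>w. walk K (weight w) k N) \<in> borel_measurable envs"
proof (induction k arbitrary: N)
  case (Suc k)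
  note [measurable] = Suc
  show ?case unfolding walk.simps by measurable
qed simp

lemma pinned_measurable [measurable]: "(\<lambda>w. pinned K (weight w) N) \<in> borel_measurable envs"
  unfolding pinned_def by measurable

lemma approach_measurable [measurable]: "(\<lambda>w. approach K (weight w) N) \<in> borel_measurable envs"
  unfolding approach_def by measurable

lemma walk_weight_nonneg: "0 \<le> walk K (weight w) k N"
  by (intro walk_nonneg K_nonneg weight_nonneg)

lemma approach_weight_nonneg: "0 \<le> approach K (weight w) N"
  by (intro approach_nonneg K_nonneg weight_nonneg)

lemma walk_one_nonneg: "0 \<le> walk K (\<lambda>_. 1) k N"
  by (intro walk_nonneg K_nonneg) simp

lemma renewal_nonneg: "0 \<le> renewal N"
  by (intro pinned_nonneg K_nonneg) simp

lemma tail_K_nonneg: "0 \<le> tail K n"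
  by (intro tail_nonneg K_nonneg K_sums)

lemma tail_K_le_1: "tail K n \<le> 1"
  unfolding tail_def using sum_nonneg[of "{..n}" K] K_nonneg by simp

lemma walk_upd: "m < n \<Longrightarrow> walk K (weight (w(n := y))) k m = walk K (weight w) k m"
  by (intro walk_cong) (auto simp: weight_def)

lemma approach_upd: "m \<le> n \<Longrightarrow> approach K (weight (w(n := y))) m = approach K (weight w) m"
  by (intro approach_cong) (auto simp: weight_def)

lemma nn_integral_weight: "(\<integral>\<^sup>+y. ennreal (1 + \<beta> * clip y) \<partial>D) = 1"
proof -
  have "(\<integral>\<^sup>+y. ennreal (1 + \<beta> * clip y) \<partial>D) = ennreal (\<integral>y. 1 + \<beta> * clip y \<partial>D)"
    using integrable_clip min_weight_ge[OF \<beta>] by (intro nn_integral_eq_integral) (auto intro!: AE_I2 less_imp_le)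
  also have "(\<integral>y. 1 + \<beta> * clip y \<partial>D) = 1" using integrable_clip by (simp add: integral_clip)
  finally show ?thesis by simp
qed

text \<open>The sum \<open>S\<close> over the earlier contacts does not involve \<open>w N\<close>,
  and the weight at \<open>N\<close> has mean one; averaging it out leaves the homogeneous
  recursion.\<close>

lemma nn_integral_walk: "(\<integral>\<^sup>+w. ennreal (walk K (weight w) k N) \<partial>envs) = ennreal (walk K (\<lambda>_. 1) k N)"
proof (induction k arbitrary: N)
  case (Suc k)
  define S where "S = (\<lambda>w. \<Sum>m<N. walk K (weight w) k m * K (N - m))"
  have S0: "0 \<le> S w" for w unfolding S_def by (intro sum_nonneg mult_nonneg_nonneg walk_weight_nonneg K_nonneg)
  have [measurable]: "S \<in> borel_measurable envs" unfolding S_def by measurable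
  have S_upd: "S (w(N := y)) = S w" for w y
    unfolding S_def by (intro sum.cong refl) (simp add: walk_upd)
  have "(\<integral>\<^sup>+w. ennreal (walk K (weight w) (Suc k) N) \<partial>envs) = (\<integral>\<^sup>+w. ennreal ((1 + \<beta> * clip (w N)) * S w) \<partial>envs)"
    by (simp add: weight_def S_def)
  also have "\<dots> = (\<integral>\<^sup>+w. \<integral>\<^sup>+y. ennreal ((1 + \<beta> * clip ((w(N := y)) N)) * S (w(N := y))) \<partial>D \<partial>envs)"
    by (rule nn_integral_resample) measurable
  also have "\<dots> = (\<integral>\<^sup>+w. \<integral>\<^sup>+y. ennreal (S w) * ennreal (1 + \<beta> * clip y) \<partial>D \<partial>envs)"
    unfolding S_upd fun_upd_same using S0 by (intro nn_integral_cong) (simp add: ennreal_mult'[symmetric] mult.commute)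
  also have "\<dots> = (\<integral>\<^sup>+w. ennreal (S w) \<partial>envs)"
    by (simp add: nn_integral_cmult nn_integral_weight)
  also have "\<dots> = (\<integral>\<^sup>+w. (\<Sum>m<N. ennreal (K (N - m)) * ennreal (walk K (weight w) k m)) \<partial>envs)"
    unfolding S_def by (intro nn_integral_cong)
      (simp add: sum_ennreal[symmetric] walk_weight_nonneg K_nonneg ennreal_mult mult.commute)
  also have "\<dots> = (\<Sum>m<N. ennreal (K (N - m)) * ennreal (walk K (\<lambda>_. 1) k m))"
    by (subst nn_integral_sum) (auto simp: nn_integral_cmult Suc)
  also have "\<dots> = ennreal (walk K (\<lambda>_. 1) (Suc k) N)"
    by (simp add: sum_ennreal[symmetric] walk_one_nonneg K_nonneg ennreal_mult mult.commute)
  finally show ?case .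
qed simp

lemma nn_integral_walk_sum:
  assumes "finite A" "\<And>k m. 0 \<le> f k m"
  shows "(\<integral>\<^sup>+w. ennreal (\<Sum>k\<in>A. \<Sum>m\<le>N. walk K (weight w) k m * f k m) \<partial>envs) =
    ennreal (\<Sum>k\<in>A. \<Sum>m\<le>N. walk K (\<lambda>_. 1) k m * f k m)"
proof -
  have "ennreal (\<Sum>k\<in>A. \<Sum>m\<le>N. walk K (weight w) k m * f k m) =
      (\<Sum>k\<in>A. \<Sum>m\<le>N. ennreal (walk K (weight w) k m) * ennreal (f k m))" for w
    using assms(2) by (simp add: sum_ennreal[symmetric] sum_nonneg walk_weight_nonneg ennreal_mult)
  then show ?thesis
    using assms(2) by (simp add: nn_integral_sum nn_integral_multc nn_integral_walk sum_ennreal[symmetric]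
      sum_nonneg walk_one_nonneg ennreal_mult)
qed

section \<open>Moments of order p\<close>

definition moment :: "real \<Rightarrow> nat \<Rightarrow> ennreal" where
  "moment p n = (\<integral>\<^sup>+w. ennreal (approach K (weight w) n powr p) \<partial>envs)"

text \<open>The constant of \<open>moment_step\<close> for increments \<open>\<beta> * clip\<close>.
  Its factor \<open>\<beta> powr p\<close> is where small \<beta> helps.\<close>

definition growth :: "real \<Rightarrow> real" where
  "growth p = 2 * p * (\<integral>y. \<bar>clip y\<bar> powr p \<partial>D) * \<beta> powr p"

text \<open>The increment at \<open>j\<close> is \<open>clip (w j) * Y w\<close> with
  \<open>X\<close> and \<open>Y\<close> free of \<open>w j\<close>, so \<open>moment_step\<close>
  applies. The coefficients \<open>b\<close> serve two cases: \<open>renewal (n - m)\<close> for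
  \<open>approach\<close>, and 1 for \<open>free\<close>.\<close>

lemma martingale_moment:
  assumes p: "1 < p" "p \<le> 2" and mom: "integrable D (\<lambda>y. \<bar>clip y\<bar> powr p)"
  shows "(\<integral>\<^sup>+w. ennreal (\<bar>c + (\<Sum>m\<in>{1..<j}. (weight w m - 1) * approach K (weight w) m * b m)\<bar> powr p) \<partial>envs) \<le>
    ennreal (\<bar>c\<bar> powr p) + ennreal (growth p) * (\<Sum>m\<in>{1..<j}. ennreal (\<bar>b m\<bar> powr p) * moment p m)"
proof (induction j)
  case (Suc j)
  define X where "X = (\<lambda>w. c + (\<Sum>m\<in>{1..<j}. (weight w m - 1) * approach K (weight w) m * b m))"
  define Y where "Y = (\<lambda>w. \<beta> * approach K (weight w) j * b j)"
  define M where "M = (\<integral>y. \<bar>clip y\<bar> powr p \<partial>D)"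
  have M0: "0 \<le> M" by (simp add: M_def)
  show ?case
  proof (cases "j = 0")
    case False
    have [measurable]: "X \<in> borel_measurable envs" "Y \<in> borel_measurable envs"
      unfolding X_def Y_def by measurable
    have X_upd: "X (w(j := y)) = X w" for w y
      unfolding X_def by (intro arg_cong2[of _ _ _ _ "(+)"] sum.cong refl) (auto simp: approach_upd, simp add: weight_def)
    have Y_upd: "Y (w(j := y)) = Y w" for w y
      unfolding Y_def by (simp add: approach_upd)
    have "(\<integral>\<^sup>+w. ennreal (\<bar>c + (\<Sum>m\<in>{1..<Suc j}. (weight w m - 1) * approach K (weight w) m * b m)\<bar> powr p) \<partial>envs) =
        (\<integral>\<^sup>+w. ennreal (\<bar>X w + clip (w j) * Y w\<bar> powr p) \<partial>envs)"
      using False by (intro nn_integral_cong) (simp add: X_def Y_def weight_def add_ac mult_ac)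
    also have "\<dots> \<le> (\<integral>\<^sup>+w. ennreal (\<bar>X w\<bar> powr p) \<partial>envs) + ennreal (2 * p * M) * (\<integral>\<^sup>+w. ennreal (\<bar>Y w\<bar> powr p) \<partial>envs)"
      unfolding M_def by (rule moment_step[OF p mom _ _ X_upd Y_upd]) measurable
    also have "(\<integral>\<^sup>+w. ennreal (\<bar>Y w\<bar> powr p) \<partial>envs) = ennreal (\<beta> powr p * \<bar>b j\<bar> powr p) * moment p j"
    proof -
      have "ennreal (\<bar>Y w\<bar> powr p) = ennreal (\<beta> powr p * \<bar>b j\<bar> powr p) * ennreal (approach K (weight w) j powr p)" for w
        using \<beta> approach_weight_nonneg[of w j]
        by (simp add: Y_def abs_mult powr_mult ennreal_mult'[symmetric] mult_ac)
      then show ?thesis by (simp add: nn_integral_cmult moment_def)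
    qed
    also have "ennreal (2 * p * M) * (ennreal (\<beta> powr p * \<bar>b j\<bar> powr p) * moment p j) = ennreal (growth p) * (ennreal (\<bar>b j\<bar> powr p) * moment p j)"
      using M0 p by (simp add: growth_def M_def[symmetric] ennreal_mult mult_ac)
    also have "(\<integral>\<^sup>+w. ennreal (\<bar>X w\<bar> powr p) \<partial>envs) \<le>
        ennreal (\<bar>c\<bar> powr p) + ennreal (growth p) * (\<Sum>m\<in>{1..<j}. ennreal (\<bar>b m\<bar> powr p) * moment p m)"
      unfolding X_def by (rule Suc)
    finally show ?thesis using False by (simp add: distrib_left add.assoc)
  qed simp
qed simp

lemma moment_rec:
  assumes p: "1 < p" "p \<le> 2" and mom: "integrable D (\<lambda>y. \<bar>clip y\<bar> powr p)" and n: "0 < n"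
  shows "moment p n \<le> ennreal (renewal n powr p) +
    ennreal (growth p) * (\<Sum>m\<in>{1..<n}. ennreal (renewal (n - m) powr p) * moment p m)"
proof -
  have "moment p n = (\<integral>\<^sup>+w. ennreal (\<bar>renewal n + (\<Sum>m\<in>{1..<n}. (weight w m - 1) * approach K (weight w) m * renewal (n - m))\<bar> powr p) \<partial>envs)"
    unfolding moment_def
  proof (intro nn_integral_cong arg_cong[of _ _ "\<lambda>x. ennreal (x powr p)"])
    fix w
    show "approach K (weight w) n = \<bar>renewal n + (\<Sum>m\<in>{1..<n}. (weight w m - 1) * approach K (weight w) m * renewal (n - m))\<bar>"
      using approach_resolvent[OF n, of K "weight w"] approach_weight_nonneg[of w n] by simp
  qed
  also have "\<dots> \<le> ennreal (\<bar>renewal n\<bar> powr p) + ennreal (growth p) * (\<Sum>m\<in>{1..<n}. ennreal (\<bar>renewal (n - m)\<bar> powr p) * moment p m)"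
    by (rule martingale_moment[OF p mom])
  finally show ?thesis by (simp add: renewal_nonneg)
qed

lemma growth_nonneg: "0 < p \<Longrightarrow> 0 \<le> growth p"
  by (simp add: growth_def)

text \<open>Summing \<open>moment_rec\<close> and exchanging the sums bounds the next partial sum by
  \<open>s + growth p * s\<close> times an earlier one; as \<open>growth p * s \<le> 1 / 2\<close>,
  the bound \<open>2 * s\<close> reproduces itself. Absorbing the full sum into the left side
  instead would presuppose its finiteness.\<close>

lemma sum_moment_le:
  assumes p: "1 < p" "p \<le> 2" and mom: "integrable D (\<lambda>y. \<bar>clip y\<bar> powr p)"
    and S: "summable (\<lambda>n. renewal n powr p)" "growth p * (\<Sum>n. renewal n powr p) \<le> 1 / 2"
  shows "(\<Sum>n\<in>{1..<N}. moment p n) \<le> ennreal (2 * (\<Sum>n. renewal n powr p))"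
proof (induction N)
  case (Suc N)
  define s where "s = (\<Sum>n. renewal n powr p)"
  have s0: "0 \<le> s" unfolding s_def by (intro suminf_nonneg S) simp
  have g0: "0 \<le> growth p" using p by (intro growth_nonneg) simp
  have part: "(\<Sum>n\<in>A. ennreal (renewal n powr p)) \<le> ennreal s" if "finite A" for A
    unfolding s_def using that S(1) by (subst sum_ennreal) (auto intro!: ennreal_leI sum_le_suminf)
  have "(\<Sum>n\<in>{1..<Suc N}. moment p n) \<le> (\<Sum>n\<in>{1..<Suc N}. ennreal (renewal n powr p) +
      ennreal (growth p) * (\<Sum>m\<in>{1..<n}. ennreal (renewal (n - m) powr p) * moment p m))"
    by (intro sum_mono moment_rec[OF p mom]) auto
  also have "\<dots> = (\<Sum>n\<in>{1..<Suc N}. ennreal (renewal n powr p)) +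
      ennreal (growth p) * (\<Sum>n\<in>{1..<Suc N}. \<Sum>m\<in>{1..<n}. ennreal (renewal (n - m) powr p) * moment p m)"
    by (simp only: sum.distrib sum_distrib_left)
  also have "(\<Sum>n\<in>{1..<Suc N}. \<Sum>m\<in>{1..<n}. ennreal (renewal (n - m) powr p) * moment p m) =
      (\<Sum>m\<in>{1..<Suc N}. \<Sum>n\<in>{m<..<Suc N}. ennreal (renewal (n - m) powr p) * moment p m)"
    by (rule sum_triangle)
  also have "\<dots> = (\<Sum>m\<in>{1..<N}. \<Sum>n\<in>{m<..<Suc N}. ennreal (renewal (n - m) powr p) * moment p m)"
    by (cases "N = 0") auto
  also have "\<dots> \<le> (\<Sum>m\<in>{1..<N}. ennreal s * moment p m)"
  proof (intro sum_mono)
    fix m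
    have "(\<Sum>n\<in>{m<..<Suc N}. ennreal (renewal (n - m) powr p) * moment p m) =
        (\<Sum>n\<in>(\<lambda>n. n - m) ` {m<..<Suc N}. ennreal (renewal n powr p)) * moment p m"
      by (subst sum.reindex) (auto simp: inj_on_def sum_distrib_right simp del: sum_ennreal)
    also have "\<dots> \<le> ennreal s * moment p m" by (intro mult_right_mono part) auto
    finally show "(\<Sum>n\<in>{m<..<Suc N}. ennreal (renewal (n - m) powr p) * moment p m) \<le> ennreal s * moment p m" .
  qed
  also have "\<dots> = ennreal s * (\<Sum>m\<in>{1..<N}. moment p m)" by (simp add: sum_distrib_left)
  also have "\<dots> \<le> ennreal s * ennreal (2 * s)" unfolding s_def by (intro mult_left_mono Suc) simp
  finally have "(\<Sum>n\<in>{1..<Suc N}. moment p n) \<le> (\<Sum>n\<in>{1..<Suc N}. ennreal (renewal n powr p)) +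
      ennreal (growth p) * (ennreal s * ennreal (2 * s))"
    by (simp add: add_left_mono mult_left_mono)
  also have "\<dots> \<le> ennreal s + ennreal (growth p) * (ennreal s * ennreal (2 * s))"
    by (intro add_right_mono part) simp
  also have "ennreal s + ennreal (growth p) * (ennreal s * ennreal (2 * s)) = ennreal (s + growth p * (s * (2 * s)))"
    using s0 g0 by (simp add: ennreal_mult ennreal_plus)
  also have "\<dots> \<le> ennreal (2 * s)"
    using mult_right_mono[OF S(2), of "2 * s"] s0 by (intro ennreal_leI) (simp add: s_def[symmetric] mult_ac)
  finally show ?case unfolding s_def .
qed simp

text \<open>The partition function with free endpoint: \<open>m\<close> is the last contact and
  \<open>tail K (N - m)\<close> the probability of none between it and \<open>N\<close> inclusive.
  The sum over \<open>k\<close> is kept so that paths with few contacts can be removed.\<close>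

definition free :: "nat \<Rightarrow> (nat \<Rightarrow> real) \<Rightarrow> real" where
  "free N w = (\<Sum>k\<le>N. \<Sum>m\<le>N. walk K (weight w) k m * tail K (N - m))"

lemma free_eq_pinned: "free N w = (\<Sum>m\<le>N. pinned K (weight w) m * tail K (N - m))"
proof -
  have "free N w = (\<Sum>m\<le>N. \<Sum>k\<le>N. walk K (weight w) k m * tail K (N - m))"
    unfolding free_def by (rule sum.swap)
  also have "\<dots> = (\<Sum>m\<le>N. pinned K (weight w) m * tail K (N - m))"
    by (intro sum.cong refl) (simp add: pinned_eq_sum[of _ N] sum_distrib_right)
  finally show ?thesis .
qed

lemma free_nonneg: "0 \<le> free N w"
  unfolding free_def by (intro sum_nonneg mult_nonneg_nonneg walk_weight_nonneg tail_K_nonneg)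

lemma free_measurable [measurable]: "free N \<in> borel_measurable envs"
  unfolding free_def[abs_def] by measurable

lemma free_moment:
  assumes p: "1 < p" "p \<le> 2" and mom: "integrable D (\<lambda>y. \<bar>clip y\<bar> powr p)"
    and S: "summable (\<lambda>n. renewal n powr p)" "growth p * (\<Sum>n. renewal n powr p) \<le> 1 / 2"
  shows "(\<integral>\<^sup>+w. ennreal (free N w powr p) \<partial>envs) \<le> 2"
proof -
  have eq: "free N w = \<bar>1 + (\<Sum>m\<in>{1..<Suc N}. (weight w m - 1) * approach K (weight w) m * 1)\<bar>" for w
    using free_eq[where K=K and N=N and w="weight w", OF K_0] free_nonneg[of N w]
    by (simp add: free_eq_pinned atLeastLessThanSuc_atLeastAtMost)
  have g0: "0 \<le> growth p" using p by (intro growth_nonneg) simp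
  have "(\<integral>\<^sup>+w. ennreal (free N w powr p) \<partial>envs) \<le>
      ennreal (\<bar>1\<bar> powr p) + ennreal (growth p) * (\<Sum>m\<in>{1..<Suc N}. ennreal (\<bar>1\<bar> powr p) * moment p m)"
    unfolding eq by (rule martingale_moment[OF p mom])
  also have "\<dots> = 1 + ennreal (growth p) * (\<Sum>m\<in>{1..<Suc N}. moment p m)" by simp
  also have "\<dots> \<le> 1 + ennreal (growth p) * ennreal (2 * (\<Sum>n. renewal n powr p))"
    by (intro add_left_mono mult_left_mono sum_moment_le[OF p mom S]) simp
  also have "\<dots> = ennreal (1 + growth p * (2 * (\<Sum>n. renewal n powr p)))"
    using g0 S(1) by (simp add: ennreal_mult ennreal_plus suminf_nonneg)
  also have "\<dots> \<le> ennreal 2" using S(2) by (intro ennreal_leI) simp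
  finally show ?thesis by simp
qed

section \<open>Paths with many contacts\<close>

definition long_free :: "nat \<Rightarrow> nat \<Rightarrow> (nat \<Rightarrow> real) \<Rightarrow> real" where
  "long_free L N w = (\<Sum>k\<in>{L..N}. \<Sum>m\<le>N. walk K (weight w) k m * tail K (N - m))"

lemma long_free_measurable [measurable]: "long_free L N \<in> borel_measurable envs"
  unfolding long_free_def[abs_def] by measurable

lemma long_free_le: "long_free L N w \<le> free N w"
  unfolding long_free_def free_def
  by (intro sum_mono2) (auto intro!: sum_nonneg mult_nonneg_nonneg walk_weight_nonneg tail_K_nonneg)

text \<open>A Paley-Zygmund argument with the exponent \<open>p\<close> in place of 2: \<open>T\<close> is chosen so that the
  part of the mean carried by \<open>{free > T}\<close> is at most 1/8.\<close>

lemma prob_long_free_ge: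
  assumes p: "1 < p" "p \<le> 2" and mom: "integrable D (\<lambda>y. \<bar>clip y\<bar> powr p)"
    and S: "summable (\<lambda>n. renewal n powr p)" "growth p * (\<Sum>n. renewal n powr p) \<le> 1 / 2"
    and L: "L \<le> N" and few: "(\<Sum>k<L. \<Sum>m\<le>N. walk K (\<lambda>_. 1) k m * tail K (N - m)) \<le> 1 / 2"
  shows "1 / (8 * 16 powr (1 / (p - 1))) \<le> measure envs {w. 1 / 4 \<le> long_free L N w}"
proof -
  \<comment> \<open>The p-th moment of \<open>free\<close> is at most 2, so this \<open>T\<close>
    solves \<open>2 * T powr (1 - p) = 1 / 8\<close>.\<close>
  define T where "T = (16::real) powr (1 / (p - 1))"
  have T: "0 < T" "2 * T powr (1 - p) = 1 / 8"
  proof -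
    have "1 / (p - 1) * (1 - p) = - 1" using p by (simp add: divide_eq_eq)
    then have "T powr (1 - p) = 16 powr (- 1)" unfolding T_def powr_powr by (simp only:)
    then show "2 * T powr (1 - p) = 1 / 8" by simp
  qed (simp add: T_def)
  let ?A = "{w. 1 / 4 \<le> long_free L N w}"
  have A: "?A \<in> sets envs"
  proof -
    have "{w \<in> space envs. 1 / 4 \<le> long_free L N w} \<in> sets envs" by measurable
    then show ?thesis by simp
  qed
  have split: "(\<Sum>k\<le>N. f k) = (\<Sum>k<L. f k) + (\<Sum>k\<in>{L..N}. f k)" for f :: "nat \<Rightarrow> real"
  proof -
    have "{..N} = {..<L} \<union> {L..N}" using L by auto
    then show ?thesis by (simp add: sum.union_disjoint ivl_disj_int)
  qed
  have mean: "(\<Sum>k\<le>N. \<Sum>m\<le>N. walk K (\<lambda>_. 1) k m * tail K (N - m)) = 1"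
  proof -
    have "(\<Sum>k\<le>N. \<Sum>m\<le>N. walk K (\<lambda>_. 1) k m * tail K (N - m)) = (\<Sum>m\<le>N. \<Sum>k\<le>N. walk K (\<lambda>_. 1) k m * tail K (N - m))"
      by (rule sum.swap)
    also have "\<dots> = (\<Sum>m\<le>N. renewal m * tail K (N - m))"
      by (intro sum.cong refl) (simp add: pinned_eq_sum[of _ N] sum_distrib_right)
    finally show ?thesis using free_eq[where K=K and N=N and w="\<lambda>_. 1", OF K_0] by simp
  qed
  then have "1 / 2 \<le> (\<Sum>k\<in>{L..N}. \<Sum>m\<le>N. walk K (\<lambda>_. 1) k m * tail K (N - m))"
    using few split[of "\<lambda>k. \<Sum>m\<le>N. walk K (\<lambda>_. 1) k m * tail K (N - m)"] by linarith
  then have "ennreal (1 / 2) \<le> ennreal (\<Sum>k\<in>{L..N}. \<Sum>m\<le>N. walk K (\<lambda>_. 1) k m * tail K (N - m))"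
    by (rule ennreal_leI)
  also have "\<dots> = (\<integral>\<^sup>+w. ennreal (long_free L N w) \<partial>envs)"
    unfolding long_free_def by (rule nn_integral_walk_sum[symmetric]) (auto simp: tail_K_nonneg)
  \<comment> \<open>Off \<open>?A\<close> the integrand is below 1/4, on \<open>?A\<close> it is at
    most \<open>T\<close> unless it exceeds \<open>T\<close>; then
    \<open>x = x powr (1 - p) * x powr p\<close> and \<open>1 - p < 0\<close> give the last term. Of
    the mean 1/2, at least 1/2 - 1/4 - 1/8 remains for \<open>T * measure envs ?A\<close>.\<close>
  also have "\<dots> \<le> (\<integral>\<^sup>+w. ennreal (1 / 4) + ennreal T * indicator ?A w + ennreal (T powr (1 - p)) * ennreal (free N w powr p) \<partial>envs)"
  proof (intro nn_integral_mono)
    fix w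
    let ?x = "long_free L N w"
    have "?x \<le> 1 / 4 + T * indicator ?A w + T powr (1 - p) * free N w powr p"
    proof -
      consider "?x < 1 / 4" | "1 / 4 \<le> ?x" "?x \<le> T" | "T < ?x" "1 / 4 \<le> ?x" by linarith
      then show ?thesis
      proof cases
        case 3
        have "?x = ?x powr (1 - p) * ?x powr p" using 3 by (simp add: powr_add[symmetric])
        also have "\<dots> \<le> T powr (1 - p) * free N w powr p"
          using 3 p T long_free_le[of L N w] by (intro mult_mono powr_mono2' powr_mono2) auto
        finally show ?thesis using 3 T by simp
      qed (use T in \<open>auto intro: add_increasing2\<close>)
    qed
    then have "ennreal ?x \<le> ennreal (1 / 4 + T * indicator ?A w + T powr (1 - p) * free N w powr p)" by (rule ennreal_leI)
    also have "\<dots> = ennreal (1 / 4) + ennreal T * indicator ?A w + ennreal (T powr (1 - p)) * ennreal (free N w powr p)"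
      using T by (simp add: ennreal_plus ennreal_mult ennreal_indicator)
    finally show "ennreal ?x \<le> ennreal (1 / 4) + ennreal T * indicator ?A w + ennreal (T powr (1 - p)) * ennreal (free N w powr p)" .
  qed
  also have "\<dots> = ennreal (1 / 4) + ennreal T * emeasure envs ?A + ennreal (T powr (1 - p)) * (\<integral>\<^sup>+w. ennreal (free N w powr p) \<partial>envs)"
    using A by (simp add: nn_integral_add nn_integral_cmult)
  also have "(\<integral>\<^sup>+w. ennreal (free N w powr p) \<partial>envs) \<le> ennreal 2"
    using free_moment[OF p mom S] by simp
  also have "ennreal (1 / 4) + ennreal T * emeasure envs ?A + ennreal (T powr (1 - p)) * ennreal 2 =
      ennreal (1 / 4 + T * measure envs ?A + T powr (1 - p) * 2)"
    using T(1) by (simp add: envs.emeasure_eq_measure ennreal_mult)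
  finally have "ennreal (1 / 2) \<le> ennreal (1 / 4 + T * measure envs ?A + T powr (1 - p) * 2)"
    by (simp add: add_left_mono mult_left_mono)
  then have "1 / 2 \<le> 1 / 4 + T * measure envs ?A + T powr (1 - p) * 2"
    using T by (subst (asm) ennreal_le_iff) auto
  then have "1 / 8 \<le> T * measure envs ?A" using T(2) by simp
  then show ?thesis unfolding T_def[symmetric] using T(1) by (simp add: field_simps)
qed

end

section \<open>Existence of the free energy\<close>

text \<open>Fekete's lemma with superadditivity from \<open>n0\<close> on; the limit is the supremum
  over \<open>n \<ge> n0\<close>.\<close>

lemma superadditive_limit:
  fixes e :: "nat \<Rightarrow> real"
  assumes n0: "1 \<le> n0" and super: "\<And>n m. n0 \<le> n \<Longrightarrow> n0 \<le> m \<Longrightarrow> e n + e m \<le> e (n + m)"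
    and up: "\<And>n. n0 \<le> n \<Longrightarrow> e n \<le> F * real n"
  obtains c where "(\<lambda>n. e n / real n) \<longlonglongrightarrow> c" "\<And>n. n0 \<le> n \<Longrightarrow> e n \<le> c * real n"
proof -
  let ?A = "(\<lambda>n. e n / real n) ` {n0..}"
  define c where "c = Sup ?A"
  have bdd: "bdd_above ?A"
    by (rule bdd_aboveI[of _ F]) (use up n0 in \<open>auto simp: field_simps\<close>)
  have le: "e n / real n \<le> c" if "n0 \<le> n" for n
    unfolding c_def by (rule cSup_upper[OF _ bdd]) (use that in auto)
  have "(\<lambda>n. e n / real n) \<longlonglongrightarrow> c"
  proof (rule order_tendstoI)
    fix a assume "c < a"
    show "\<forall>\<^sub>F n in sequentially. e n / real n < a"
      using eventually_ge_at_top[of n0]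
    proof eventually_elim
      case (elim n)
      show ?case using le[OF elim] \<open>c < a\<close> by simp
    qed
  next
    fix a assume "a < c"
    then obtain m where m: "n0 \<le> m" "a < e m / real m"
      unfolding c_def by (subst (asm) less_cSup_iff[OF _ bdd]) auto
    have m0: "0 < m" using m n0 by simp
    define B where "B = 2 * \<bar>e m\<bar> + (\<Sum>r<2 * m. \<bar>e r\<bar>)"
    have iter: "real q * e m + e r \<le> e (q * m + r)" if "m \<le> r" for q r
    proof (induction q)
      case (Suc q)
      have "e m + e (q * m + r) \<le> e (m + (q * m + r))" using m that by (intro super) auto
      then show ?case using Suc by (simp add: algebra_simps)
    qed simp
    have key: "e m / real m * real N - B \<le> e N" if N: "2 * m \<le> N" for N
    proof -
      \<comment> \<open>The remainder is enlarged by one block, so that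
        \<open>r \<ge> m \<ge> n0\<close> lies in the range of superadditivity.\<close>
      define q r where "q = N div m - 1" and "r = N mod m + m"
      have "0 < N div m" using N m0 by (simp add: div_greater_zero_iff)
      then obtain k where "N div m = Suc k" by (auto simp: gr0_conv_Suc)
      then have Nq: "N = q * m + r"
        using div_mult_mod_eq[of N m] by (simp add: q_def r_def)
      have r: "m \<le> r" "r < 2 * m" using m0 by (auto simp: r_def)
      have "real N = real q * real m + real r" by (subst Nq) simp
      then have "real q * e m = e m / real m * real N - real r / real m * e m"
        using m0 by (simp add: field_simps)
      moreover have "real r / real m * e m \<le> 2 * \<bar>e m\<bar>"
      proof -
        have "real r / real m \<le> 2" using r m0 by (simp add: field_simps)
        then have "real r / real m * \<bar>e m\<bar> \<le> 2 * \<bar>e m\<bar>" by (rule mult_right_mono) simp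
        moreover have "real r / real m * e m \<le> real r / real m * \<bar>e m\<bar>" by (intro mult_left_mono) auto
        ultimately show ?thesis by (rule order_trans[rotated])
      qed
      moreover have "\<bar>e r\<bar> \<le> (\<Sum>r<2 * m. \<bar>e r\<bar>)" using r by (intro member_le_sum) auto
      moreover have "real q * e m + e r \<le> e N" using iter[OF r(1), of q] Nq by simp
      ultimately show ?thesis unfolding B_def by linarith
    qed
    have "(\<lambda>N. e m / real m - B / real N) \<longlonglongrightarrow> e m / real m - 0"
      by (intro tendsto_diff tendsto_const lim_const_over_n)
    then have "\<forall>\<^sub>F N in sequentially. a < e m / real m - B / real N"
      by (rule order_tendstoD) (use m in simp)
    then show "\<forall>\<^sub>F N in sequentially. a < e N / real N"
      using eventually_ge_at_top[of "2 * m"]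
    proof eventually_elim
      case (elim N)
      have "0 < real N" using elim m0 by simp
      then have "e m / real m - B / real N \<le> e N / real N"
        using divide_right_mono[OF key[OF elim(2)], of "real N"] by (simp add: diff_divide_distrib)
      then show ?case using elim(1) by linarith
    qed
  qed
  moreover have "e n \<le> c * real n" if "n0 \<le> n" for n using le[OF that] that n0 by (simp add: field_simps)
  ultimately show ?thesis using that by blast
qed

text \<open>Squares near \<open>N\<close> differ from \<open>N\<close> by order
  \<open>sqrt N\<close> only, and between them \<open>x\<close> loses at most a logarithm. With
  \<open>j\<close> the integer part of \<open>sqrt N\<close>, the squares of \<open>j - 1\<close>
  and \<open>j + 2\<close> are used rather than those of \<open>j\<close> and \<open>j + 1\<close>:
  this leaves the gap \<open>n0\<close> that \<open>step\<close> demands on both sides.\<close>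

lemma tendsto_interpolate_squares:
  fixes x :: "nat \<Rightarrow> real"
  assumes sq: "(\<lambda>j. x (j\<^sup>2) / real (j\<^sup>2)) \<longlonglongrightarrow> c"
    and step: "\<And>a N. n0 \<le> a \<Longrightarrow> a + n0 \<le> N \<Longrightarrow> x a - (C1 + C2 * ln (real N)) \<le> x N"
    and C2: "0 \<le> C2"
  shows "(\<lambda>N. x N / real N) \<longlonglongrightarrow> c"
proof -
  define j where "j = (\<lambda>N::nat. nat \<lfloor>sqrt (real N)\<rfloor>)"
  have j_le: "real (j N) \<le> sqrt (real N)" and j_gt: "sqrt (real N) - 1 \<le> real (j N)" for N
    unfolding j_def by (simp, linarith)
  have j2: "(j N)\<^sup>2 \<le> N" "N \<le> (j N + 1)\<^sup>2" for N
  proof -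
    have "(real (j N))\<^sup>2 \<le> (sqrt (real N))\<^sup>2" by (intro power_mono j_le) simp
    then have "real ((j N)\<^sup>2) \<le> real N" by simp
    then show "(j N)\<^sup>2 \<le> N" by (simp only: of_nat_le_iff)
    have "(sqrt (real N))\<^sup>2 \<le> (real (j N) + 1)\<^sup>2" using j_gt[of N] by (intro power_mono) auto
    then have "real N \<le> real ((j N + 1)\<^sup>2)" by (simp add: add.commute)
    then show "N \<le> (j N + 1)\<^sup>2" by (simp only: of_nat_le_iff)
  qed
  have j_top: "filterlim (\<lambda>N. real (j N)) at_top sequentially"
  proof (rule filterlim_at_top_mono)
    show "filterlim (\<lambda>N::nat. sqrt (real N) - 1) at_top sequentially" by real_asymp
  qed (use j_gt in auto)
  then have j_top': "filterlim j at_top sequentially" by (simp add: filterlim_sequentially_iff_filterlim_real)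
  have ratio: "(\<lambda>N. (real (j N) + a)\<^sup>2 / real N) \<longlonglongrightarrow> 1" if a: "- 1 \<le> a" "a \<le> 2" for a
  proof (rule tendsto_sandwich)
    show "\<forall>\<^sub>F N in sequentially. (sqrt (real N) - 2)\<^sup>2 / real N \<le> (real (j N) + a)\<^sup>2 / real N"
      using eventually_ge_at_top[of 4]
    proof eventually_elim
      case (elim N)
      then have "sqrt 4 \<le> sqrt (real N)" by (intro real_sqrt_le_mono) simp
      then show ?case using j_gt[of N] a by (intro divide_right_mono power_mono) auto
    qed
    show "\<forall>\<^sub>F N in sequentially. (real (j N) + a)\<^sup>2 / real N \<le> (sqrt (real N) + 2)\<^sup>2 / real N"
      using eventually_ge_at_top[of 4]
    proof eventually_elim
      case (elim N)
      then have "sqrt 4 \<le> sqrt (real N)" by (intro real_sqrt_le_mono) simp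
      then show ?case using j_le[of N] j_gt[of N] a by (intro divide_right_mono power_mono) auto
    qed
    show "(\<lambda>N::nat. (sqrt (real N) - 2)\<^sup>2 / real N) \<longlonglongrightarrow> 1" by real_asymp
    show "(\<lambda>N::nat. (sqrt (real N) + 2)\<^sup>2 / real N) \<longlonglongrightarrow> 1" by real_asymp
  qed
  let ?y = "\<lambda>j. x (j\<^sup>2) / real (j\<^sup>2)"
  have large: "\<forall>\<^sub>F N in sequentially. n0 + 2 \<le> j N"
    using j_top' by (auto simp: filterlim_at_top)
  show ?thesis
  proof (rule tendsto_sandwich)
    show "\<forall>\<^sub>F N in sequentially. ?y (j N - 1) * ((real (j N) + - 1)\<^sup>2 / real N) - (C1 + C2 * ln (real N)) / real N \<le> x N / real N"
      using large
    proof eventually_elim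
      case (elim N)
      define i where "i = j N - 1"
      have i: "j N = i + 1" "n0 + 1 \<le> i" using elim by (auto simp: i_def)
      have "n0 \<le> i\<^sup>2" using i by (intro order_trans[OF _ self_le_power[of i 2]]) auto
      moreover have "i\<^sup>2 + n0 \<le> N" using j2(1)[of N] i by (simp add: power2_eq_square)
      ultimately have "x (i\<^sup>2) - (C1 + C2 * ln (real N)) \<le> x N" by (rule step)
      then have "(x (i\<^sup>2) - (C1 + C2 * ln (real N))) / real N \<le> x N / real N" by (rule divide_right_mono) simp
      moreover have "?y i * ((real (j N) + - 1)\<^sup>2 / real N) = x (i\<^sup>2) / real N" using i by (simp add: field_simps)
      ultimately show ?case unfolding i_def by (simp only: diff_divide_distrib)
    qed
    show "\<forall>\<^sub>F N in sequentially. x N / real N \<le> ?y (j N + 2) * ((real (j N) + 2)\<^sup>2 / real N) + (C1 + C2 * ln ((sqrt (real N) + 2)\<^sup>2)) / real N"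
      using large
    proof eventually_elim
      case (elim N)
      define i where "i = j N"
      have i: "n0 + 2 \<le> i" using elim by (auto simp: i_def)
      have "n0 \<le> i\<^sup>2" using i by (intro order_trans[OF _ self_le_power[of i 2]]) auto
      then have "n0 \<le> N" using j2(1)[of N] by (simp add: i_def)
      moreover have "N + n0 \<le> (i + 2)\<^sup>2" using j2(2)[of N] i by (simp add: i_def power2_eq_square)
      ultimately have "x N - (C1 + C2 * ln (real ((i + 2)\<^sup>2))) \<le> x ((i + 2)\<^sup>2)" by (rule step)
      moreover have "ln (real ((i + 2)\<^sup>2)) \<le> ln ((sqrt (real N) + 2)\<^sup>2)"
      proof -
        have "(real i + 2)\<^sup>2 \<le> (sqrt (real N) + 2)\<^sup>2" using j_le[of N] by (intro power_mono) (auto simp: i_def)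
        then show ?thesis by (intro ln_mono) (auto simp: add_nonneg_pos add.commute)
      qed
      then have "C2 * ln (real ((i + 2)\<^sup>2)) \<le> C2 * ln ((sqrt (real N) + 2)\<^sup>2)" using C2 by (rule mult_left_mono)
      ultimately have "x N \<le> x ((i + 2)\<^sup>2) + (C1 + C2 * ln ((sqrt (real N) + 2)\<^sup>2))" by linarith
      then have "x N / real N \<le> (x ((i + 2)\<^sup>2) + (C1 + C2 * ln ((sqrt (real N) + 2)\<^sup>2))) / real N" by (rule divide_right_mono) simp
      moreover have "?y (i + 2) * ((real i + 2)\<^sup>2 / real N) = x ((i + 2)\<^sup>2) / real N"
        by (simp add: add.commute)
      ultimately show ?case unfolding i_def by (simp only: add_divide_distrib)
    qed
    have lim1: "filterlim (\<lambda>N. j N - 1) at_top sequentially"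
    proof (rule filterlim_compose[OF _ j_top'])
      show "filterlim (\<lambda>n::nat. n - 1) at_top sequentially" by (rule filterlim_minus_const_nat_at_top)
    qed
    have lim2: "filterlim (\<lambda>N. j N + 2) at_top sequentially"
      by (rule filterlim_at_top_mono[OF j_top']) auto
    have "(\<lambda>N::nat. (C1 + C2 * ln (real N)) / real N) \<longlonglongrightarrow> 0" by real_asymp
    then have "(\<lambda>N. ?y (j N - 1) * ((real (j N) + - 1)\<^sup>2 / real N) - (C1 + C2 * ln (real N)) / real N) \<longlonglongrightarrow> c * 1 - 0"
      by (intro tendsto_diff tendsto_mult ratio filterlim_compose[OF sq lim1]) auto
    then show "(\<lambda>N. ?y (j N - 1) * ((real (j N) + - 1)\<^sup>2 / real N) - (C1 + C2 * ln (real N)) / real N) \<longlonglongrightarrow> c" by simp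
    have "(\<lambda>N::nat. (C1 + C2 * ln ((sqrt (real N) + 2)\<^sup>2)) / real N) \<longlonglongrightarrow> 0" by real_asymp
    then have "(\<lambda>N. ?y (j N + 2) * ((real (j N) + 2)\<^sup>2 / real N) + (C1 + C2 * ln ((sqrt (real N) + 2)\<^sup>2)) / real N) \<longlonglongrightarrow> c * 1 + 0"
      by (intro tendsto_add tendsto_mult ratio filterlim_compose[OF sq lim2]) auto
    then show "(\<lambda>N. ?y (j N + 2) * ((real (j N) + 2)\<^sup>2 / real N) + (C1 + C2 * ln ((sqrt (real N) + 2)\<^sup>2)) / real N) \<longlonglongrightarrow> c" by simp
  qed
qed

section \<open>The logarithm of the partition function\<close>

locale pinning_tail = pinning +
  fixes \<alpha> c0 :: real and n0 :: nat
  assumes \<alpha>: "0 < \<alpha>" and c0: "0 < c0" and n0: "1 \<le> n0"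
    and K_ge: "\<And>n. n0 \<le> n \<Longrightarrow> c0 * real n powr - (1 + \<alpha>) \<le> K n"
begin

definition Z :: "real \<Rightarrow> nat \<Rightarrow> (nat \<Rightarrow> real) \<Rightarrow> real" where
  "Z h N w = pinned K (\<lambda>n. exp h * weight w n) N"

lemma Z_eq_sum: "Z h N w = (\<Sum>k\<le>N. exp h ^ k * walk K (weight w) k N)"
  by (simp add: Z_def pinned_def walk_scale)

lemma Z_measurable [measurable]: "Z h N \<in> borel_measurable envs"
  unfolding Z_eq_sum[abs_def] by measurable

lemma Z_nonneg: "0 \<le> Z h N w"
  unfolding Z_def by (intro pinned_nonneg K_nonneg mult_nonneg_nonneg weight_nonneg) simp

text \<open>A single jump to \<open>N\<close>; the polynomial tail of \<open>K\<close> makes its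
  cost only logarithmic in \<open>ln Z\<close>.\<close>

lemma Z_ge:
  assumes "n0 \<le> N"
  shows "exp h * (1 - \<beta>) * (c0 * real N powr - (1 + \<alpha>)) \<le> Z h N w" "0 < Z h N w"
proof -
  have N: "0 < N" using assms n0 by simp
  have "exp h * (1 - \<beta>) * (c0 * real N powr - (1 + \<alpha>)) \<le> exp h * weight w N * K N"
    using \<beta> c0 weight_ge[of w N] by (intro mult_mono mult_left_mono K_ge assms) (auto intro: mult_nonneg_nonneg weight_nonneg)
  also have "\<dots> \<le> Z h N w"
    unfolding Z_def by (rule pinned_ge_jump[OF K_nonneg _ N]) (simp add: weight_nonneg)
  finally show "exp h * (1 - \<beta>) * (c0 * real N powr - (1 + \<alpha>)) \<le> Z h N w" .
  moreover have "0 < exp h * (1 - \<beta>) * (c0 * real N powr - (1 + \<alpha>))" using \<beta> c0 N by simp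
  ultimately show "0 < Z h N w" by linarith
qed

lemma ln_Z_ge:
  assumes "n0 \<le> N"
  shows "h + ln ((1 - \<beta>) * c0) - (1 + \<alpha>) * ln (real N) \<le> ln (Z h N w)"
proof -
  have N: "0 < N" using assms n0 by simp
  have "h + ln ((1 - \<beta>) * c0) - (1 + \<alpha>) * ln (real N) = ln (exp h * (1 - \<beta>) * (c0 * real N powr - (1 + \<alpha>)))"
    using \<beta> c0 N by (simp add: ln_mult ln_powr) (simp add: algebra_simps)
  also have "\<dots> \<le> ln (Z h N w)"
    using Z_ge[OF assms] \<beta> c0 N by (intro ln_mono) auto
  finally show ?thesis .
qed

lemma ln_Z_superadd:
  assumes "n0 \<le> n" "n0 \<le> m"
  shows "ln (Z h n w) + ln (Z h m (\<lambda>i. w (n + i))) \<le> ln (Z h (n + m) w)"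
proof -
  have "Z h n w * Z h m (\<lambda>i. w (n + i)) \<le> Z h (n + m) w"
    using pinned_superadd[of K "\<lambda>i. exp h * weight w i" n m] K_nonneg weight_nonneg[of w]
    by (simp add: Z_def weight_def)
  then have "ln (Z h n w * Z h m (\<lambda>i. w (n + i))) \<le> ln (Z h (n + m) w)"
    using Z_ge(2) assms by (intro ln_mono) auto
  then show ?thesis unfolding ln_mult_pos[OF Z_ge(2)[OF assms(1)] Z_ge(2)[OF assms(2)]] .
qed

text \<open>\<open>clip 0 = 0\<close> makes the reference weight independent of \<beta>, so the
  update multiplies one weight by \<open>r\<close> and \<open>Z\<close> by a factor between 1 and
  \<open>r\<close>. For \<open>r < 1\<close> the two environments exchange roles.\<close>

lemma ln_Z_update_le: "\<bar>ln (Z h N (w(n := y))) - ln (Z h N (w(n := 0)))\<bar> \<le> \<bar>ln (1 + \<beta> * clip y)\<bar>"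
proof -
  define r where "r = 1 + \<beta> * clip y"
  have r: "0 < r" unfolding r_def by (rule min_weight_ge[OF \<beta>])
  let ?u = "\<lambda>i. exp h * weight (w(n := y)) i" and ?v = "\<lambda>i. exp h * weight (w(n := 0)) i"
  have u0: "0 \<le> ?u i" "0 \<le> ?v i" for i by (simp_all add: weight_nonneg)
  have uv: "?u i = ?v i" if "i \<noteq> n" for i using that by (simp add: weight_def)
  have un: "?u n = r * ?v n" by (simp add: weight_def r_def clip_def)
  \<comment> \<open>\<open>Z\<close> may vanish for \<open>N < n0\<close>; then both values vanish,
    and \<open>ln 0 = 0\<close> keeps the bound true.\<close>
  have *: "ln B \<le> ln A \<and> ln A \<le> ln r' + ln B" if "B \<le> A" "A \<le> r' * B" "1 \<le> r'" "0 \<le> B" for A B r' :: real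
  proof (cases "B = 0")
    case False
    then have "ln A \<le> ln (r' * B)" using that by (intro ln_mono) auto
    then show ?thesis using that False ln_mono[of B A] by (simp add: ln_mult)
  next
    case True
    then show ?thesis using that by simp
  qed
  show ?thesis
  proof (cases "1 \<le> r")
    case True
    have "pinned K ?v N \<le> pinned K ?u N"
    proof (rule pinned_mono[OF K_nonneg u0(2)])
      fix i show "?v i \<le> ?u i"
        using uv[of i] un True mult_right_mono[OF True u0(2)[of n]] by (cases "i = n") auto
    qed
    moreover have "pinned K ?u N \<le> r * pinned K ?v N"
      by (rule pinned_le_scale[where i = n and w = "?v"]) (fact K_nonneg u0(2) True uv un)+
    ultimately show ?thesis
      using *[of "Z h N (w(n := 0))" "Z h N (w(n := y))" r] Z_nonneg r True unfolding Z_def r_def by auto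
  next
    case False
    have vn: "?v n = (1 / r) * ?u n" using un r by simp
    have r1: "1 \<le> 1 / r" using False r by simp
    have "pinned K ?u N \<le> pinned K ?v N"
    proof (rule pinned_mono[OF K_nonneg u0(1)])
      fix i show "?u i \<le> ?v i"
        using uv[of i] vn mult_right_mono[OF r1 u0(1)[of n]] by (cases "i = n") auto
    qed
    moreover have "pinned K ?v N \<le> (1 / r) * pinned K ?u N"
      by (rule pinned_le_scale[where i = n and w = "?u"]) (fact K_nonneg u0(1) r1 uv[symmetric] vn)+
    moreover have "ln (1 / r) = - ln r" using r by (simp add: ln_div)
    ultimately show ?thesis
      using *[of "Z h N (w(n := y))" "Z h N (w(n := 0))" "1 / r"] Z_nonneg r r1 False unfolding Z_def r_def by auto
  qed
qed

text \<open>Finite despite the heavy tail of the weight: its logarithm is bounded below because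
  \<open>\<beta> < 1\<close>, and above it grows more slowly than a square root.\<close>

definition osc :: real where "osc = (\<integral>y. (ln (1 + \<beta> * clip y))\<^sup>2 \<partial>D)"

lemma integrable_osc: "integrable D (\<lambda>y. (ln (1 + \<beta> * clip y))\<^sup>2)"
proof (rule Bochner_Integration.integrable_bound)
  show "integrable D (\<lambda>y. (ln (1 - \<beta>))\<^sup>2 + 4 * (1 + \<beta> * clip y))" using integrable_clip by simp
  show "AE y in D. norm ((ln (1 + \<beta> * clip y))\<^sup>2) \<le> norm ((ln (1 - \<beta>))\<^sup>2 + 4 * (1 + \<beta> * clip y))"
  proof (rule AE_I2)
    fix y
    define r where "r = 1 + \<beta> * clip y"
    have r: "0 < r" "1 - \<beta> \<le> r" unfolding r_def using min_weight_ge[OF \<beta>] by auto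
    have "(ln r)\<^sup>2 \<le> (ln (1 - \<beta>))\<^sup>2 + 4 * r"
    proof (cases "1 \<le> r")
      case True
      have "ln (sqrt r) \<le> sqrt r" using True by (intro ln_bound) simp
      moreover have "ln (sqrt r) = ln r / 2" using r by (simp add: ln_sqrt)
      ultimately have "(ln r)\<^sup>2 \<le> (2 * sqrt r)\<^sup>2" using True by (intro power_mono) auto
      also have "\<dots> = 4 * r" using r by (simp add: power_mult_distrib)
      finally show ?thesis by (simp add: add_increasing)
    next
      case False
      have "ln (1 - \<beta>) \<le> ln r" "ln r \<le> 0" using r False \<beta> by (auto intro: ln_mono)
      then have "(ln r)\<^sup>2 \<le> (ln (1 - \<beta>))\<^sup>2" by (simp add: abs_le_square_iff[symmetric])
      then show ?thesis using r by simp
    qed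
    then show "norm ((ln (1 + \<beta> * clip y))\<^sup>2) \<le> norm ((ln (1 - \<beta>))\<^sup>2 + 4 * (1 + \<beta> * clip y))"
      using r by (simp add: r_def[symmetric])
  qed
qed measurable

definition mean_ln_Z :: "real \<Rightarrow> nat \<Rightarrow> real" where
  "mean_ln_Z h N = (\<integral>w. ln (Z h N w) \<partial>envs)"

lemma osc_nonneg: "0 \<le> osc"
  by (simp add: osc_def)

text \<open>\<open>variance_bound\<close> gives a finite second moment about some \<open>c\<close>,
  hence integrability; the mean minimizes that moment and may replace \<open>c\<close>.
  \<open>Suc N\<close> counts the coordinates 0 to \<open>N\<close>.\<close>

lemma
  shows integrable_ln_Z: "integrable envs (\<lambda>w. ln (Z h N w))"
    and variance_ln_Z: "(\<integral>\<^sup>+w. ennreal ((ln (Z h N w) - mean_ln_Z h N)\<^sup>2) \<partial>envs) \<le> ennreal (real (Suc N) * osc)"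
proof -
  let ?F = "\<lambda>w. ln (Z h N w)"
  have "\<exists>c. (\<integral>\<^sup>+w. ennreal ((?F w - c)\<^sup>2) \<partial>envs) \<le> ennreal (real (Suc N) * osc)"
    unfolding osc_def power2_abs[of "ln _", symmetric]
  proof (rule variance_bound[where g = "\<lambda>y. \<bar>ln (1 + \<beta> * clip y)\<bar>"])
    show "?F w = ?F w'" if "\<And>i. i < Suc N \<Longrightarrow> w i = w' i" for w w'
      unfolding Z_def using that by (intro arg_cong[of _ _ ln] pinned_cong) (auto simp: weight_def)
  qed (use integrable_osc ln_Z_update_le in \<open>simp_all\<close>)
  then obtain c where c: "(\<integral>\<^sup>+w. ennreal ((?F w - c)\<^sup>2) \<partial>envs) \<le> ennreal (real (Suc N) * osc)" by blast
  have sq: "integrable envs (\<lambda>w. (?F w - c)\<^sup>2)"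
    using c by (intro integrableI_nonneg) (auto intro: le_less_trans)
  have "integrable envs (\<lambda>w. ?F w - c)"
    by (rule envs.square_integrable_imp_integrable[OF _ sq]) measurable
  then have "integrable envs (\<lambda>w. (?F w - c) + c)" by (rule Bochner_Integration.integrable_add) simp
  then show int: "integrable envs ?F" by simp
  have eq: "(\<lambda>w. (?F w - mean_ln_Z h N)\<^sup>2) =
      (\<lambda>w. (?F w - c)\<^sup>2 - 2 * (mean_ln_Z h N - c) * (?F w - c) + (mean_ln_Z h N - c)\<^sup>2)"
    by (simp add: fun_eq_iff power2_eq_square algebra_simps)
  have int': "integrable envs (\<lambda>w. (?F w - mean_ln_Z h N)\<^sup>2)" unfolding eq using int sq by simp
  have "(\<integral>w. (?F w - mean_ln_Z h N)\<^sup>2 \<partial>envs) = (\<integral>w. (?F w - c)\<^sup>2 \<partial>envs) - (mean_ln_Z h N - c)\<^sup>2"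
  proof -
    have "(\<integral>w. ?F w - c \<partial>envs) = mean_ln_Z h N - c" using int envs.prob_space by (simp add: mean_ln_Z_def)
    then show ?thesis unfolding eq using int sq envs.prob_space by (simp add: power2_eq_square)
  qed
  also have "\<dots> \<le> (\<integral>w. (?F w - c)\<^sup>2 \<partial>envs)" by simp
  finally have "ennreal (\<integral>w. (?F w - mean_ln_Z h N)\<^sup>2 \<partial>envs) \<le> ennreal (\<integral>w. (?F w - c)\<^sup>2 \<partial>envs)" by (rule ennreal_leI)
  then show "(\<integral>\<^sup>+w. ennreal ((?F w - mean_ln_Z h N)\<^sup>2) \<partial>envs) \<le> ennreal (real (Suc N) * osc)"
    using c nn_integral_eq_integral[OF int'] nn_integral_eq_integral[OF sq] by (simp only: zero_le_power2 eventually_True)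
qed

lemma mean_ln_Z_superadd:
  assumes "n0 \<le> n" "n0 \<le> m"
  shows "mean_ln_Z h n + mean_ln_Z h m \<le> mean_ln_Z h (n + m)"
proof -
  have int: "integrable envs (\<lambda>w. ln (Z h m (\<lambda>i. w (n + i))))"
    using integrable_distr_eq[OF shift_measurable[of n], of "\<lambda>w. ln (Z h m w)"] integrable_ln_Z[of h m]
    by (simp add: distr_shift)
  have "mean_ln_Z h m = (\<integral>w. ln (Z h m (\<lambda>i. w (n + i))) \<partial>envs)"
    unfolding mean_ln_Z_def using integral_distr[OF shift_measurable[of n], of "\<lambda>w. ln (Z h m w)"]
    by (simp add: distr_shift)
  then have "mean_ln_Z h n + mean_ln_Z h m = (\<integral>w. ln (Z h n w) + ln (Z h m (\<lambda>i. w (n + i))) \<partial>envs)"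
    using integrable_ln_Z int by (simp add: mean_ln_Z_def)
  also have "\<dots> \<le> mean_ln_Z h (n + m)"
    unfolding mean_ln_Z_def using ln_Z_superadd[OF assms]
    by (intro integral_mono Bochner_Integration.integrable_add integrable_ln_Z int) auto
  finally show ?thesis .
qed

lemma nn_integral_Z: "(\<integral>\<^sup>+w. ennreal (Z h N w) \<partial>envs) = ennreal (pinned K (\<lambda>_. exp h) N)"
proof -
  have "ennreal (Z h N w) = (\<Sum>k\<le>N. ennreal (exp h ^ k) * ennreal (walk K (weight w) k N))" for w
    unfolding Z_eq_sum by (simp add: sum_ennreal[symmetric] walk_weight_nonneg ennreal_mult)
  then have "(\<integral>\<^sup>+w. ennreal (Z h N w) \<partial>envs) = (\<Sum>k\<le>N. ennreal (exp h ^ k) * ennreal (walk K (\<lambda>_. 1) k N))"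
    by (simp add: nn_integral_sum nn_integral_cmult nn_integral_walk)
  also have "\<dots> = ennreal (pinned K (\<lambda>_. exp h) N)"
    using walk_scale[of K "exp h" "\<lambda>_. 1"] by (simp add: pinned_def sum_ennreal[symmetric] walk_one_nonneg ennreal_mult)
  finally show ?thesis .
qed

text \<open>Jensen's inequality through \<open>ln x \<le> x - 1\<close> at \<open>x = Z / a\<close>:
  the mean of \<open>Z\<close> is the homogeneous partition function, which is at most
  \<open>a\<close>.\<close>

lemma mean_ln_Z_le:
  assumes F: "\<And>N. exp h * (\<Sum>n\<in>{1..N}. K n * exp (- F * real n)) \<le> 1" and N: "n0 \<le> N"
  shows "mean_ln_Z h N \<le> F * real N"
proof -
  define a where "a = exp (F * real N)"
  have nn: "(\<integral>\<^sup>+w. ennreal (Z h N w) \<partial>envs) \<le> ennreal a"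
    unfolding nn_integral_Z a_def by (intro ennreal_leI pinned_exp_bound K_nonneg F) simp
  have int: "integrable envs (Z h N)"
    using nn by (intro integrableI_nonneg) (auto intro: le_less_trans simp: Z_nonneg)
  have "ennreal (\<integral>w. Z h N w \<partial>envs) \<le> ennreal a"
    using nn nn_integral_eq_integral[OF int] by (simp add: Z_nonneg)
  then have mean: "(\<integral>w. Z h N w \<partial>envs) \<le> a" by (simp add: a_def)
  have "mean_ln_Z h N \<le> (\<integral>w. Z h N w / a - 1 + F * real N \<partial>envs)"
    unfolding mean_ln_Z_def
  proof (intro integral_mono integrable_ln_Z)
    show "integrable envs (\<lambda>w. Z h N w / a - 1 + F * real N)" using int by simp
    fix w
    have "ln (Z h N w / a) \<le> Z h N w / a - 1" using Z_ge(2)[OF N] by (intro ln_le_minus_one) (simp add: a_def)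
    then show "ln (Z h N w) \<le> Z h N w / a - 1 + F * real N"
      using Z_ge(2)[OF N, of h w] by (simp add: ln_div a_def)
  qed
  also have "\<dots> = (\<integral>w. Z h N w \<partial>envs) / a - 1 + F * real N" using int envs.prob_space by simp
  also have "\<dots> \<le> F * real N" using mean by (simp add: a_def)
  finally show ?thesis .
qed

text \<open>The variance of \<open>ln Z / N\<close> is of order at most \<open>1 / N\<close>, a
  bound that is summable along \<open>N = j^2\<close>. The sum of the squared deviations then has
  finite mean, so its terms tend to 0 almost surely.\<close>

lemma AE_square_deviation:
  "AE w in envs. (\<lambda>j. (ln (Z h (j\<^sup>2) w) - mean_ln_Z h (j\<^sup>2)) / real (j\<^sup>2)) \<longlonglongrightarrow> 0"
proof -
  define f where "f = (\<lambda>j w. ((ln (Z h (j\<^sup>2) w) - mean_ln_Z h (j\<^sup>2)) / real (j\<^sup>2))\<^sup>2)"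
  have [measurable]: "f j \<in> borel_measurable envs" for j unfolding f_def by measurable
  have fj: "(\<integral>\<^sup>+w. ennreal (f j w) \<partial>envs) \<le> ennreal (2 * osc * (1 / real j ^ 2))" for j
  proof (cases "j = 0")
    case False
    then have j: "1 \<le> real (j\<^sup>2)" by simp
    have "(\<integral>\<^sup>+w. ennreal (f j w) \<partial>envs) = (\<integral>\<^sup>+w. ennreal (1 / (real (j\<^sup>2))\<^sup>2) * ennreal ((ln (Z h (j\<^sup>2) w) - mean_ln_Z h (j\<^sup>2))\<^sup>2) \<partial>envs)"
      by (intro nn_integral_cong) (simp add: f_def ennreal_mult'[symmetric] power_divide)
    also have "\<dots> = ennreal (1 / (real (j\<^sup>2))\<^sup>2) * (\<integral>\<^sup>+w. ennreal ((ln (Z h (j\<^sup>2) w) - mean_ln_Z h (j\<^sup>2))\<^sup>2) \<partial>envs)"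
      by (rule nn_integral_cmult) measurable
    also have "\<dots> \<le> ennreal (1 / (real (j\<^sup>2))\<^sup>2) * ennreal (real (Suc (j\<^sup>2)) * osc)"
      by (intro mult_left_mono variance_ln_Z) simp
    also have "\<dots> = ennreal (1 / (real (j\<^sup>2))\<^sup>2 * (real (Suc (j\<^sup>2)) * osc))"
      using osc_nonneg by (intro ennreal_mult[symmetric]) auto
    also have "1 / (real (j\<^sup>2))\<^sup>2 * (real (Suc (j\<^sup>2)) * osc) \<le> 1 / (real (j\<^sup>2))\<^sup>2 * ((2 * real (j\<^sup>2)) * osc)"
      using j osc_nonneg by (intro mult_left_mono mult_right_mono) auto
    also have "\<dots> = 2 * osc * (1 / real j ^ 2)" using False by (simp add: power2_eq_square)
    finally show ?thesis by (simp add: ennreal_leI)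
  qed (simp add: f_def)
  have sum: "summable (\<lambda>j. 2 * osc * (1 / real j ^ 2))"
    by (intro summable_mult) (use inverse_power_summable[of 2] in \<open>simp add: inverse_eq_divide\<close>)
  have "(\<integral>\<^sup>+w. (\<Sum>j. ennreal (f j w)) \<partial>envs) = (\<Sum>j. \<integral>\<^sup>+w. ennreal (f j w) \<partial>envs)"
    by (rule nn_integral_suminf) measurable
  also have "\<dots> \<le> (\<Sum>j. ennreal (2 * osc * (1 / real j ^ 2)))" by (intro suminf_le fj) auto
  also have "\<dots> = ennreal (\<Sum>j. 2 * osc * (1 / real j ^ 2))"
    by (rule suminf_ennreal2[OF _ sum]) (simp add: osc_nonneg)
  also have "\<dots> < \<infinity>" by simp
  finally have "AE w in envs. (\<Sum>j. ennreal (f j w)) \<noteq> \<infinity>"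
    by (intro nn_integral_PInf_AE) (auto simp: less_top)
  then show ?thesis
  proof eventually_elim
    case (elim w)
    let ?d = "\<lambda>j. (ln (Z h (j\<^sup>2) w) - mean_ln_Z h (j\<^sup>2)) / real (j\<^sup>2)"
    have "summable (\<lambda>j. f j w)" by (rule summable_suminf_not_top) (use elim in \<open>auto simp: f_def\<close>)
    then have "(\<lambda>j. sqrt (f j w)) \<longlonglongrightarrow> sqrt 0" by (intro tendsto_real_sqrt summable_LIMSEQ_zero)
    then have "(\<lambda>j. \<bar>?d j\<bar>) \<longlonglongrightarrow> 0" unfolding f_def real_sqrt_abs by simp
    then show ?case by (rule tendsto_rabs_zero_cancel)
  qed
qed

text \<open>Every jump has length at least 1 and so pays at least \<open>|h|\<close>. This crude
  exponent serves to make the supremum in the superadditive limit finite.\<close>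

lemma abs_exponent_admissible:
  "exp h * (\<Sum>n\<in>{1..N}. K n * exp (- \<bar>h\<bar> * real n)) \<le> 1"
proof -
  have "(\<Sum>n\<in>{1..N}. K n * exp (- \<bar>h\<bar> * real n)) \<le> (\<Sum>n\<in>{1..N}. K n * exp (- \<bar>h\<bar>))"
  proof (intro sum_mono mult_left_mono K_nonneg)
    fix n assume "n \<in> {1..N}"
    then show "exp (- \<bar>h\<bar> * real n) \<le> exp (- \<bar>h\<bar>)" using mult_left_mono[of 1 "real n" "\<bar>h\<bar>"] by simp
  qed
  also have "\<dots> = sum K {1..N} * exp (- \<bar>h\<bar>)" by (simp add: sum_distrib_right)
  also have "\<dots> \<le> 1 * exp (- \<bar>h\<bar>)"
    using sum_le_suminf[of K "{1..N}"] K_sums K_nonneg by (intro mult_right_mono) (auto simp: sums_iff)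
  finally have "exp h * (\<Sum>n\<in>{1..N}. K n * exp (- \<bar>h\<bar> * real n)) \<le> exp h * exp (- \<bar>h\<bar>)" by simp
  also have "\<dots> \<le> 1" by (simp add: exp_add[symmetric])
  finally show ?thesis .
qed

text \<open>The limit comes with the bounds by which it is estimated later: it dominates every mean
  with \<open>N \<ge> n0\<close>, so one well-chosen \<open>N\<close> gives a lower bound, and it
  lies below every admissible homogeneous exponent.\<close>

lemma free_energy_exists:
  obtains c where "AE w in envs. (\<lambda>N. ln (Z h N w) / real N) \<longlonglongrightarrow> c"
    "\<And>N. n0 \<le> N \<Longrightarrow> mean_ln_Z h N \<le> c * real N"
    "\<forall>F. (\<forall>N. exp h * (\<Sum>n\<in>{1..N}. K n * exp (- F * real n)) \<le> 1) \<longrightarrow> c \<le> F"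
    "0 \<le> c"
proof -
  obtain c where c: "(\<lambda>n. mean_ln_Z h n / real n) \<longlonglongrightarrow> c" "\<And>n. n0 \<le> n \<Longrightarrow> mean_ln_Z h n \<le> c * real n"
    using superadditive_limit[OF n0 mean_ln_Z_superadd[of _ _ h] mean_ln_Z_le[OF abs_exponent_admissible]] by blast
  have "AE w in envs. (\<lambda>N. ln (Z h N w) / real N) \<longlonglongrightarrow> c"
    using AE_square_deviation[of h]
  proof eventually_elim
    case (elim w)
    have "filterlim (\<lambda>j::nat. j\<^sup>2) at_top sequentially" by (rule filterlim_subseq) (auto simp: strict_mono_def power_strict_mono)
    then have "(\<lambda>j. mean_ln_Z h (j\<^sup>2) / real (j\<^sup>2)) \<longlonglongrightarrow> c" by (rule filterlim_compose[OF c(1)])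
    from tendsto_add[OF elim this] have sq: "(\<lambda>j. ln (Z h (j\<^sup>2) w) / real (j\<^sup>2)) \<longlonglongrightarrow> c"
      by (simp add: diff_divide_distrib)
    define C1 where "C1 = \<bar>h + ln ((1 - \<beta>) * c0)\<bar>"
    show ?case
    proof (rule tendsto_interpolate_squares[OF sq])
      fix a N assume aN: "n0 \<le> a" "a + n0 \<le> N"
      have "h + ln ((1 - \<beta>) * c0) - (1 + \<alpha>) * ln (real (N - a)) \<le> ln (Z h (N - a) (\<lambda>i. w (a + i)))"
        using aN by (intro ln_Z_ge) auto
      moreover have "(1 + \<alpha>) * ln (real (N - a)) \<le> (1 + \<alpha>) * ln (real N)"
        using aN n0 \<alpha> by (intro mult_left_mono ln_mono) auto
      moreover have "ln (Z h a w) + ln (Z h (N - a) (\<lambda>i. w (a + i))) \<le> ln (Z h (a + (N - a)) w)"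
        using aN by (intro ln_Z_superadd) auto
      ultimately show "ln (Z h a w) - (C1 + (1 + \<alpha>) * ln (real N)) \<le> ln (Z h N w)"
        using aN unfolding C1_def by simp
    qed (use \<alpha> in simp)
  qed
  moreover have "c \<le> F" if "\<And>N. exp h * (\<Sum>n\<in>{1..N}. K n * exp (- F * real n)) \<le> 1" for F
  proof (rule LIMSEQ_le_const2[OF c(1)])
    show "\<exists>N. \<forall>n\<ge>N. mean_ln_Z h n / real n \<le> F"
      using mean_ln_Z_le[OF that] n0 by (intro exI[of _ n0]) (auto simp: field_simps)
  qed
  moreover have "0 \<le> c"
  proof -
    have lim: "(\<lambda>N::nat. (h + ln ((1 - \<beta>) * c0) - (1 + \<alpha>) * ln (real N)) / real N) \<longlonglongrightarrow> 0" by real_asymp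
    show ?thesis
    proof (rule LIMSEQ_le[OF lim c(1)], intro exI[of _ n0] allI impI divide_right_mono)
      fix N assume N: "n0 \<le> N"
      have "(\<integral>w. h + ln ((1 - \<beta>) * c0) - (1 + \<alpha>) * ln (real N) \<partial>envs) \<le> mean_ln_Z h N"
        unfolding mean_ln_Z_def by (intro integral_mono integrable_ln_Z ln_Z_ge N) simp
      then show "h + ln ((1 - \<beta>) * c0) - (1 + \<alpha>) * ln (real N) \<le> mean_ln_Z h N" using envs.prob_space by simp
    qed simp
  qed
  ultimately show ?thesis using that c(2) by blast
qed

end

section \<open>Asymptotics of the free energy\<close>

context pinning_tail begin

text \<open>At least \<open>L\<close> contacts up to \<open>N\<close> collect
  \<open>exp (h * L)\<close>; one jump from \<open>m \<le> N\<close> to \<open>2 * N\<close>, of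
  length between \<open>N\<close> and \<open>2 * N\<close>, then pins the endpoint at the polynomial
  cost \<open>\<kappa>\<close>. This is used on the event \<open>A\<close>, and the single jump of
  \<open>ln_Z_ge\<close> off it. The last constant is the lower bound on the probability of
  \<open>A\<close>.\<close>

lemma mean_ln_Z_ge:
  assumes p: "1 < p" "p \<le> 2" and mom: "integrable D (\<lambda>y. \<bar>clip y\<bar> powr p)"
    and S: "summable (\<lambda>n. renewal n powr p)" "growth p * (\<Sum>n. renewal n powr p) \<le> 1 / 2"
    and h: "0 \<le> h" and N: "n0 \<le> N"
    and L: "L \<le> N" and few: "(\<Sum>k<L. \<Sum>m\<le>N. walk K (\<lambda>_. 1) k m * tail K (N - m)) \<le> 1 / 2"
  shows "ln ((1 - \<beta>) * c0 / 4) - (1 + \<alpha>) * ln (real (2 * N)) + h * real L * (1 / (8 * 16 powr (1 / (p - 1))))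
    \<le> mean_ln_Z h (2 * N)"
proof -
  define A where "A = {w. 1 / 4 \<le> long_free L N w}"
  define B where "B = ln ((1 - \<beta>) * c0 / 4) - (1 + \<alpha>) * ln (real (2 * N))"
  have A: "A \<in> sets envs"
  proof -
    have "{w \<in> space envs. 1 / 4 \<le> long_free L N w} \<in> sets envs" by measurable
    then show ?thesis by (simp add: A_def)
  qed
  have N0: "0 < N" using N n0 by simp
  have pos: "0 < (1 - \<beta>) * c0" using \<beta> c0 by simp
  define \<kappa> where "\<kappa> = c0 * real (2 * N) powr - (1 + \<alpha>)"
  have \<kappa>: "0 < \<kappa>" using c0 N0 by (simp add: \<kappa>_def)
  have long: "exp (h * real L) * (1 - \<beta>) * \<kappa> * long_free L N w \<le> Z h (2 * N) w" for w
  proof -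
    have Zm: "exp (h * real L) * (\<Sum>k\<in>{L..N}. walk K (weight w) k m) \<le> Z h m w" if "m \<le> N" for m
    proof -
      have "exp (h * real L) * (\<Sum>k\<in>{L..N}. walk K (weight w) k m) \<le> (\<Sum>k\<in>{L..N}. exp h ^ k * walk K (weight w) k m)"
        unfolding sum_distrib_left
      proof (intro sum_mono mult_right_mono walk_weight_nonneg)
        fix k assume "k \<in> {L..N}"
        then have "real L * h \<le> real k * h" using h by (intro mult_right_mono) auto
        then show "exp (h * real L) \<le> exp h ^ k" by (simp add: exp_of_nat_mult[symmetric] mult.commute)
      qed
      also have "\<dots> \<le> (\<Sum>k\<le>N. exp h ^ k * walk K (weight w) k m)"
        by (intro sum_mono2) (auto intro!: mult_nonneg_nonneg walk_weight_nonneg)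
      also have "\<dots> = Z h m w" unfolding Z_def pinned_eq_sum[OF that] walk_scale ..
      finally show ?thesis .
    qed
    have "exp (h * real L) * \<kappa> * long_free L N w =
        (\<Sum>m\<le>N. exp (h * real L) * (\<Sum>k\<in>{L..N}. walk K (weight w) k m) * (tail K (N - m) * \<kappa>))"
      unfolding long_free_def by (subst sum.swap) (simp add: sum_distrib_left sum_distrib_right mult_ac)
    also have "\<dots> \<le> (\<Sum>m\<le>N. Z h m w * K (2 * N - m))"
    proof (intro sum_mono mult_mono Zm)
      fix m assume m: "m \<in> {..N}"
      have "tail K (N - m) * \<kappa> \<le> 1 * \<kappa>" using \<kappa> by (intro mult_right_mono tail_K_le_1) auto
      also have "\<dots> \<le> c0 * real (2 * N - m) powr - (1 + \<alpha>)"
        unfolding \<kappa>_def mult_1 using m N0 c0 \<alpha> by (intro mult_left_mono powr_mono2') auto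
      also have "\<dots> \<le> K (2 * N - m)" using m N by (intro K_ge) auto
      finally show "tail K (N - m) * \<kappa> \<le> K (2 * N - m)" .
    qed (auto simp: Z_nonneg intro!: mult_nonneg_nonneg tail_K_nonneg less_imp_le[OF \<kappa>])
    also have "\<dots> \<le> approach K (\<lambda>n. exp h * weight w n) (2 * N)"
      unfolding approach_def Z_def[symmetric] using N0
      by (intro sum_mono2) (auto intro!: mult_nonneg_nonneg Z_nonneg K_nonneg)
    finally have "(1 - \<beta>) * (exp (h * real L) * \<kappa> * long_free L N w) \<le>
        (exp h * weight w (2 * N)) * approach K (\<lambda>n. exp h * weight w n) (2 * N)"
    proof (rule mult_mono[rotated])
      show "1 - \<beta> \<le> exp h * weight w (2 * N)"
        using weight_ge[of w "2 * N"] weight_nonneg[of w "2 * N"] h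
          mult_right_mono[of 1 "exp h" "weight w (2 * N)"] by simp
      show "0 \<le> exp (h * real L) * \<kappa> * long_free L N w"
        unfolding long_free_def using \<kappa>
        by (intro mult_nonneg_nonneg sum_nonneg walk_weight_nonneg tail_K_nonneg) auto
    qed (simp add: weight_nonneg)
    also have "\<dots> = Z h (2 * N) w" unfolding Z_def using N0 by (simp add: pinned_rec)
    finally show ?thesis by (simp add: mult_ac)
  qed
  have pointwise: "B + h * real L * indicator A w \<le> ln (Z h (2 * N) w)" for w
  proof (cases "w \<in> A")
    case True
    have "B + h * real L * indicator A w = ln (exp (h * real L) * (1 - \<beta>) * \<kappa> * (1 / 4))"
      using True pos N0 \<beta> c0 unfolding B_def \<kappa>_def by (simp add: ln_mult ln_powr ln_div) (simp add: algebra_simps)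
    also have "\<dots> \<le> ln (Z h (2 * N) w)"
    proof (rule ln_mono)
      show "0 < exp (h * real L) * (1 - \<beta>) * \<kappa> * (1 / 4)" using \<beta> \<kappa> by simp
      have "exp (h * real L) * (1 - \<beta>) * \<kappa> * (1 / 4) \<le> exp (h * real L) * (1 - \<beta>) * \<kappa> * long_free L N w"
        using True \<beta> \<kappa> by (intro mult_left_mono) (auto simp: A_def)
      then show "exp (h * real L) * (1 - \<beta>) * \<kappa> * (1 / 4) \<le> Z h (2 * N) w" using long[of w] by linarith
    qed
    finally show ?thesis .
  next
    case False
    have "ln ((1 - \<beta>) * c0 / 4) \<le> ln ((1 - \<beta>) * c0)" using pos by (intro ln_mono) linarith+
    moreover have "h + ln ((1 - \<beta>) * c0) - (1 + \<alpha>) * ln (real (2 * N)) \<le> ln (Z h (2 * N) w)"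
      using N by (intro ln_Z_ge) simp
    ultimately show ?thesis using False h unfolding B_def by simp
  qed
  have int: "integrable envs (\<lambda>w. h * real L * indicator A w)"
    using A by (intro integrable_mult_right integrable_real_indicator) (auto simp: envs.emeasure_eq_measure)
  have "B + h * real L * (1 / (8 * 16 powr (1 / (p - 1)))) \<le> B + h * real L * measure envs A"
    unfolding A_def using h by (intro add_left_mono mult_left_mono prob_long_free_ge[OF p mom S L few]) auto
  also have "\<dots> = (\<integral>w. B + h * real L * indicator A w \<partial>envs)"
    using int envs.prob_space by simp
  also have "\<dots> \<le> mean_ln_Z h (2 * N)"
    unfolding mean_ln_Z_def using int by (intro integral_mono integrable_ln_Z pointwise) simp
  finally show ?thesis unfolding B_def .
qed

end

text \<open>Each jump longer than \<open>1/F\<close> contributes at most half its mass to the Laplace transform.\<close>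

lemma pure_exponent_admissible:
  assumes K: "\<And>n. 0 \<le> K n" "K sums 1" and \<alpha>: "0 < \<alpha>"
    and d: "0 < d" "\<And>n. 1 \<le> n \<Longrightarrow> d * real n powr - \<alpha> \<le> tail K n"
    and h: "0 < h" "h \<le> d * 2 powr - (1 + \<alpha>)"
  defines "F \<equiv> (h / (d * 2 powr - (1 + \<alpha>))) powr (1 / \<alpha>)"
  shows "exp h * (\<Sum>n\<in>{1..N}. K n * exp (- F * real n)) \<le> 1"
proof -
  \<comment> \<open>With \<open>m\<close> the least integer above \<open>1 / F\<close>, hence at
    most \<open>2 / F\<close>, half of \<open>tail K m\<close> is at least
    \<open>e * F powr \<alpha>\<close>, which is \<open>h\<close> by the choice of
    \<open>F\<close>.\<close>
  define e where "e = d * 2 powr - (1 + \<alpha>)"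
  have e: "0 < e" using d by (simp add: e_def)
  have F: "0 < F" "F \<le> 1" "F powr \<alpha> = h / e"
    using h e \<alpha> unfolding F_def e_def[symmetric] by (auto simp: powr_powr intro!: powr_le1)
  define m where "m = nat \<lceil>1 / F\<rceil>"
  have m: "1 / F \<le> real m" "real m \<le> 1 / F + 1"
    unfolding m_def using F by (auto; linarith)+
  have m1: "1 \<le> 1 / F" using F by simp
  then have m1': "1 \<le> m" using m by linarith
  have m2: "real m \<le> 2 / F" using m(2) m1 by (simp add: add_divide_distrib[symmetric])
  have "(\<Sum>n\<in>{1..N}. K n * exp (- F * real n)) \<le> (\<Sum>n\<in>{1..N}. K n / 2 + (if n \<le> m then K n / 2 else 0))"
  proof (intro sum_mono)
    fix n assume n: "n \<in> {1..N}"
    show "K n * exp (- F * real n) \<le> K n / 2 + (if n \<le> m then K n / 2 else 0)"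
    proof (cases "n \<le> m")
      case True
      have "K n * exp (- F * real n) \<le> K n * 1" using F K by (intro mult_left_mono) auto
      then show ?thesis using True by simp
    next
      case False
      have "1 / F \<le> real n" using m(1) False by linarith
      then have "1 \<le> F * real n" using F by (simp add: field_simps)
      then have "2 \<le> exp (F * real n)" using exp_ge_add_one_self[of "F * real n"] by linarith
      then have "exp (- F * real n) \<le> 1 / 2" by (simp add: exp_minus field_simps)
      then have "K n * exp (- F * real n) \<le> K n * (1 / 2)" using K by (intro mult_left_mono) auto
      then show ?thesis using False by simp
    qed
  qed
  also have "\<dots> = (\<Sum>n\<in>{1..N}. K n) / 2 + (\<Sum>n\<in>{1..N} \<inter> {..m}. K n) / 2"
  proof -
    have "(\<Sum>n\<in>{1..N}. if n \<le> m then K n / 2 else 0) = (\<Sum>n\<in>{1..N} \<inter> {..m}. K n / 2)"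
      by (subst sum.inter_restrict) (auto intro!: sum.cong)
    then show ?thesis by (simp only: sum.distrib sum_divide_distrib)
  qed
  also have "(\<Sum>n\<in>{1..N}. K n) \<le> 1" using sum_le_suminf[of K "{1..N}"] K by (auto simp: sums_iff)
  also have "(\<Sum>n\<in>{1..N} \<inter> {..m}. K n) \<le> (\<Sum>n\<le>m. K n)" using K by (intro sum_mono2) auto
  also have "(\<Sum>n\<le>m. K n) = 1 - tail K m" by (simp add: tail_def)
  finally have *: "(\<Sum>n\<in>{1..N}. K n * exp (- F * real n)) \<le> 1 - tail K m / 2" by (simp add: diff_divide_distrib)
  have "2 powr - (1 + \<alpha>) = 2 powr - \<alpha> / (2::real)"
  proof -
    have "- (1 + \<alpha>) = - \<alpha> + - 1" by simp
    then show ?thesis by (simp only: powr_add) simp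
  qed
  then have "e = d * 2 powr - \<alpha> / 2" by (simp add: e_def)
  moreover have "h = e * F powr \<alpha>" using F(3) e by simp
  ultimately have "h = d * (2 powr - \<alpha> * F powr \<alpha>) / 2" by simp
  also have "2 powr - \<alpha> * F powr \<alpha> = (2 / F) powr - \<alpha>"
    using F by (simp add: powr_divide powr_minus field_simps)
  also have "d * (2 / F) powr - \<alpha> / 2 \<le> d * real m powr - \<alpha> / 2"
    using m1' m2 \<alpha> d by (intro divide_right_mono mult_left_mono powr_mono2') auto
  also have "\<dots> \<le> tail K m / 2" using d(2)[OF m1'] by (intro divide_right_mono) auto
  finally have "(\<Sum>n\<in>{1..N}. K n * exp (- F * real n)) \<le> 1 - h" using * by linarith
  also have "\<dots> \<le> exp (- h)" using exp_ge_add_one_self[of "- h"] by simp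
  finally have "exp h * (\<Sum>n\<in>{1..N}. K n * exp (- F * real n)) \<le> exp h * exp (- h)" by (intro mult_left_mono) auto
  then show ?thesis by (simp add: exp_minus)
qed

text \<open>Division by \<open>ln h < 0\<close> reverses inequalities, so the upper bound on
  \<open>c\<close> bounds the ratio from below. The lower bound is available for each
  \<open>s < \<alpha>\<close>, and \<open>s\<close> is chosen near \<alpha> depending on the target
  \<open>a\<close>; constant factors vanish against \<open>ln h\<close>.\<close>

lemma tendsto_log_ratio:
  fixes c :: "real \<Rightarrow> real"
  assumes \<alpha>: "0 < \<alpha>" and d: "0 < d"
    and upper: "\<forall>\<^sub>F h in at_right 0. c h \<le> (h / d) powr (1 / \<alpha>)"
    and lower: "\<And>s. 0 < s \<Longrightarrow> s < \<alpha> \<Longrightarrow> \<forall>\<^sub>F h in at_right 0. h powr (1 / s) / 4 \<le> c h"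
  shows "((\<lambda>h. ln (c h) / ln h) \<longlongrightarrow> 1 / \<alpha>) (at_right 0)"
proof -
  have small: "\<forall>\<^sub>F h in at_right (0::real). 0 < h \<and> h < 1"
    using eventually_at_right_real[of 0 1] by (auto elim: eventually_mono)
  show ?thesis
  proof (rule order_tendstoI)
    fix a assume a: "1 / \<alpha> < a"
    have a0: "0 < a" using a \<alpha> by (smt (verit) divide_pos_pos)
    define b where "b = 1 / a"
    define s where "s = (b + \<alpha>) / 2"
    have "b < \<alpha>" "0 < b" unfolding b_def using a a0 \<alpha> by (simp_all add: field_simps)
    then have s: "0 < s" "s < \<alpha>" "1 / a < s" unfolding b_def[symmetric] s_def by simp_all
    have "1 / s < a" using s a0 by (simp add: field_simps)
    moreover have "((\<lambda>h::real. 1 / s - ln 4 / ln h) \<longlongrightarrow> 1 / s) (at_right 0)" by real_asymp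
    ultimately have "\<forall>\<^sub>F h in at_right 0. 1 / s - ln 4 / ln h < a" by (rule order_tendstoD(2)[rotated])
    then show "\<forall>\<^sub>F h in at_right 0. ln (c h) / ln h < a"
      using lower[OF s(1,2)] small
    proof eventually_elim
      case (elim h)
      have "ln (h powr (1 / s) / 4) \<le> ln (c h)" using elim by (intro ln_mono) auto
      then have "1 / s * ln h - ln 4 \<le> ln (c h)" using elim by (simp add: ln_div ln_powr)
      moreover have "ln h < 0" using elim by simp
      ultimately have "ln (c h) / ln h \<le> (1 / s * ln h - ln 4) / ln h" by (simp add: divide_right_mono_neg)
      also have "\<dots> = 1 / s - ln 4 / ln h" using \<open>ln h < 0\<close> by (simp add: diff_divide_distrib)
      finally show ?case using elim by linarith
    qed
  next
    fix a assume a: "a < 1 / \<alpha>"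
    have "((\<lambda>h::real. 1 / \<alpha> - 1 / \<alpha> * ln d / ln h) \<longlongrightarrow> 1 / \<alpha>) (at_right 0)" by real_asymp
    then have "\<forall>\<^sub>F h in at_right 0. a < 1 / \<alpha> - 1 / \<alpha> * ln d / ln h" by (rule order_tendstoD(1)) (rule a)
    \<comment> \<open>Used here for \<open>0 < c h\<close> only, as \<open>ln\<close> is monotone on
      positive arguments.\<close>
    moreover have "\<forall>\<^sub>F h in at_right 0. h powr (1 / (\<alpha> / 2)) / 4 \<le> c h" using \<alpha> by (intro lower) auto
    ultimately show "\<forall>\<^sub>F h in at_right 0. a < ln (c h) / ln h"
      using upper small
    proof eventually_elim
      case (elim h)
      have "0 < h powr (1 / (\<alpha> / 2)) / 4" using elim by simp
      then have "0 < c h" using elim by linarith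
      then have "ln (c h) \<le> ln ((h / d) powr (1 / \<alpha>))" using elim by (intro ln_mono) auto
      then have "ln (c h) \<le> 1 / \<alpha> * (ln h - ln d)" using elim d by (simp add: ln_div ln_powr)
      moreover have "ln h < 0" using elim by simp
      ultimately have "1 / \<alpha> * (ln h - ln d) / ln h \<le> ln (c h) / ln h" by (intro divide_right_mono_neg) auto
      moreover have "1 / \<alpha> * (ln h - ln d) / ln h = 1 / \<alpha> - 1 / \<alpha> * ln d / ln h"
        using \<open>ln h < 0\<close> \<alpha> by (simp add: field_simps)
      ultimately show ?case using elim by linarith
    qed
  qed
qed

context pinning_tail begin

text \<open>Take \<open>N\<close> about \<open>h powr -(1 / t)\<close>, so that
  \<open>h \<ge> N powr -t\<close>, and \<open>L\<close> about \<open>N powr s / (2 * M)\<close>,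
  for which \<open>walk_tail_le\<close> gives 1/2. The gain \<open>h * L\<close> is of order at
  least \<open>N powr (s - t)\<close> and beats the logarithms, so the mean at \<open>2 * N\<close>
  is at least 1 and \<open>c h \<ge> 1 / (2 * N)\<close>.\<close>

lemma free_energy_lower:
  assumes p: "1 < p" "p \<le> 2" and mom: "integrable D (\<lambda>y. \<bar>clip y\<bar> powr p)"
    and S: "summable (\<lambda>n. renewal n powr p)" "growth p * (\<Sum>n. renewal n powr p) \<le> 1 / 2"
    and t: "0 < t" "t < s" "s \<le> 1" and M: "(\<lambda>n. K n * real n powr s) sums M"
    and c: "\<And>h N. n0 \<le> N \<Longrightarrow> mean_ln_Z h N \<le> c h * real N"
  shows "\<forall>\<^sub>F h in at_right 0. h powr (1 / t) / 4 \<le> c h"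
proof -
  have M1: "1 \<le> M" using t by (intro moment_ge_1[OF K_nonneg K_0 K_sums _ M]) simp
  define q where "q = 1 / (8 * 16 powr (1 / (p - 1)))"
  have q: "0 < q" by (simp add: q_def)
  define A where "A = ln ((1 - \<beta>) * c0 / 4)"
  \<comment> \<open>The bound of \<open>mean_ln_Z_ge\<close> at \<open>N = x\<close>, with
    \<open>h\<close> and \<open>L\<close> replaced by the lower estimates \<open>x powr -t\<close>
    and \<open>x powr s / (2 * M) - 1\<close>.\<close>
  define \<phi> where "\<phi> = (\<lambda>x::real. A - (1 + \<alpha>) * ln (2 * x) + q * (x powr - t * (x powr s / (2 * M) - 1)))"
  have "filterlim \<phi> at_top at_top" unfolding \<phi>_def using q M1 t \<alpha> by real_asymp
  then have "\<forall>\<^sub>F x in at_top. 1 \<le> \<phi> x" by (simp add: filterlim_at_top)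
  moreover have "filterlim (\<lambda>h. real (nat \<lceil>h powr - (1 / t)\<rceil>)) at_top (at_right 0)"
  proof (rule filterlim_at_top_mono)
    show "filterlim (\<lambda>h::real. h powr - (1 / t)) at_top (at_right 0)" using t by real_asymp
    show "\<forall>\<^sub>F h in at_right 0. h powr - (1 / t) \<le> real (nat \<lceil>h powr - (1 / t)\<rceil>)"
      by (intro always_eventually allI) linarith
  qed
  ultimately have "\<forall>\<^sub>F h in at_right 0. 1 \<le> \<phi> (real (nat \<lceil>h powr - (1 / t)\<rceil>)) \<and> real n0 \<le> real (nat \<lceil>h powr - (1 / t)\<rceil>)"
    by (intro eventually_conj) (auto simp: filterlim_iff eventually_ge_at_top)
  moreover have "\<forall>\<^sub>F h in at_right (0::real). 0 < h \<and> h < 1"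
    using eventually_at_right_real[of 0 1] by (auto elim: eventually_mono)
  ultimately show ?thesis
  proof eventually_elim
    case (elim h)
    define N where "N = nat \<lceil>h powr - (1 / t)\<rceil>"
    define L where "L = nat \<lfloor>real N powr s / (2 * M)\<rfloor>"
    have h: "0 < h" "h < 1" using elim by auto
    have N: "n0 \<le> N" "1 \<le> \<phi> (real N)" using elim by (auto simp: N_def)
    have N1: "1 \<le> N" using N n0 by simp
    have hp: "1 \<le> h powr - (1 / t)" using h t powr_mono'[of "- (1 / t)" 0 h] by simp
    have Nh: "h powr - (1 / t) \<le> real N" "real N \<le> 2 * h powr - (1 / t)"
      unfolding N_def using hp by linarith+
    have L_le: "real L \<le> real N powr s / (2 * M)" "real N powr s / (2 * M) - 1 \<le> real L"
      unfolding L_def using M1 by (auto; linarith)+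
    have "real L \<le> real N"
    proof -
      have "real N powr s / (2 * M) \<le> real N powr s / 1" using M1 by (intro divide_left_mono) auto
      also have "\<dots> \<le> real N powr 1" unfolding div_by_1 using N1 t by (intro powr_mono) auto
      finally show ?thesis using L_le(1) by simp
    qed
    then have LN: "L \<le> N" by simp
    have "(\<Sum>k<L. \<Sum>m\<le>N. walk K (\<lambda>_. 1) k m * tail K (N - m)) \<le> real L * M * real N powr - s"
      using N1 t by (intro walk_tail_le K_nonneg K_0 K_sums M) auto
    also have "\<dots> \<le> (real N powr s / (2 * M)) * M * real N powr - s"
      using L_le M1 by (intro mult_right_mono) auto
    also have "\<dots> = 1 / 2" using M1 N1 by (simp add: powr_minus field_simps)
    finally have few: "(\<Sum>k<L. \<Sum>m\<le>N. walk K (\<lambda>_. 1) k m * tail K (N - m)) \<le> 1 / 2" .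
    have "real N powr - t \<le> (h powr - (1 / t)) powr - t" using Nh(1) hp t by (intro powr_mono2') auto
    also have "\<dots> = h" using h t by (simp add: powr_powr)
    finally have hN: "real N powr - t \<le> h" .
    have "real N powr - t * (real N powr s / (2 * M) - 1) \<le> real N powr - t * real L"
      by (intro mult_left_mono L_le) simp
    also have "\<dots> \<le> h * real L" by (intro mult_right_mono hN) simp
    finally have "q * (real N powr - t * (real N powr s / (2 * M) - 1)) \<le> q * (h * real L)"
      using q by (intro mult_left_mono) auto
    then have "1 \<le> A - (1 + \<alpha>) * ln (real (2 * N)) + h * real L * q"
      using N(2) unfolding \<phi>_def by (simp add: mult_ac)
    also have "\<dots> \<le> mean_ln_Z h (2 * N)"
      unfolding A_def q_def using h by (intro mean_ln_Z_ge[OF p mom S _ N(1) LN few]) simp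
    also have "\<dots> \<le> c h * real (2 * N)" using N(1) by (intro c) simp
    finally have c1: "1 \<le> c h * (2 * real N)" by simp
    have N0: "0 < real N" using N1 by simp
    have "h powr (1 / t) / 4 = 1 / (2 * (2 * h powr - (1 / t)))" using h by (simp add: powr_minus field_simps)
    also have "\<dots> \<le> 1 / (2 * real N)" using Nh(2) N0 h by (intro divide_left_mono) auto
    also have "\<dots> \<le> c h" using c1 N0 by (simp add: field_simps)
    finally show ?case .
  qed
qed

end

section \<open>From the recursion to the pinning model\<close>

text \<open>Induction on the number of jumps: increment number \<open>k\<close> is independent of
  the earlier ones, and summing over the position \<open>m\<close> of contact \<open>k\<close> gives
  the recursion of \<open>walk\<close>.\<close>

lemma (in prob_space) expectation_walk:
  fixes K :: "nat \<Rightarrow> real" and W :: "nat \<Rightarrow> real"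
  assumes start: "\<And>x. x \<in> space M \<Longrightarrow> \<tau> 0 x = 0" and incr: "\<And>x. x \<in> space M \<Longrightarrow> strict_mono (\<lambda>n. \<tau> n x)"
    and ind: "indep_vars (\<lambda>_. count_space UNIV) (\<lambda>n x. \<tau> (Suc n) x - \<tau> n x) UNIV"
    and law: "\<And>n k. prob {x \<in> space M. \<tau> (Suc n) x - \<tau> n x = k} = K k"
  defines "\<Phi> \<equiv> \<lambda>k n x. (\<Prod>i\<in>{1..k}. W (\<tau> i x)) * of_bool (\<tau> k x = n)"
  shows "integrable M (\<Phi> k n)" "expectation (\<Phi> k n) = walk K W k n"
proof -
  define X where "X = (\<lambda>i x. \<tau> (Suc i) x - \<tau> i x)"
  have X_meas: "X i \<in> measurable M (count_space UNIV)" for i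
    using ind unfolding indep_vars_def X_def by auto
  have \<tau>_sum: "\<tau> k x = (\<Sum>i<k. X i x)" if "x \<in> space M" for k x
  proof (induction k)
    case (Suc k)
    have "\<tau> k x \<le> \<tau> (Suc k) x" using strict_mono_leD[OF incr[OF that], of k "Suc k"] by simp
    then show ?case using Suc by (simp add: X_def)
  qed (simp add: start that)
  \<comment> \<open>The functional written in the increments, where independence is available. A
    finite product of copies of the discrete naturals is again discrete, so measurability is
    immediate.\<close>
  define \<phi> where "\<phi> = (\<lambda>k n (a :: nat \<Rightarrow> nat). (\<Prod>i\<in>{1..k}. W (\<Sum>j<i. a j)) * of_bool ((\<Sum>j<k. a j) = n))"
  have \<Phi>_eq: "\<Phi> k n x = \<phi> k n (restrict (\<lambda>i. X i x) {..<k})" if "x \<in> space M" for k n x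
    unfolding \<Phi>_def \<phi>_def \<tau>_sum[OF that]
    by (intro arg_cong2[of _ _ _ _ "(*)"] prod.cong arg_cong[of _ _ W] arg_cong[of _ _ of_bool] arg_cong2[of _ _ _ _ "(=)"] sum.cong) auto
  have PiM_count: "PiM I (\<lambda>_. count_space (UNIV :: nat set)) = count_space (PiE I (\<lambda>_. UNIV))" if "finite I" for I :: "nat set"
    using that by (intro count_space_PiM_finite) auto
  have \<phi>_meas: "\<phi> k n \<in> borel_measurable (PiM {..<k} (\<lambda>_. count_space UNIV))" for k n
    by (simp add: PiM_count)
  have restr_meas: "(\<lambda>x. restrict (\<lambda>i. X i x) I) \<in> measurable M (PiM I (\<lambda>_. count_space UNIV))" for I
    by (intro measurable_restrict X_meas)
  have \<Phi>_meas: "\<Phi> k n \<in> borel_measurable M" for k n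
    using measurable_compose[OF restr_meas \<phi>_meas] by (subst measurable_cong[OF \<Phi>_eq])
  have \<Phi>_int: "integrable M (\<Phi> k n)" for k n
  proof (rule integrable_const_bound[OF _ \<Phi>_meas])
    \<comment> \<open>On the event \<open>\<tau> k x = n\<close> all contacts lie in
      \<open>{..n}\<close>, so finitely many weights bound the product.\<close>
    define b where "b = 1 + (\<Sum>j\<le>n. \<bar>W j\<bar>)"
    have b: "1 \<le> b" by (simp add: b_def sum_nonneg)
    have Wb: "\<bar>W j\<bar> \<le> b" if "j \<le> n" for j
      using member_le_sum[of j "{..n}" "\<lambda>j. \<bar>W j\<bar>"] that by (simp add: b_def)
    have "\<bar>\<Phi> k n x\<bar> \<le> b ^ k" if x: "x \<in> space M" for x
    proof (cases "\<tau> k x = n")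
      case True
      have "\<bar>W (\<tau> i x)\<bar> \<le> b" if "i \<in> {1..k}" for i
      proof (rule Wb)
        show "\<tau> i x \<le> n" using strict_mono_leD[OF incr[OF x], of i k] that True by simp
      qed
      then have "(\<Prod>i\<in>{1..k}. \<bar>W (\<tau> i x)\<bar>) \<le> (\<Prod>i\<in>{1..k}. b)" by (intro prod_mono) auto
      then show ?thesis using True by (simp add: \<Phi>_def abs_prod)
    qed (use b in \<open>simp add: \<Phi>_def\<close>)
    then show "AE x in M. norm (\<Phi> k n x) \<le> b ^ k" by (auto intro: AE_I2)
  qed
  then show "integrable M (\<Phi> k n)" .
  show "expectation (\<Phi> k n) = walk K W k n"
  proof (induction k arbitrary: n)
    case 0
    have "expectation (\<Phi> 0 n) = expectation (\<lambda>x. of_bool (n = 0))"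
      by (intro Bochner_Integration.integral_cong) (auto simp: \<Phi>_def start)
    then show ?case by (simp add: prob_space)
  next
    case (Suc k)
    define B where "B = (\<lambda>d x. of_bool (X k x = d) :: real)"
    have B_meas: "B d \<in> borel_measurable M" for d
      unfolding B_def by (rule measurable_compose[OF X_meas]) simp
    have B_int: "integrable M (B d)" for d
      by (rule integrable_const_bound[where B = 1, OF _ B_meas]) (auto simp: B_def)
    have EB: "expectation (B d) = K d" for d
    proof -
      have "expectation (B d) = expectation (indicator {x \<in> space M. X k x = d})"
        by (intro Bochner_Integration.integral_cong) (auto simp: B_def indicator_def)
      also have "\<dots> = prob {x \<in> space M. X k x = d}" by (simp add: Int_def conj_commute cong: conj_cong)
      finally show ?thesis using law[of k d] by (simp add: X_def)
    qed
    have prod: "integrable M (\<lambda>x. \<Phi> k m x * B d x)"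
      "expectation (\<lambda>x. \<Phi> k m x * B d x) = walk K W k m * K d" for m d
    proof -
      define \<Psi> where "\<Psi> = \<phi> k m \<circ> (\<lambda>x. restrict (\<lambda>i. X i x) {..<k})"
      have \<Psi>: "\<Phi> k m x = \<Psi> x" if "x \<in> space M" for x using \<Phi>_eq[OF that] by (simp add: \<Psi>_def)
      have \<Psi>_int: "integrable M \<Psi>" using \<Phi>_int[of k m] \<Psi> by (simp cong: Bochner_Integration.integrable_cong)
      have "indep_var (PiM {..<k} (\<lambda>_. count_space UNIV)) (\<lambda>x. restrict (\<lambda>i. X i x) {..<k})
          (PiM {k} (\<lambda>_. count_space UNIV)) (\<lambda>x. restrict (\<lambda>i. X i x) {k})"
        by (rule indep_var_restrict[OF ind[folded X_def]]) auto
      then have "indep_var borel (\<phi> k m \<circ> (\<lambda>x. restrict (\<lambda>i. X i x) {..<k})) borel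
          ((\<lambda>a. of_bool (a k = d)) \<circ> (\<lambda>x. restrict (\<lambda>i. X i x) {k}))"
        by (rule indep_var_compose[OF _ \<phi>_meas]) (simp add: PiM_count)
      moreover have "(\<lambda>a. of_bool (a k = d)) \<circ> (\<lambda>x. restrict (\<lambda>i. X i x) {k}) = B d"
        by (simp add: B_def fun_eq_iff)
      ultimately have ind\<Psi>: "indep_var borel \<Psi> borel (B d)" by (simp only: \<Psi>_def)
      show "integrable M (\<lambda>x. \<Phi> k m x * B d x)"
        using indep_var_integrable[OF ind\<Psi> \<Psi>_int B_int] \<Psi> by (simp cong: Bochner_Integration.integrable_cong)
      have "expectation (\<lambda>x. \<Phi> k m x * B d x) = expectation (\<lambda>x. \<Psi> x * B d x)"
        by (intro Bochner_Integration.integral_cong refl) (simp add: \<Psi>)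
      also have "\<dots> = expectation \<Psi> * K d"
        by (simp add: indep_var_lebesgue_integral[OF ind\<Psi> \<Psi>_int B_int] EB)
      also have "expectation \<Psi> = expectation (\<Phi> k m)"
        by (intro Bochner_Integration.integral_cong refl) (simp add: \<Psi>)
      finally show "expectation (\<lambda>x. \<Phi> k m x * B d x) = walk K W k m * K d" by (simp only: Suc)
    qed
    have "expectation (\<Phi> (Suc k) n) = expectation (\<lambda>x. \<Sum>m<n. W n * (\<Phi> k m x * B (n - m) x))"
    proof (intro Bochner_Integration.integral_cong refl)
      fix x assume x: "x \<in> space M"
      have lt: "\<tau> k x < \<tau> (Suc k) x" using incr[OF x] by (simp add: strict_mono_Suc_iff)
      show "\<Phi> (Suc k) n x = (\<Sum>m<n. W n * (\<Phi> k m x * B (n - m) x))"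
      proof (cases "\<tau> (Suc k) x = n")
        case True
        have "(\<Sum>m<n. W n * (\<Phi> k m x * B (n - m) x)) = (\<Sum>m\<in>{\<tau> k x}. W n * (\<Phi> k m x * B (n - m) x))"
          using True lt by (intro sum.mono_neutral_right) (auto simp: \<Phi>_def)
        then show ?thesis using True by (simp add: \<Phi>_def B_def X_def)
      next
        case False
        have "\<Phi> k m x * B (n - m) x = 0" if "m < n" for m
          using False lt that by (auto simp: \<Phi>_def B_def X_def)
        then have "(\<Sum>m<n. W n * (\<Phi> k m x * B (n - m) x)) = 0" by (intro sum.neutral) simp
        moreover have "\<Phi> (Suc k) n x = 0" using False by (simp add: \<Phi>_def)
        ultimately show ?thesis by simp
      qed
    qed
    also have "\<dots> = (\<Sum>m<n. W n * expectation (\<lambda>x. \<Phi> k m x * B (n - m) x))"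
      by (subst Bochner_Integration.integral_sum) (auto intro!: prod)
    also have "\<dots> = (\<Sum>m<n. W n * (walk K W k m * K (n - m)))"
      by (simp only: prod)
    finally show ?case by (simp add: sum_distrib_left)
  qed
qed

text \<open>Paths are sorted by the index \<open>k\<close> with \<open>\<tau> k x = N\<close>:
  strict monotonicity makes it unique and forces \<open>k \<le> N\<close>, and the contacts in
  \<open>{1..N}\<close> are then those of index 1 to \<open>k\<close>.\<close>

lemma partition_function_eq_pinned:
  assumes "renewal_process P K \<tau>"
  shows "partition_function P \<tau> \<beta> h w N = pinned K (\<lambda>n. exp h * (\<beta> * w n + 1)) N"
proof -
  interpret prob_space P using assms by (simp add: renewal_process_def)
  define W where "W = (\<lambda>n. exp h * (\<beta> * w n + 1))"
  have start: "\<And>x. x \<in> space P \<Longrightarrow> \<tau> 0 x = 0" and incr: "\<And>x. x \<in> space P \<Longrightarrow> strict_mono (\<lambda>n. \<tau> n x)"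
    and ind: "indep_vars (\<lambda>_. count_space UNIV) (\<lambda>n x. \<tau> (Suc n) x - \<tau> n x) UNIV"
    and law: "\<And>n k. prob {x \<in> space P. \<tau> (Suc n) x - \<tau> n x = k} = K k"
    using assms by (auto simp: renewal_process_def)
  note walk = expectation_walk[where W = W, OF start incr ind law]
  let ?\<Phi> = "\<lambda>k x. (\<Prod>i\<in>{1..k}. W (\<tau> i x)) * of_bool (\<tau> k x = N)"
  have "partition_function P \<tau> \<beta> h w N =
      expectation (\<lambda>x. (\<Prod>n\<in>renewal_set \<tau> x \<inter> {1..N}. W n) * indicator (renewal_set \<tau> x) N)"
    by (simp add: partition_function_def W_def)
  also have "\<dots> = expectation (\<lambda>x. \<Sum>k\<le>N. ?\<Phi> k x)"
  proof (intro Bochner_Integration.integral_cong refl)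
    fix x assume x: "x \<in> space P"
    note mono = incr[OF x]
    have inj: "inj (\<lambda>k. \<tau> k x)" using mono by (rule strict_mono_imp_inj_on)
    show "(\<Prod>n\<in>renewal_set \<tau> x \<inter> {1..N}. W n) * indicator (renewal_set \<tau> x) N = (\<Sum>k\<le>N. ?\<Phi> k x)"
    proof (cases "N \<in> renewal_set \<tau> x")
      case True
      then obtain k where k: "\<tau> k x = N" by (auto simp: renewal_set_def)
      have kN: "k \<le> N" using strict_mono_imp_increasing[OF mono, of k] k by simp
      have "renewal_set \<tau> x \<inter> {1..N} = (\<lambda>i. \<tau> i x) ` {1..k}"
      proof (intro set_eqI iffI)
        fix n assume "n \<in> renewal_set \<tau> x \<inter> {1..N}"
        then obtain i where i: "n = \<tau> i x" "1 \<le> \<tau> i x" "\<tau> i x \<le> \<tau> k x" by (auto simp: renewal_set_def k)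
        have "i \<noteq> 0" using i start[OF x] by (intro notI) simp
        moreover have "i \<le> k" using i(3) strict_mono_less_eq[OF mono, of i k] by simp
        ultimately show "n \<in> (\<lambda>i. \<tau> i x) ` {1..k}" using i by auto
      next
        fix n assume "n \<in> (\<lambda>i. \<tau> i x) ` {1..k}"
        then obtain i where i: "n = \<tau> i x" "1 \<le> i" "i \<le> k" by auto
        have "\<tau> i x \<le> N" using strict_mono_less_eq[OF mono, of i k] i k by simp
        moreover have "i \<le> \<tau> i x" by (rule strict_mono_imp_increasing[OF mono])
        ultimately show "n \<in> renewal_set \<tau> x \<inter> {1..N}" using i by (auto simp: renewal_set_def)
      qed
      then have "(\<Prod>n\<in>renewal_set \<tau> x \<inter> {1..N}. W n) = (\<Prod>i\<in>{1..k}. W (\<tau> i x))"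
        using inj by (simp add: prod.reindex inj_on_subset)
      moreover have "(\<Sum>k\<le>N. ?\<Phi> k x) = (\<Sum>j\<in>{k}. ?\<Phi> j x)"
        using kN k inj by (intro sum.mono_neutral_right) (auto dest: injD)
      ultimately show ?thesis using True k by simp
    next
      case False
      then have "\<tau> k x \<noteq> N" for k by (auto simp: renewal_set_def)
      then show ?thesis using False by simp
    qed
  qed
  also have "\<dots> = (\<Sum>k\<le>N. expectation (?\<Phi> k))"
    by (rule Bochner_Integration.integral_sum) (rule walk(1))
  also have "\<dots> = pinned K W N" by (simp only: walk(2) pinned_def)
  finally show ?thesis by (simp add: W_def)
qed

lemma (in disorder) distr_environment:
  assumes "iid_environment M D \<omega>"
  shows "(\<lambda>y n. \<omega> n y) \<in> measurable M envs" "distr M envs (\<lambda>y n. \<omega> n y) = envs"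
proof -
  interpret M: prob_space M using assms by (simp add: iid_environment_def)
  have ind: "M.indep_vars (\<lambda>_. borel) \<omega> UNIV" and law: "\<And>n. distr M borel (\<omega> n) = D"
    using assms by (auto simp: iid_environment_def)
  have rv: "\<omega> n \<in> borel_measurable M" for n using ind by (simp add: M.indep_vars_def)
  have rvD: "\<omega> n \<in> measurable M D" for n using rv[of n] by (simp cong: measurable_cong_sets add: sets_D)
  show meas: "(\<lambda>y n. \<omega> n y) \<in> measurable M envs"
    unfolding envs_def by (intro measurable_PiM_single' rvD) (auto simp: space_PiM)
  have "distr M (PiM UNIV (\<lambda>_. borel)) (\<lambda>y. \<lambda>i\<in>UNIV. \<omega> i y) = PiM UNIV (\<lambda>i. distr M borel (\<omega> i))"
    using M.indep_vars_iff_distr_eq_PiM[where I = UNIV and M' = "\<lambda>_. borel" and X = \<omega>] ind rv by simp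
  then have "distr M (PiM UNIV (\<lambda>_. borel)) (\<lambda>y n. \<omega> n y) = envs"
    by (simp add: law envs_def restrict_def)
  moreover have "sets (PiM UNIV (\<lambda>_::nat. borel :: real measure)) = sets envs"
    unfolding envs_def by (intro sets_PiM_cong) (auto simp: sets_D)
  ultimately show "distr M envs (\<lambda>y n. \<omega> n y) = envs"
    using distr_cong[of M M "PiM UNIV (\<lambda>_. borel)" envs "\<lambda>y n. \<omega> n y" "\<lambda>y n. \<omega> n y"] by simp
qed

text \<open>The clipping is undone at all sites at once outside a null set; uniqueness of limits
  then makes the definite description denote \<open>c\<close>.\<close>

lemma (in pinning_tail) free_energy_eq:
  assumes renewal: "renewal_process P K \<tau>" and env: "iid_environment M D \<omega>"
    and lim: "AE w in envs. (\<lambda>N. ln (Z h N w) / real N) \<longlonglongrightarrow> c"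
  shows "free_energy P \<tau> M \<omega> \<beta> h = c"
proof -
  interpret M: prob_space M using env by (simp add: iid_environment_def)
  note distr = distr_environment[OF env]
  have "AE y in M. (\<lambda>N. ln (Z h N (\<lambda>n. \<omega> n y)) / real N) \<longlonglongrightarrow> c"
    by (rule AE_distrD[OF distr(1)]) (simp only: distr(2) lim)
  moreover have "AE y in M. \<forall>n. clip (\<omega> n y) = \<omega> n y"
  proof (intro AE_all_countable[THEN iffD2] allI)
    fix n
    have "\<omega> n \<in> borel_measurable M" "distr M borel (\<omega> n) = D"
      using env by (auto simp: iid_environment_def M.indep_vars_def)
    then show "AE y in M. clip (\<omega> n y) = \<omega> n y" using AE_clip by (intro AE_distrD[of "\<omega> n" M borel]) auto
  qed
  ultimately have ae: "AE y in M. (\<lambda>N. 1 / real N * ln (partition_function P \<tau> \<beta> h (\<lambda>n. \<omega> n y) N)) \<longlonglongrightarrow> c"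
  proof eventually_elim
    case (elim y)
    have "Z h N (\<lambda>n. \<omega> n y) = partition_function P \<tau> \<beta> h (\<lambda>n. \<omega> n y) N" for N
      unfolding partition_function_eq_pinned[OF renewal] Z_def
      by (intro pinned_cong) (simp add: weight_def elim(2) add.commute)
    then show ?case using elim(1) by simp
  qed
  show ?thesis unfolding free_energy_def
  proof (rule the_equality, rule ae)
    fix c' assume "AE y in M. (\<lambda>N. 1 / real N * ln (partition_function P \<tau> \<beta> h (\<lambda>n. \<omega> n y) N)) \<longlonglongrightarrow> c'"
    with ae have "AE y in M. c' = c" by eventually_elim (rule LIMSEQ_unique)
    then show "c' = c" by simp
  qed
qed

theorem theorem2p3:
  fixes \<alpha> \<gamma> C\<^sub>K C\<^sub>P :: real
    and K :: "nat \<Rightarrow> real"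
    and D :: "real measure"
  assumes "1 < \<gamma>" "\<gamma> < 2"
    and "0 < \<alpha>" "\<alpha> < 1 - 1 / \<gamma>"
    and "inter_arrival_law K \<alpha> C\<^sub>K"
    and "disorder_law D \<gamma> C\<^sub>P"
  shows "\<exists>\<beta>\<^sub>0::real. 0 < \<beta>\<^sub>0 \<and> \<beta>\<^sub>0 \<le> 1 \<and>
    (\<forall>(P :: 'a measure) (\<tau> :: nat \<Rightarrow> 'a \<Rightarrow> nat) (M :: 'b measure) (\<omega> :: nat \<Rightarrow> 'b \<Rightarrow> real).
       renewal_process P K \<tau> \<longrightarrow> iid_environment M D \<omega> \<longrightarrow>
       (\<forall>\<beta>. 0 < \<beta> \<and> \<beta> < \<beta>\<^sub>0 \<longrightarrow>
          critical_point P \<tau> M \<omega> \<beta> = 0 \<and>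
          ((\<lambda>h. ln (free_energy P \<tau> M \<omega> \<beta> h) / ln h) \<longlongrightarrow> 1 / \<alpha>) (at_right 0)))"
proof -
  have K: "\<And>n. 0 \<le> K n" "K 0 = 0" "K sums 1" using assms(5) by (auto simp: inter_arrival_law_def)
  have "0 < 1 / \<gamma>" using assms(1) by simp
  then have \<alpha>1: "\<alpha> < 1" using assms(4) by linarith
  interpret disorder D
    using assms(6) unfolding disorder_law_def disorder_def by blast
  \<comment> \<open>The hypothesis on \<alpha> amounts to
    \<open>1 / (1 - \<alpha>) < \<gamma>\<close>. A point strictly between gives a finite p-th
    moment of the disorder and a p-summable renewal mass at once.\<close>
  define p where "p = (1 / (1 - \<alpha>) + \<gamma>) / 2"
  have "1 / (1 - \<alpha>) < \<gamma>" using assms(1,4) \<alpha>1 by (simp add: field_simps)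
  then have p': "1 / (1 - \<alpha>) < p" "p < \<gamma>" by (auto simp: p_def)
  have "1 < 1 / (1 - \<alpha>)" using \<open>0 < \<alpha>\<close> \<alpha>1 by simp
  then have p: "1 < p" "p \<le> 2" using p' \<open>\<gamma> < 2\<close> by auto
  have p1: "1 < p * (1 - \<alpha>)" using p'(1) \<alpha>1 by (simp add: field_simps)
  have mom: "integrable D (\<lambda>y. \<bar>clip y\<bar> powr p)"
    using assms(6) p p' by (intro integrable_clip_powr[of C\<^sub>P \<gamma>]) (auto simp: disorder_law_def)
  have S: "summable (\<lambda>n. pinned K (\<lambda>_. 1) n powr p)"
    using p p1 \<alpha>1 assms by (intro summable_renewal_powr[of K \<alpha> C\<^sub>K]) auto
  define S where "S = (\<Sum>n. pinned K (\<lambda>_. 1) n powr p)"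
  define m where "m = (\<integral>y. \<bar>clip y\<bar> powr p \<partial>D)"
  \<comment> \<open>The threshold is \<open>1 / k\<close>: since
    \<open>\<beta> powr p \<le> \<beta> < 1 / k\<close>, the product
    \<open>2 * p * m * S * \<beta> powr p\<close> is at most 1/2, and \<open>+ 1\<close> keeps the
    threshold at most 1. It is built from \<open>K\<close> and \<open>D\<close> alone, before any
    process is fixed.\<close>
  define k where "k = 4 * p * m * S + 1"
  have S0: "0 \<le> S" unfolding S_def using S(1) by (intro suminf_nonneg) auto
  have m0: "0 \<le> m" by (simp add: m_def)
  have k: "1 \<le> k" using p S0 m0 by (simp add: k_def)
  obtain c0 C n0 where bounds: "0 < c0" "1 \<le> n0" "\<And>n. n0 \<le> n \<Longrightarrow> c0 * real n powr - (1 + \<alpha>) \<le> K n"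
    using inter_arrival_law_bounds[OF assms(5,3)] by metis
  obtain d where d: "0 < d" "\<And>n. 1 \<le> n \<Longrightarrow> d * real n powr - \<alpha> \<le> tail K n"
    using tail_lower[OF assms(5,3)] by metis
  show ?thesis
  proof (intro exI[of _ "1 / k"] conjI allI impI)
    show "0 < 1 / k" "1 / k \<le> 1" using k by auto
    fix P :: "'a measure" and \<tau> :: "nat \<Rightarrow> 'a \<Rightarrow> nat" and M :: "'b measure" and \<omega> :: "nat \<Rightarrow> 'b \<Rightarrow> real" and \<beta> :: real
    assume renewal: "renewal_process P K \<tau>" and env: "iid_environment M D \<omega>" and small: "0 < \<beta> \<and> \<beta> < 1 / k"
    have "1 / k \<le> 1" using k by simp
    then have \<beta>1: "\<beta> < 1" using small by linarith
    interpret pinning_tail D K \<beta> \<alpha> c0 n0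
      using K small \<beta>1 bounds assms(3) by unfold_locales auto
    have grow: "growth p * (\<Sum>n. pinned K (\<lambda>_. 1) n powr p) \<le> 1 / 2"
    proof -
      have "\<beta> powr p \<le> \<beta> powr 1" using small \<beta>1 p by (intro powr_mono') auto
      moreover have "\<beta> powr 1 = \<beta>" using small by simp
      ultimately have "\<beta> powr p \<le> 1 / k" using small by linarith
      then have "2 * p * m * S * \<beta> powr p \<le> 2 * p * m * S * (1 / k)"
        using p m0 S0 by (intro mult_left_mono) auto
      also have "\<dots> \<le> 1 / 2" using k by (simp add: k_def field_simps)
      finally show ?thesis by (simp add: growth_def m_def[symmetric] S_def[symmetric] mult_ac)
    qed
    define F where "F = free_energy P \<tau> M \<omega> \<beta>"
    have F: "\<And>N. n0 \<le> N \<Longrightarrow> mean_ln_Z h N \<le> F h * real N"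
      "\<And>G. (\<And>N. exp h * (\<Sum>n\<in>{1..N}. K n * exp (- G * real n)) \<le> 1) \<Longrightarrow> F h \<le> G" "0 \<le> F h" for h
    proof -
      obtain c where c: "AE w in envs. (\<lambda>N. ln (Z h N w) / real N) \<longlonglongrightarrow> c"
        "\<And>N. n0 \<le> N \<Longrightarrow> mean_ln_Z h N \<le> c * real N"
        "\<forall>G. (\<forall>N. exp h * (\<Sum>n\<in>{1..N}. K n * exp (- G * real n)) \<le> 1) \<longrightarrow> c \<le> G" "0 \<le> c"
        using free_energy_exists[of h] by blast
      have Fc: "F h = c" unfolding F_def by (rule free_energy_eq[OF renewal env c(1)])
      show "\<And>N. n0 \<le> N \<Longrightarrow> mean_ln_Z h N \<le> F h * real N"
        "\<And>G. (\<And>N. exp h * (\<Sum>n\<in>{1..N}. K n * exp (- G * real n)) \<le> 1) \<Longrightarrow> F h \<le> G" "0 \<le> F h"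
        unfolding Fc using c by blast+
    qed
    \<comment> \<open>For \<open>h \<le> 0\<close> the exponent 0 is admissible, because
      \<open>K\<close> has total mass 1.\<close>
    have F_nonpos: "F h \<le> 0" if "h \<le> 0" for h
    proof (rule F(2))
      fix N
      have "(\<Sum>n\<in>{1..N}. K n) \<le> 1" using sum_le_suminf[of K "{1..N}"] K by (auto simp: sums_iff)
      then have "exp h * (\<Sum>n\<in>{1..N}. K n) \<le> 1 * 1" using that K by (intro mult_mono sum_nonneg) auto
      then show "exp h * (\<Sum>n\<in>{1..N}. K n * exp (- 0 * real n)) \<le> 1" by simp
    qed
    have lower: "\<forall>\<^sub>F h in at_right 0. h powr (1 / t) / 4 \<le> F h" if t: "0 < t" "t < \<alpha>" for t
    proof -
      define s where "s = (t + \<alpha>) / 2"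
      have s: "t < s" "s < \<alpha>" "s \<le> 1" using t \<alpha>1 by (auto simp: s_def)
      obtain M where "(\<lambda>n. K n * real n powr s) sums M"
        using summable_moment[OF assms(5,3) s(2)] by blast
      then show ?thesis by (rule free_energy_lower[OF p mom S grow t(1) s(1,3) _ F(1)])
    qed
    define e where "e = d * 2 powr - (1 + \<alpha>)"
    have e: "0 < e" using d by (simp add: e_def)
    have upper: "\<forall>\<^sub>F h in at_right 0. F h \<le> (h / e) powr (1 / \<alpha>)"
      using eventually_at_right_real[OF e]
    proof eventually_elim
      case (elim h)
      then show ?case unfolding e_def
        by (intro F(2) pure_exponent_admissible[OF K(1,3) assms(3) d]) auto
    qed
    show "((\<lambda>h. ln (free_energy P \<tau> M \<omega> \<beta> h) / ln h) \<longlongrightarrow> 1 / \<alpha>) (at_right 0)"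
      unfolding F_def[symmetric] by (rule tendsto_log_ratio[OF assms(3) e upper lower])
    \<comment> \<open>The lower bound makes the free energy positive at arbitrarily small
      \<open>h > 0\<close>, which together with \<open>F_nonpos\<close> puts the infimum at
      0.\<close>
    have pos: "\<exists>h<\<epsilon>. 0 < F h" if "0 < \<epsilon>" for \<epsilon>
    proof -
      have "\<forall>\<^sub>F h in at_right 0. h powr (1 / (\<alpha> / 2)) / 4 \<le> F h \<and> h \<in> {0<..<\<epsilon>}"
        using lower[of "\<alpha> / 2"] assms(3) by (intro eventually_conj eventually_at_right_real that) auto
      then have "\<exists>h. h powr (1 / (\<alpha> / 2)) / 4 \<le> F h \<and> h \<in> {0<..<\<epsilon>}"
        by (rule eventually_happens'[OF trivial_limit_at_right_real])
      then obtain h where "h powr (1 / (\<alpha> / 2)) / 4 \<le> F h" "0 < h" "h < \<epsilon>" by auto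
      moreover from this have "0 < h powr (1 / (\<alpha> / 2)) / 4" by simp
      ultimately show ?thesis by (intro exI[of _ h]) linarith
    qed
    show "critical_point P \<tau> M \<omega> \<beta> = 0"
      unfolding critical_point_def F_def[symmetric]
    proof (rule cInf_eq_non_empty)
      show "{h. 0 < F h} \<noteq> {}" using pos[of 1] by auto
      show "0 \<le> x" if "x \<in> {h. 0 < F h}" for x using F_nonpos[of x] that by (cases "x \<le> 0") auto
      show "y \<le> 0" if "\<And>x. x \<in> {h. 0 < F h} \<Longrightarrow> y \<le> x" for y
      proof (rule ccontr)
        assume "\<not> y \<le> 0"
        then obtain h where "h < y" "0 < F h" using pos[of y] by auto
        then show False using that[of h] by simp
      qed
    qed
  qed
qed

end
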